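(* Let $p$ be a prime, $l\geq 1$ an integer and $d=p^l$. Then the extension in $\mathcal{F}(\mathsf{ab};\mathbb{Z})$ $$0\to S^{d}\to E_{d}\to I\to 0,$$ induced by the usual inclusion $S^d(s)\hookrightarrow S^d(s)\oplus I(s)$ and the usual projection $S^d(s)\oplus I(s)\twoheadrightarrow I(s)$, is a generator of $\mathrm{Ext}^{1}_{\mathcal{F}(\mathsf{ab};\mathbb{Z})}(I,S^{d})\cong\mathbb{Z}/p$.
   Context: $\mathsf{ab}$ is the category of finitely generated free abelian groups and homomorphisms, with objects (up to isomorphism) labelled by $n\in\mathbb{N}=\{0,1,2,\dots\}$, $n$ standing for $\mathbb{Z}^n$ with canonical basis $e_1,\dots,e_n$. $\mathcal{F}(\mathsf{ab};\mathbb{Z})$ is the category of functors from $\mathsf{ab}$ to the category $\mathsf{Ab}$ of abelian groups, $I:\mathsf{ab}\to\mathsf{Ab}$ is the inclusion, and $S^d:\mathsf{ab}\to\mathsf{Ab}$ is the $d$-th symmetric power. Consider the following morphisms of $\mathsf{ab}$: $\epsilon:1\to 0$ and $\eta:0\to 1$ (zero maps), $\Delta:1\to 2$ the diagonal, $\nabla:2\to 1$, $(x,y)\mapsto x+y$, $S:1\to 1$, $x\mapsto -x$, $\tau:2\to 2$ exchanging the two generators. For $f$ one of these and $n,m\in\mathbb{N}$ put ${}_n[f]_m=\mathrm{id}_n\oplus f\oplus\mathrm{id}_m$. These morphisms generate $\mathsf{ab}$ under composition (Pirashvili). For $d=p^l$, $E_d:\mathsf{ab}\to\mathsf{Ab}$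 is the (unique) functor with $E_d(s)=S^d(s)\oplus I(s)$ for $s\in\mathbb{N}$ and, for each generating morphism $g={}_n[f]_m:s\to t$, $$E_d(g)=\begin{pmatrix}S^d(g)&D_d(g)\\0&I(g)\end{pmatrix},$$ where $D_d(g):I(s)\to S^d(t)$ is the homomorphism given as follows: $D_d({}_n[S]_m)$ sends $e_{n+1}$ to $\frac{1+(-1)^d}{p}e_{n+1}^d$ and every other $e_i$ to $0$; $D_d({}_n[\Delta]_m)$ sends $e_{n+1}$ to $\sum_{k=1}^{d-1}\frac1p\binom{p^l}{k}e_{n+1}^ke_{n+2}^{d-k}$ and every other $e_i$ to $0$; and $D_d(g)=0$ for all other generating morphisms. *)

theory Defs
  imports
    "HOL-Algebra.Elementary_Groups"
    "HOL-Algebra.Free_Abelian_Groups"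
    "HOL-Library.Poly_Mapping"
    "HOL-Computational_Algebra.Primes"
    "Jordan_Normal_Form.Matrix"
begin

section \<open>Functors from finitely generated free abelian groups to abelian groups\<close>

text \<open>The category of finitely generated free abelian groups is used in its skeletal form:
  objects are natural numbers, a morphism \<open>s \<rightarrow> t\<close> is an integer matrix in
  \<open>carrier_mat t s\<close> acting on column vectors, and composition is matrix multiplication.
  Matrices remember their dimensions, also when one of them is 0, so a matrix determines its
  source and target. The canonical basis vectors are the \<open>unit_vec s i\<close> with
  \<open>i < s\<close>, counted from 0.\<close>

record 'a ab_functor =
  obj :: "nat \<Rightarrow> 'a monoid"
  arr :: "int mat \<Rightarrow> 'a \<Rightarrow> 'a"

text \<open>The maps are required to be \<open>undefined\<close> outside the carrier of their domain,
  so that equality of the action on morphisms is equality of homomorphisms.\<close>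

definition is_ab_functor :: "'a ab_functor \<Rightarrow> bool" where
  "is_ab_functor F \<longleftrightarrow>
     (\<forall>n. comm_group (obj F n)) \<and>
     (\<forall>s t. \<forall>M \<in> carrier_mat t s.
        arr F M \<in> hom (obj F s) (obj F t) \<inter> extensional (carrier (obj F s))) \<and>
     (\<forall>n. \<forall>x \<in> carrier (obj F n). arr F (1\<^sub>m n) x = x) \<and>
     (\<forall>r s t. \<forall>M \<in> carrier_mat s r. \<forall>N \<in> carrier_mat t s. \<forall>x \<in> carrier (obj F r).
        arr F (N * M) x = arr F N (arr F M x))"

definition nat_trans :: "'a ab_functor \<Rightarrow> 'b ab_functor \<Rightarrow> (nat \<Rightarrow> 'a \<Rightarrow> 'b) \<Rightarrow> bool" where
  "nat_trans F G \<theta> \<longleftrightarrow>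
     (\<forall>n. \<theta> n \<in> hom (obj F n) (obj G n)) \<and>
     (\<forall>s t. \<forall>M \<in> carrier_mat t s. \<forall>x \<in> carrier (obj F s).
        \<theta> t (arr F M x) = arr G M (\<theta> s x))"


section \<open>Extensions of functors and the group of their equivalence classes\<close>

record ('a, 'b, 'c) fun_ext =
  middle :: "'b ab_functor"
  inc :: "nat \<Rightarrow> 'a \<Rightarrow> 'b"
  prj :: "nat \<Rightarrow> 'b \<Rightarrow> 'c"

text \<open>\<open>is_extension C A X\<close>: X is a short exact sequence \<open>0 \<rightarrow> A \<rightarrow> E \<rightarrow> C \<rightarrow> 0\<close> of functors;
  exactness in the functor category is objectwise. (The constant \<open>short_exact_sequence\<close>
  of the library needs all three groups to have the same type.)\<close>

definition is_extension :: "'c ab_functor \<Rightarrow> 'a ab_functor \<Rightarrow> ('a, 'b, 'c) fun_ext \<Rightarrow> bool" where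
  "is_extension C A X \<longleftrightarrow>
     is_ab_functor (middle X) \<and>
     nat_trans A (middle X) (inc X) \<and> nat_trans (middle X) C (prj X) \<and>
     (\<forall>n. inc X n \<in> mon (obj A n) (obj (middle X) n) \<and>
          prj X n \<in> epi (obj (middle X) n) (obj C n) \<and>
          inc X n ` carrier (obj A n) = kernel (obj (middle X) n) (obj C n) (prj X n))"

definition ext_equiv ::
  "'c ab_functor \<Rightarrow> 'a ab_functor \<Rightarrow> ('a, 'b, 'c) fun_ext \<Rightarrow> ('a, 'd, 'c) fun_ext \<Rightarrow> bool" where
  "ext_equiv C A X Y \<longleftrightarrow>
     (\<exists>\<theta>. nat_trans (middle X) (middle Y) \<theta> \<and>
          (\<forall>n. \<theta> n \<in> iso (obj (middle X) n) (obj (middle Y) n)) \<and>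
          (\<forall>n. \<forall>a \<in> carrier (obj A n). \<theta> n (inc X n a) = inc Y n a) \<and>
          (\<forall>n. \<forall>e \<in> carrier (obj (middle X) n). prj Y n (\<theta> n e) = prj X n e))"

definition pullback_fun ::
  "('a, 'b, 'c) fun_ext \<Rightarrow> ('a, 'd, 'c) fun_ext \<Rightarrow> nat \<Rightarrow> ('b \<times> 'd) monoid" where
  "pullback_fun X Y n =
     (obj (middle X) n \<times>\<times> obj (middle Y) n)
       \<lparr>carrier := {(x, y). x \<in> carrier (obj (middle X) n) \<and> y \<in> carrier (obj (middle Y) n) \<and>
                            prj X n x = prj Y n y}\<rparr>"

definition skew_diagonal ::
  "'a ab_functor \<Rightarrow> ('a, 'b, 'c) fun_ext \<Rightarrow> ('a, 'd, 'c) fun_ext \<Rightarrow> nat \<Rightarrow> ('b \<times> 'd) set" where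
  "skew_diagonal A X Y n =
     (\<lambda>a. (inc X n a, inv\<^bsub>obj (middle Y) n\<^esub> (inc Y n a))) ` carrier (obj A n)"

text \<open>The Baer sum: the quotient of the pullback over C by the skew-diagonal copy of A.
  Elements of the quotient are cosets; \<open>the_elem\<close> picks the common value on a coset.\<close>

definition baer_sum ::
  "'a ab_functor \<Rightarrow> ('a, 'b, 'c) fun_ext \<Rightarrow> ('a, 'd, 'c) fun_ext \<Rightarrow> ('a, ('b \<times> 'd) set, 'c) fun_ext" where
  "baer_sum A X Y =
     \<lparr>middle =
        \<lparr>obj = (\<lambda>n. pullback_fun X Y n Mod skew_diagonal A X Y n),
         arr = (\<lambda>M. \<lambda>K \<in> carrier (pullback_fun X Y (dim_col M) Mod skew_diagonal A X Y (dim_col M)).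
                  the_elem ((\<lambda>(x, y). skew_diagonal A X Y (dim_row M)
                       #>\<^bsub>pullback_fun X Y (dim_row M)\<^esub> (arr (middle X) M x, arr (middle Y) M y)) ` K))\<rparr>,
      inc = (\<lambda>n a. skew_diagonal A X Y n
                #>\<^bsub>pullback_fun X Y n\<^esub> (inc X n a, \<one>\<^bsub>obj (middle Y) n\<^esub>)),
      prj = (\<lambda>n K. the_elem ((\<lambda>(x, y). prj X n x) ` K))\<rparr>"

definition direct_sum :: "'a ab_functor \<Rightarrow> 'c ab_functor \<Rightarrow> ('a \<times> 'c) ab_functor" where
  "direct_sum A C =
     \<lparr>obj = (\<lambda>n. obj A n \<times>\<times> obj C n),
      arr = (\<lambda>M. \<lambda>(x, y) \<in> carrier (obj A (dim_col M) \<times>\<times> obj C (dim_col M)).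
               (arr A M x, arr C M y))\<rparr>"

text \<open>The usual inclusion and projection, for any functor whose value at each n is the group
  \<open>A(n) \<oplus> C(n)\<close>, whatever its action on morphisms.\<close>

definition sum_ext :: "'c ab_functor \<Rightarrow> ('a \<times> 'c) ab_functor \<Rightarrow> ('a, 'a \<times> 'c, 'c) fun_ext" where
  "sum_ext C E = \<lparr>middle = E, inc = (\<lambda>n a. (a, \<one>\<^bsub>obj C n\<^esub>)), prj = (\<lambda>n e. snd e)\<rparr>"

text \<open>Equivalence classes are formed among extensions whose middle groups have elements of type
  \<open>'a \<times> 'c\<close>. This loses no extension: a set-theoretic section of
  \<open>E(n) \<rightarrow> C(n)\<close> identifies the set \<open>E(n)\<close> with \<open>A(n) \<times> C(n)\<close>,
  so every extension, of whatever type, is equivalent to one of this type; see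
  \<open>extension_transport\<close> below.\<close>

definition ext_class ::
  "'c ab_functor \<Rightarrow> 'a ab_functor \<Rightarrow> ('a, 'b, 'c) fun_ext \<Rightarrow> ('a, 'a \<times> 'c, 'c) fun_ext set" where
  "ext_class C A X = {Y. is_extension C A Y \<and> ext_equiv C A X Y}"

lemma extension_transport:
  fixes X :: "('a, 'b, 'c) fun_ext"
  assumes C: "is_ab_functor C" and X: "is_extension C A X"
  shows "\<exists>Y :: ('a, 'a \<times> 'c, 'c) fun_ext. is_extension C A Y \<and> ext_equiv C A X Y"
proof -
  define E where "E = middle X"
  have fE: "is_ab_functor E" and ni: "nat_trans A E (inc X)" and np: "nat_trans E C (prj X)"
    and mono: "\<And>n. inc X n \<in> mon (obj A n) (obj E n)"
    and epi: "\<And>n. prj X n \<in> epi (obj E n) (obj C n)"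
    and ker: "\<And>n. inc X n ` carrier (obj A n) = kernel (obj E n) (obj C n) (prj X n)"
    using X by (auto simp: is_extension_def E_def)
  have cg: "comm_group (obj E n)" and cC: "comm_group (obj C n)" for n
    using fE C by (simp_all add: is_ab_functor_def)
  have "\<exists>f :: 'b \<Rightarrow> 'a \<times> 'c. inj_on f (carrier (obj E n))" for n
  proof -
    interpret G: comm_group "obj E n" by (rule cg)
    interpret H: comm_group "obj C n" by (rule cC)
    interpret q: group_hom "obj E n" "obj C n" "prj X n"
      using np by unfold_locales (simp add: nat_trans_def)
    define s where "s c = (SOME e. e \<in> carrier (obj E n) \<and> prj X n e = c)" for c
    have s: "s (prj X n e) \<in> carrier (obj E n) \<and> prj X n (s (prj X n e)) = prj X n e"
      if "e \<in> carrier (obj E n)" for e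
      unfolding s_def by (rule someI) (use that in auto)
    have k: "e \<otimes>\<^bsub>obj E n\<^esub> inv\<^bsub>obj E n\<^esub> s (prj X n e) \<in> inc X n ` carrier (obj A n)"
      if "e \<in> carrier (obj E n)" for e
      using s[OF that] that by (auto simp: ker kernel_def)
    have "inj_on (\<lambda>e. (inv_into (carrier (obj A n)) (inc X n)
             (e \<otimes>\<^bsub>obj E n\<^esub> inv\<^bsub>obj E n\<^esub> s (prj X n e)), prj X n e)) (carrier (obj E n))"
    proof (rule inj_onI, clarify)
      fix x y assume xy: "x \<in> carrier (obj E n)" "y \<in> carrier (obj E n)"
        "prj X n x = prj X n y"
        "inv_into (carrier (obj A n)) (inc X n) (x \<otimes>\<^bsub>obj E n\<^esub> inv\<^bsub>obj E n\<^esub> s (prj X n x)) =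
         inv_into (carrier (obj A n)) (inc X n) (y \<otimes>\<^bsub>obj E n\<^esub> inv\<^bsub>obj E n\<^esub> s (prj X n y))"
      have "x \<otimes>\<^bsub>obj E n\<^esub> inv\<^bsub>obj E n\<^esub> s (prj X n x) = y \<otimes>\<^bsub>obj E n\<^esub> inv\<^bsub>obj E n\<^esub> s (prj X n y)"
        using inv_into_injective[OF xy(4) k[OF xy(1)] k[OF xy(2)]] .
      with xy s show "x = y" by (metis G.inv_closed G.right_cancel)
    qed
    thus ?thesis by blast
  qed
  then obtain f :: "nat \<Rightarrow> 'b \<Rightarrow> 'a \<times> 'c" where f: "\<And>n. inj_on (f n) (carrier (obj E n))"
    by metis
  define g where "g n = inv_into (carrier (obj E n)) (f n)" for n
  have gf [simp]: "g n (f n x) = x" if "x \<in> carrier (obj E n)" for n x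
    using f that by (simp add: g_def)
  define O' where "O' n = \<lparr>carrier = f n ` carrier (obj E n),
      monoid.mult = (\<lambda>x y. f n (g n x \<otimes>\<^bsub>obj E n\<^esub> g n y)), one = f n \<one>\<^bsub>obj E n\<^esub>\<rparr>" for n
  define F where "F = \<lparr>obj = O', arr = (\<lambda>M. \<lambda>x \<in> carrier (O' (dim_col M)).
      f (dim_row M) (arr E M (g (dim_col M) x)))\<rparr>"
  have objF: "obj F = O'" by (simp add: F_def)
  have car: "carrier (O' n) = f n ` carrier (obj E n)" for n by (simp add: O'_def)
  have arrE: "arr E M x \<in> carrier (obj E t)"
    "arr E M (x \<otimes>\<^bsub>obj E s\<^esub> y) = arr E M x \<otimes>\<^bsub>obj E t\<^esub> arr E M y"
    if "M \<in> carrier_mat t s" "x \<in> carrier (obj E s)" "y \<in> carrier (obj E s)" for M s t x y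
    using fE that by (auto simp: is_ab_functor_def hom_def Pi_iff)
  have arrF: "arr F M (f s x) = f t (arr E M x)"
    if "M \<in> carrier_mat t s" "x \<in> carrier (obj E s)" for M s t x
    using that by (auto simp: F_def car)
  have iso: "f n \<in> iso (obj E n) (O' n)" for n
  proof -
    interpret comm_group "obj E n" by (rule cg)
    show ?thesis using f by (auto simp: iso_def hom_def O'_def bij_betw_def)
  qed
  have cO: "comm_group (O' n)" for n
  proof -
    interpret comm_group "obj E n" by (rule cg)
    show ?thesis
    proof (rule comm_groupI)
      fix x assume "x \<in> carrier (O' n)"
      then obtain y where y: "y \<in> carrier (obj E n)" "x = f n y" by (auto simp: car)
      show "\<exists>z\<in>carrier (O' n). z \<otimes>\<^bsub>O' n\<^esub> x = \<one>\<^bsub>O' n\<^esub>"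
        by (rule bexI[of _ "f n (inv\<^bsub>obj E n\<^esub> y)"]) (use y in \<open>auto simp: O'_def\<close>)
    qed (auto simp: O'_def m_ac)
  qed
  have fF: "is_ab_functor F"
    unfolding is_ab_functor_def objF
  proof (intro conjI allI ballI)
    show "comm_group (O' n)" for n by (rule cO)
    show "arr F (1\<^sub>m n) x = x" if "x \<in> carrier (O' n)" for n x
      using that fE by (auto simp: car arrF[of _ n] is_ab_functor_def)
    show "arr F M \<in> hom (O' s) (O' t) \<inter> extensional (carrier (O' s))"
      if M: "M \<in> carrier_mat t s" for M s t
    proof
      interpret comm_group "obj E s" by (rule cg)
      show "arr F M \<in> hom (O' s) (O' t)"
        by (rule homI) (auto simp: car arrF[OF M] arrE[OF M] O'_def)
      show "arr F M \<in> extensional (carrier (O' s))" using M by (auto simp: F_def)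
    qed
    show "arr F (N * M) x = arr F N (arr F M x)"
      if "M \<in> carrier_mat s r" "N \<in> carrier_mat t s" "x \<in> carrier (O' r)" for M N x r s t
    proof -
      from that obtain y where y: "y \<in> carrier (obj E r)" "x = f r y" by (auto simp: car)
      have "N * M \<in> carrier_mat t r" using that by auto
      with that y fE show ?thesis
        by (simp add: arrF[of _ t r] arrF[of _ s r] arrF[of _ t s] arrE(1)[of M s r])
           (simp add: is_ab_functor_def)
    qed
  qed
  define Y where "Y = \<lparr>middle = F, inc = (\<lambda>n a. f n (inc X n a)), prj = (\<lambda>n e. prj X n (g n e))\<rparr>"
  have inE: "inc X n a \<in> carrier (obj E n)" if "a \<in> carrier (obj A n)" for n a
    using mono[of n] that by (auto simp: mon_def hom_def)
  have "is_extension C A Y"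
    unfolding is_extension_def
  proof (intro conjI allI)
    have 1: "inc Y n \<in> hom (obj A n) (O' n)" for n
      using hom_compose[of "inc X n" "obj A n" "obj E n" "f n" "O' n"] mono[of n] iso[of n]
      by (simp add: Y_def mon_def iso_def comp_def)
    have 2: "prj Y n \<in> hom (O' n) (obj C n)" for n
    proof -
      interpret comm_group "obj E n" by (rule cg)
      show ?thesis using epi[of n] by (auto simp: Y_def epi_def hom_def O'_def)
    qed
    show "is_ab_functor (middle Y)" by (simp add: Y_def fF)
    show "nat_trans A (middle Y) (inc Y)"
      using ni 1 by (auto simp: nat_trans_def Y_def objF arrF inE)
    show "nat_trans (middle Y) C (prj Y)"
      using np 2 by (auto simp: nat_trans_def Y_def objF arrF arrE car)
    fix n
    show "inc Y n \<in> mon (obj A n) (obj (middle Y) n)"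
      using 1[of n] mono[of n] f[of n] inE
      by (auto simp: mon_def Y_def objF inj_on_def)
    show "prj Y n \<in> epi (obj (middle Y) n) (obj C n)"
      using 2[of n] epi[of n] by (auto simp: epi_def Y_def objF car image_image)
    show "inc Y n ` carrier (obj A n) = kernel (obj (middle Y) n) (obj C n) (prj Y n)"
    proof -
      have "inc Y n ` carrier (obj A n) = f n ` kernel (obj E n) (obj C n) (prj X n)"
        by (simp add: Y_def ker[symmetric] image_image)
      also have "\<dots> = kernel (obj (middle Y) n) (obj C n) (prj Y n)"
        by (auto simp: kernel_def Y_def objF car)
      finally show ?thesis .
    qed
  qed
  moreover have "ext_equiv C A X Y"
    unfolding ext_equiv_def
    by (rule exI[of _ f])
       (use iso in \<open>auto simp: nat_trans_def Y_def objF E_def[symmetric] arrF iso_def\<close>)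
  ultimately show ?thesis by blast
qed

definition Ext1 :: "'c ab_functor \<Rightarrow> 'a ab_functor \<Rightarrow> ('a, 'a \<times> 'c, 'c) fun_ext set monoid" where
  "Ext1 C A =
     \<lparr>carrier = ext_class C A ` {X :: ('a, 'a \<times> 'c, 'c) fun_ext. is_extension C A X},
      monoid.mult = (\<lambda>U V. \<Union>X \<in> U. \<Union>Y \<in> V. ext_class C A (baer_sum A X Y)),
      one = ext_class C A (sum_ext C (direct_sum A C))\<rparr>"


section \<open>The inclusion functor and the symmetric powers\<close>

definition incl_functor :: "int vec ab_functor" where
  "incl_functor =
     \<lparr>obj = (\<lambda>n. \<lparr>carrier = carrier_vec n, monoid.mult = (+), one = 0\<^sub>v n\<rparr>),
      arr = (\<lambda>M. \<lambda>v \<in> carrier_vec (dim_col M). M *\<^sub>v v)\<rparr>"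

text \<open>The symmetric algebra of the free abelian group on \<open>e\<^sub>0, \<dots>, e\<^bsub>n-1\<^esub>\<close> is the
  polynomial ring over the integers in these variables, and its d-th symmetric power is the
  group of homogeneous polynomials of degree d; the universal property is proved below as
  \<open>sym_group_universal\<close>. A polynomial is a finitely supported
  function from exponents \<open>nat \<Rightarrow>\<^sub>0 nat\<close> to coefficients, with the (convolution) product
  of \<open>HOL-Library.Poly_Mapping\<close>.\<close>

type_synonym ipoly = "(nat \<Rightarrow>\<^sub>0 nat) \<Rightarrow>\<^sub>0 int"

definition gen :: "nat \<Rightarrow> ipoly" where
  "gen i = Poly_Mapping.single (Poly_Mapping.single i 1) 1"

definition sym_group :: "nat \<Rightarrow> nat \<Rightarrow> ipoly monoid" where
  "sym_group d n =
     \<lparr>carrier = {P. \<forall>m \<in> Poly_Mapping.keys P. Poly_Mapping.keys m \<subseteq> {..<n} \<and> (\<Sum>i \<in> Poly_Mapping.keys m. Poly_Mapping.lookup m i) = d},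
      monoid.mult = (+), one = 0\<rparr>"

text \<open>The ring homomorphism sending the i-th generator to the i-th column of M.\<close>

definition subst_mat :: "int mat \<Rightarrow> ipoly \<Rightarrow> ipoly" where
  "subst_mat M P =
     (\<Sum>m \<in> Poly_Mapping.keys P. of_int (Poly_Mapping.lookup P m) *
        (\<Prod>i \<in> Poly_Mapping.keys m. (\<Sum>j < dim_row M. of_int (M $$ (j, i)) * gen j) ^ Poly_Mapping.lookup m i))"

definition sym_functor :: "nat \<Rightarrow> ipoly ab_functor" where
  "sym_functor d =
     \<lparr>obj = sym_group d,
      arr = (\<lambda>M. \<lambda>P \<in> carrier (sym_group d (dim_col M)). subst_mat M P)\<rparr>"

definition sym_exps :: "nat \<Rightarrow> nat \<Rightarrow> (nat \<Rightarrow>\<^sub>0 nat) set" where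
  "sym_exps d n = {m. Poly_Mapping.keys m \<subseteq> {..<n} \<and>
     (\<Sum>i \<in> Poly_Mapping.keys m. Poly_Mapping.lookup m i) = d}"

lemma sym_group_eq: "sym_group d n = free_Abelian_group (sym_exps d n)"
  by (auto simp: sym_group_def free_Abelian_group_def sym_exps_def)

lemma sym_exps_iff:
  "m \<in> sym_exps d n \<longleftrightarrow> Poly_Mapping.keys m \<subseteq> {..<n} \<and> (\<Sum>i<n. Poly_Mapping.lookup m i) = d"
proof -
  have "(\<Sum>i \<in> Poly_Mapping.keys m. Poly_Mapping.lookup m i) = (\<Sum>i<n. Poly_Mapping.lookup m i)"
    if "Poly_Mapping.keys m \<subseteq> {..<n}"
    by (rule sum.mono_neutral_left) (use that in \<open>auto simp: in_keys_iff\<close>)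
  thus ?thesis by (auto simp: sym_exps_def)
qed

lemma sym_exps_add: "a \<in> sym_exps c n \<Longrightarrow> b \<in> sym_exps d n \<Longrightarrow> a + b \<in> sym_exps (c + d) n"
  using keys_add[of a b] by (auto simp: sym_exps_iff lookup_add sum.distrib)

lemma sym_group_mult:
  assumes "P \<in> carrier (sym_group c n)" "Q \<in> carrier (sym_group d n)"
  shows "P * Q \<in> carrier (sym_group (c + d) n)"
proof -
  have "Poly_Mapping.keys P \<subseteq> sym_exps c n" "Poly_Mapping.keys Q \<subseteq> sym_exps d n"
    using assms by (auto simp: sym_group_eq)
  hence "Poly_Mapping.keys (P * Q) \<subseteq> sym_exps (c + d) n"
    using keys_mult[of P Q] sym_exps_add by blast
  thus ?thesis by (simp add: sym_group_eq)
qed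

lemma sym_group_sum:
  assumes "\<And>i. i \<in> I \<Longrightarrow> P i \<in> carrier (sym_group d n)"
  shows "(\<Sum>i\<in>I. P i) \<in> carrier (sym_group d n)"
proof -
  have "Poly_Mapping.keys (\<Sum>i\<in>I. P i) \<subseteq> sym_exps d n"
    using keys_sum[of P I] assms by (fastforce simp: sym_group_eq)
  thus ?thesis by (simp add: sym_group_eq)
qed

definition lin_form :: "nat \<Rightarrow> int vec \<Rightarrow> ipoly" where
  "lin_form n v = (\<Sum>j<n. of_int (v $ j) * gen j)"

lemma gen_sym_group: "i < n \<Longrightarrow> gen i \<in> carrier (sym_group 1 n)"
  by (auto simp: sym_group_def gen_def)

lemma of_int_sym_group: "of_int z \<in> carrier (sym_group 0 n)"
proof -
  have "of_int z = (Poly_Mapping.single 0 z :: ipoly)" by (metis id_apply of_int_eq_id single_of_int)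
  thus ?thesis by (auto simp: sym_group_def)
qed

lemma lin_sym_group: "lin_form n v \<in> carrier (sym_group 1 n)"
  unfolding lin_form_def
  by (rule sym_group_sum) (use sym_group_mult[OF of_int_sym_group gen_sym_group] in auto)

lemma prod_lin_sym_group: "(\<Prod>v\<leftarrow>vs. lin_form n v) \<in> carrier (sym_group (length vs) n)"
proof (induction vs)
  case Nil
  show ?case using of_int_sym_group[of 1 n] by simp
next
  case (Cons v vs)
  show ?case using sym_group_mult[OF lin_sym_group Cons] by simp
qed

lemma lin_unit: "i < n \<Longrightarrow> lin_form n (unit_vec n i) = gen i"
proof -
  assume i: "i < n"
  have "lin_form n (unit_vec n i) = (\<Sum>j<n. if j = i then gen j else 0)"
    unfolding lin_form_def by (rule sum.cong) (auto simp: i)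
  thus ?thesis using i by simp
qed

lemma prod_gen: "(\<Prod>i\<leftarrow>js. gen i) = frag_of (\<Sum>i\<leftarrow>js. Poly_Mapping.single i 1)"
  by (induction js) (auto simp: gen_def mult_single)

lemma lookup_index_list:
  "Poly_Mapping.lookup (\<Sum>i\<leftarrow>js. Poly_Mapping.single i (1::nat)) j = count (mset js) j"
  by (induction js) (auto simp: lookup_add lookup_single when_def simp del: One_nat_def)

lemma prod_gen_lin:
  "set js \<subseteq> {..<n} \<Longrightarrow> (\<Prod>i\<leftarrow>js. gen i) = (\<Prod>v\<leftarrow>map (unit_vec n) js. lin_form n v)"
  by (induction js) (auto simp: lin_unit)

definition index_list :: "(nat \<Rightarrow>\<^sub>0 nat) \<Rightarrow> nat list" where
  "index_list m = (SOME js. (\<Sum>i\<leftarrow>js. Poly_Mapping.single i 1) = m)"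

lemma index_list: "(\<Sum>i\<leftarrow>index_list m. Poly_Mapping.single i 1) = m"
proof -
  obtain js where js: "mset js = (\<Sum>i\<in>Poly_Mapping.keys m. replicate_mset (Poly_Mapping.lookup m i) i)"
    using ex_mset by blast
  have "(\<Sum>i\<leftarrow>js. Poly_Mapping.single i 1) = m"
    by (rule poly_mapping_eqI)
       (auto simp: lookup_index_list js count_sum in_keys_iff simp del: One_nat_def)
  thus ?thesis unfolding index_list_def by (rule someI)
qed

lemma index_list_in:
  assumes "m \<in> sym_exps d n"
  shows "set (index_list m) \<subseteq> {..<n}" "length (index_list m) = d"
proof -
  have c: "Poly_Mapping.lookup m j = count (mset (index_list m)) j" for j
    using lookup_index_list[of "index_list m" j] by (simp add: index_list del: One_nat_def)
  show s: "set (index_list m) \<subseteq> {..<n}"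
  proof
    fix j assume "j \<in> set (index_list m)"
    hence "j \<in> Poly_Mapping.keys m" using c[of j] by (simp add: in_keys_iff)
    thus "j \<in> {..<n}" using assms by (auto simp: sym_exps_iff)
  qed
  have "length (index_list m) = size (mset (index_list m))" by simp
  also have "\<dots> = (\<Sum>i\<in>set (index_list m). count (mset (index_list m)) i)"
    by (simp add: size_multiset_overloaded_eq)
  also have "\<dots> = (\<Sum>i<n. count (mset (index_list m)) i)"
    by (rule sum.mono_neutral_left) (use s in \<open>auto simp: count_eq_zero_iff\<close>)
  finally show "length (index_list m) = d" using assms by (simp add: c[symmetric] sym_exps_iff)
qed

lemma hom_vec_eqI:
  assumes G: "comm_group G"
    and a: "a \<in> hom (obj incl_functor n) G" and b: "b \<in> hom (obj incl_functor n) G"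
    and u: "\<And>i. i < n \<Longrightarrow> a (unit_vec n i) = b (unit_vec n i)"
    and v: "v \<in> carrier_vec n"
  shows "a v = b v"
proof -
  interpret G: comm_group G by (rule G)
  have car: "a x \<in> carrier G" "b x \<in> carrier G" if "x \<in> carrier_vec n" for x
    using a b that by (auto simp: hom_def incl_functor_def)
  have am: "a (x + y) = a x \<otimes>\<^bsub>G\<^esub> a y" "b (x + y) = b x \<otimes>\<^bsub>G\<^esub> b y"
    if "x \<in> carrier_vec n" "y \<in> carrier_vec n" for x y
    using a b that by (auto simp: hom_def incl_functor_def)
  have a0: "a (0\<^sub>v n) = \<one>\<^bsub>G\<^esub>" "b (0\<^sub>v n) = \<one>\<^bsub>G\<^esub>"
    using car[of "0\<^sub>v n"] am[of "0\<^sub>v n" "0\<^sub>v n"] by (metis G.r_cancel_one' right_zero_vec zero_carrier_vec)+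
  have add: "a (x + y) = b (x + y)"
    if "x \<in> carrier_vec n" "y \<in> carrier_vec n" "a x = b x" "a y = b y" for x y
    using that by (simp add: am)
  have sub: "a x = b x" if "x \<in> carrier_vec n" "y \<in> carrier_vec n" "a (x + y) = b (x + y)" "a y = b y" for x y
    using that car[of x] car[of y] by (simp add: am)
  have smult: "a (z \<cdot>\<^sub>v unit_vec n i) = b (z \<cdot>\<^sub>v unit_vec n i)" if i: "i < n" for z i
  proof (induction z rule: int_induct[where k = 0])
    case base
    have "(0::int) \<cdot>\<^sub>v unit_vec n i = 0\<^sub>v n" by auto
    thus ?case by (simp only: a0)
  next
    case (step1 z)
    have "(z + 1) \<cdot>\<^sub>v unit_vec n i = z \<cdot>\<^sub>v unit_vec n i + unit_vec n i"
      by (rule eq_vecI) (simp_all add: algebra_simps)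
    with step1 u[OF i] show ?case by (simp add: add)
  next
    case (step2 z)
    have "z \<cdot>\<^sub>v unit_vec n i = (z - 1) \<cdot>\<^sub>v unit_vec n i + unit_vec n i"
      by (rule eq_vecI) (simp_all add: algebra_simps)
    hence eq: "a ((z - 1) \<cdot>\<^sub>v unit_vec n i + unit_vec n i) = b ((z - 1) \<cdot>\<^sub>v unit_vec n i + unit_vec n i)"
      using step2 by simp
    show ?case by (rule sub[OF _ _ eq u[OF i]]) simp_all
  qed
  have "a x = b x" if "k \<le> n" "x \<in> carrier_vec n" "\<And>j. j < n \<Longrightarrow> j \<ge> k \<Longrightarrow> x $ j = 0" for k x
    using that
  proof (induction k arbitrary: x)
    case 0
    hence "x = 0\<^sub>v n" by auto
    thus ?case by (simp add: a0)
  next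
    case (Suc k)
    define y where "y = vec n (\<lambda>j. if j = k then 0 else x $ j)"
    have "a y = b y" by (rule Suc.IH) (use Suc.prems in \<open>auto simp: y_def not_less_eq_eq le_less_Suc_eq\<close>)
    moreover have "x = y + (x $ k) \<cdot>\<^sub>v unit_vec n k"
      by (rule eq_vecI) (use Suc.prems in \<open>auto simp: y_def\<close>)
    ultimately show ?case
      using add[of y "(x $ k) \<cdot>\<^sub>v unit_vec n k"] smult[of k] Suc.prems by (auto simp: y_def)
  qed
  from this[of n v] v show ?thesis by simp
qed

text \<open>The map sending \<open>v\<^sub>1, \<dots>, v\<^sub>d\<close> to the product of the linear polynomials
  \<open>v\<^sub>1, \<dots>, v\<^sub>d\<close> is the universal symmetric multiadditive map, so \<open>sym_group d n\<close> is the
  d-th symmetric power of the free abelian group of rank n. Additivity in the first argument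
  suffices, by symmetry.\<close>

lemma sym_group_universal:
  fixes f :: "int vec list \<Rightarrow> 'g"
  assumes G: "comm_group G"
    and car: "\<And>vs. length vs = d \<Longrightarrow> set vs \<subseteq> carrier_vec n \<Longrightarrow> f vs \<in> carrier G"
    and sym: "\<And>vs ws. length vs = d \<Longrightarrow> set vs \<subseteq> carrier_vec n \<Longrightarrow> mset ws = mset vs \<Longrightarrow> f ws = f vs"
    and add: "\<And>u v vs. Suc (length vs) = d \<Longrightarrow> u \<in> carrier_vec n \<Longrightarrow> v \<in> carrier_vec n \<Longrightarrow>
        set vs \<subseteq> carrier_vec n \<Longrightarrow> f ((u + v) # vs) = f (u # vs) \<otimes>\<^bsub>G\<^esub> f (v # vs)"
  shows "\<exists>!\<phi>. \<phi> \<in> hom (sym_group d n) G \<and> \<phi> \<in> extensional (carrier (sym_group d n)) \<and>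
     (\<forall>vs. length vs = d \<and> set vs \<subseteq> carrier_vec n \<longrightarrow>
        \<phi> (\<Prod>v\<leftarrow>vs. \<Sum>j<n. of_int (v $ j) * gen j) = f vs)"
proof -
  interpret G: comm_group G by (rule G)
  let ?U = "map (unit_vec n) :: nat list \<Rightarrow> int vec list"
  have U: "set (?U js) \<subseteq> carrier_vec n" for js by auto
  have "(\<lambda>m. f (?U (index_list m))) ` sym_exps d n \<subseteq> carrier G"
    using index_list_in by (auto intro!: car)
  then obtain h where h: "h \<in> hom (free_Abelian_group (sym_exps d n)) G"
    and hf: "\<And>m. m \<in> sym_exps d n \<Longrightarrow> h (frag_of m) = f (?U (index_list m))"
    using G.free_Abelian_group_universal by blast
  have hS: "h \<in> hom (sym_group d n) G" using h by (simp add: sym_group_eq)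
  have hg: "h (\<Prod>i\<leftarrow>js. gen i) = f (?U js)" if js: "set js \<subseteq> {..<n}" "length js = d" for js
  proof -
    define m where "m = (\<Sum>i\<leftarrow>js. Poly_Mapping.single i (1::nat))"
    have "(\<Prod>i\<leftarrow>js. gen i) = (\<Prod>v\<leftarrow>?U js. lin_form n v)"
      using js by (intro prod_gen_lin)
    hence "(\<Prod>i\<leftarrow>js. gen i) \<in> carrier (sym_group d n)"
      using prod_lin_sym_group[of n "?U js"] js by simp
    hence m: "m \<in> sym_exps d n" by (auto simp: prod_gen m_def sym_group_eq)
    have "mset (index_list m) = mset js"
      by (rule multiset_eqI)
         (metis index_list lookup_index_list m_def)
    hence "mset (?U (index_list m)) = mset (?U js)" by (metis mset_map)
    hence "f (?U (index_list m)) = f (?U js)" using js by (intro sym U) auto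
    thus ?thesis using hf[OF m] by (simp add: prod_gen m_def)
  qed
  have main: "h ((\<Prod>v\<leftarrow>vs. lin_form n v) * (\<Prod>i\<leftarrow>js. gen i)) = f (vs @ ?U js)"
    if "set vs \<subseteq> carrier_vec n" "set js \<subseteq> {..<n}" "length vs + length js = d" for vs js
    using that
  proof (induction vs arbitrary: js)
    case Nil
    thus ?case using hg by simp
  next
    case (Cons v vs)
    define R where "R = (\<Prod>v\<leftarrow>vs. lin_form n v) * (\<Prod>i\<leftarrow>js. gen i)"
    have "(\<Prod>i\<leftarrow>js. gen i) = (\<Prod>v\<leftarrow>?U js. lin_form n v)"
      using Cons.prems by (intro prod_gen_lin)
    hence R: "R \<in> carrier (sym_group (length vs + length js) n)"
      unfolding R_def using prod_lin_sym_group[of n vs] prod_lin_sym_group[of n "?U js"]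
      by (intro sym_group_mult) auto
    have LR: "lin_form n w * R \<in> carrier (sym_group d n)" for w
      using sym_group_mult[OF lin_sym_group R] Cons.prems by simp
    have "h (lin_form n v * R) = f (v # vs @ ?U js)"
    proof (rule hom_vec_eqI[OF G, where n = n and a = "\<lambda>v. h (lin_form n v * R)"
          and b = "\<lambda>v. f (v # vs @ ?U js)"])
      show "(\<lambda>v. h (lin_form n v * R)) \<in> hom (obj incl_functor n) G"
      proof (rule homI)
        show "h (lin_form n x * R) \<in> carrier G" for x using hS LR by (auto simp: hom_def)
        fix x y assume "x \<in> carrier (obj incl_functor n)" "y \<in> carrier (obj incl_functor n)"
        hence xy: "x \<in> carrier_vec n" "y \<in> carrier_vec n" by (auto simp: incl_functor_def)
        have "lin_form n (x + y) = lin_form n x + lin_form n y"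
          using xy by (simp add: lin_form_def sum.distrib[symmetric] algebra_simps)
        hence "h (lin_form n (x + y) * R) = h (lin_form n x * R + lin_form n y * R)" by (simp add: algebra_simps)
        also have "\<dots> = h (lin_form n x * R) \<otimes>\<^bsub>G\<^esub> h (lin_form n y * R)"
          using hom_mult[OF hS LR LR] by (simp add: sym_group_def)
        finally show "h (lin_form n (x \<otimes>\<^bsub>obj incl_functor n\<^esub> y) * R) =
            h (lin_form n x * R) \<otimes>\<^bsub>G\<^esub> h (lin_form n y * R)" by (simp add: incl_functor_def)
      qed
      show "(\<lambda>v. f (v # vs @ ?U js)) \<in> hom (obj incl_functor n) G"
        by (rule homI) (use Cons.prems in \<open>auto simp: incl_functor_def intro!: car add\<close>)
      fix i assume i: "i < n"
      have "h (lin_form n (unit_vec n i) * R) = h ((\<Prod>v\<leftarrow>vs. lin_form n v) * (\<Prod>i\<leftarrow>i # js. gen i))"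
        using i by (simp add: lin_unit R_def mult_ac)
      also have "\<dots> = f (vs @ ?U (i # js))" by (rule Cons.IH) (use Cons.prems i in auto)
      also have "\<dots> = f (unit_vec n i # vs @ ?U js)"
        by (rule sym) (use Cons.prems in auto)
      finally show "h (lin_form n (unit_vec n i) * R) = f (unit_vec n i # vs @ ?U js)" .
    qed (use Cons.prems in auto)
    thus ?case by (simp add: R_def mult_ac)
  qed
  show ?thesis
  proof (rule ex1I[of _ "restrict h (carrier (sym_group d n))"])
    show "restrict h (carrier (sym_group d n)) \<in> hom (sym_group d n) G \<and>
      restrict h (carrier (sym_group d n)) \<in> extensional (carrier (sym_group d n)) \<and>
      (\<forall>vs. length vs = d \<and> set vs \<subseteq> carrier_vec n \<longrightarrow>
        restrict h (carrier (sym_group d n)) (\<Prod>v\<leftarrow>vs. \<Sum>j<n. of_int (v $ j) * gen j) = f vs)"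
    proof (intro conjI allI impI)
      have "group (sym_group d n)" by (simp add: sym_group_eq)
      thus "restrict h (carrier (sym_group d n)) \<in> hom (sym_group d n) G"
        using hS by (auto simp: hom_def group.is_monoid monoid.m_closed)
      fix vs :: "int vec list" assume "length vs = d \<and> set vs \<subseteq> carrier_vec n"
      thus "restrict h (carrier (sym_group d n)) (\<Prod>v\<leftarrow>vs. \<Sum>j<n. of_int (v $ j) * gen j) = f vs"
        using main[of vs "[]"] prod_lin_sym_group[of n vs] by (auto simp: lin_form_def)
    qed auto
    fix \<psi>
    assume \<psi>: "\<psi> \<in> hom (sym_group d n) G \<and> \<psi> \<in> extensional (carrier (sym_group d n)) \<and>
      (\<forall>vs. length vs = d \<and> set vs \<subseteq> carrier_vec n \<longrightarrow>
        \<psi> (\<Prod>v\<leftarrow>vs. \<Sum>j<n. of_int (v $ j) * gen j) = f vs)"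
    interpret P: group_hom "sym_group d n" G \<psi>
      using \<psi> G.is_group by (simp add: group_hom_def group_hom_axioms_def sym_group_eq)
    interpret H: group_hom "sym_group d n" G h
      using hS G.is_group by (simp add: group_hom_def group_hom_axioms_def sym_group_eq)
    have "\<psi> P = h P \<and> P \<in> carrier (sym_group d n)" if "Poly_Mapping.keys P \<subseteq> sym_exps d n" for P
      using that
    proof (induction rule: frag_induction)
      case zero
      show ?case using P.hom_one H.hom_one by (simp add: sym_group_def)
    next
      case (one m)
      have il: "set (index_list m) \<subseteq> {..<n}" "length (index_list m) = d"
        using index_list_in[OF one] by auto
      have fm: "frag_of m = (\<Prod>i\<leftarrow>index_list m. gen i)"
        by (simp only: prod_gen index_list)
      hence "frag_of m = (\<Prod>v\<leftarrow>?U (index_list m). lin_form n v)" by (simp only: prod_gen_lin[OF il(1)])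
      hence "\<psi> (frag_of m) = f (?U (index_list m))"
        using conjunct2[OF conjunct2[OF \<psi>], rule_format, of "?U (index_list m)"] il(2) U
        by (simp add: lin_form_def)
      moreover have "frag_of m \<in> carrier (sym_group d n)" using one by (simp add: sym_group_eq)
      ultimately show ?case using hg[OF il] by (simp only: fm)
    next
      case (diff a b)
      have mem: "b \<in> carrier (sym_group d n)" "a - b \<in> carrier (sym_group d n)"
        using diff keys_diff[of a b] by (auto simp: sym_group_eq)
      have "\<phi> (a - b) = \<phi> a \<otimes>\<^bsub>G\<^esub> inv\<^bsub>G\<^esub> \<phi> b" if "group_hom (sym_group d n) G \<phi>" for \<phi>
      proof -
        interpret f: group_hom "sym_group d n" G \<phi> by (rule that)
        have "\<phi> ((a - b) \<otimes>\<^bsub>sym_group d n\<^esub> b) = \<phi> (a - b) \<otimes>\<^bsub>G\<^esub> \<phi> b"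
          by (rule f.hom_mult[OF mem(2) mem(1)])
        hence "\<phi> a = \<phi> (a - b) \<otimes>\<^bsub>G\<^esub> \<phi> b" by (simp add: sym_group_def)
        thus ?thesis using f.hom_closed[OF mem(1)] f.hom_closed[OF mem(2)]
          by (simp add: G.m_assoc)
      qed
      from this[OF P.group_hom_axioms] this[OF H.group_hom_axioms] diff mem
      show ?case by simp
    qed
    thus "\<psi> = restrict h (carrier (sym_group d n))"
      using \<psi> by (intro extensionalityI[of _ "carrier (sym_group d n)"]) (auto simp: sym_group_eq)
  qed
qed

lemma subst_mat_frag_extend:
  "subst_mat M = frag_extend (\<lambda>m. \<Prod>i \<in> Poly_Mapping.keys m.
     (\<Sum>j < dim_row M. of_int (M $$ (j, i)) * gen j) ^ Poly_Mapping.lookup m i)"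
proof -
  have "of_int z * (P :: ipoly) = frag_cmul z P" for z P
  proof -
    have "of_int z * P = Poly_Mapping.single 0 z * P" by (metis id_apply of_int_eq_id single_of_int)
    also have "\<dots> = Poly_Mapping.map ((*) z) P" by (rule mult_map_scale_conv_mult[symmetric])
    also have "\<dots> = frag_cmul z P"
      by (rule poly_mapping_eqI) (simp add: map.rep_eq when_def)
    finally show ?thesis .
  qed
  thus ?thesis by (simp add: fun_eq_iff subst_mat_def frag_extend_def)
qed

lemma subst_mat_frag_of_add:
  "subst_mat M (frag_of (a + b)) = subst_mat M (frag_of a) * subst_mat M (frag_of b)"
proof -
  let ?L = "\<lambda>i. \<Sum>j < dim_row M. of_int (M $$ (j, i)) * gen j"
  let ?K = "Poly_Mapping.keys a \<union> Poly_Mapping.keys b"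
  have "(\<Prod>i \<in> Poly_Mapping.keys m. ?L i ^ Poly_Mapping.lookup m i)
      = (\<Prod>i \<in> ?K. ?L i ^ Poly_Mapping.lookup m i)" if "Poly_Mapping.keys m \<subseteq> ?K" for m
    by (rule prod.mono_neutral_left) (use that in \<open>auto simp: in_keys_iff\<close>)
  from this[of a] this[of b] this[of "a + b"] keys_add[of a b] show ?thesis
    by (simp add: subst_mat_frag_extend frag_extend_of lookup_add power_add prod.distrib)
qed

lemma subst_mat_diff: "subst_mat M (P - Q) = subst_mat M P - subst_mat M Q"
  by (simp add: subst_mat_frag_extend frag_extend_diff)

lemma subst_mat_0: "subst_mat M 0 = 0"
  by (simp add: subst_mat_def)

lemma subst_mat_add: "subst_mat M (P + Q) = subst_mat M P + subst_mat M Q"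
  by (simp add: subst_mat_frag_extend frag_extend_add)

lemma subst_mat_mult: "subst_mat M (P * Q) = subst_mat M P * subst_mat M Q"
proof -
  have 1: "subst_mat M (frag_of a * Q) = subst_mat M (frag_of a) * subst_mat M Q" for a Q
    by (rule frag_induction[where S = UNIV and c = Q])
       (auto simp: subst_mat_0 mult_single subst_mat_frag_of_add subst_mat_diff right_diff_distrib)
  show ?thesis
    by (rule frag_induction[where S = UNIV and c = P])
       (auto simp: subst_mat_0 1 subst_mat_diff left_diff_distrib)
qed

lemma subst_mat_of_int: "subst_mat M (of_int z) = of_int z"
proof -
  have "of_int z = (Poly_Mapping.single 0 z :: ipoly)" by (metis id_apply of_int_eq_id single_of_int)
  thus ?thesis by (simp add: subst_mat_def)
qed

lemma subst_mat_sum: "subst_mat M (\<Sum>i\<in>I. P i) = (\<Sum>i\<in>I. subst_mat M (P i))"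
  by (induction I rule: infinite_finite_induct) (auto simp: subst_mat_0 subst_mat_add)

lemma subst_mat_gen: "subst_mat M (gen i) = (\<Sum>j < dim_row M. of_int (M $$ (j, i)) * gen j)"
  by (simp add: subst_mat_def gen_def)

lemma subst_mat_lin:
  assumes "M \<in> carrier_mat t s" "v \<in> carrier_vec s"
  shows "subst_mat M (lin_form s v) = lin_form t (M *\<^sub>v v)"
proof -
  have "subst_mat M (lin_form s v) = (\<Sum>i<s. \<Sum>j<t. of_int (v $ i * M $$ (j, i)) * gen j)"
    using assms
    by (simp add: lin_form_def subst_mat_sum subst_mat_mult subst_mat_of_int subst_mat_gen
          sum_distrib_left mult.assoc)
  also have "\<dots> = (\<Sum>j<t. \<Sum>i<s. of_int (v $ i * M $$ (j, i)) * gen j)" by (rule sum.swap)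
  also have "\<dots> = lin_form t (M *\<^sub>v v)"
    using assms unfolding lin_form_def
    by (intro sum.cong)
       (auto simp: scalar_prod_def sum_distrib_left atLeast0LessThan mult_ac)
  finally show ?thesis .
qed

text \<open>The induced map is the one given by functoriality of the symmetric power.\<close>

lemma sym_functor_prod:
  assumes M: "M \<in> carrier_mat t s" and vs: "set vs \<subseteq> carrier_vec s" "length vs = d"
  shows "arr (sym_functor d) M (\<Prod>v\<leftarrow>vs. \<Sum>j<s. of_int (v $ j) * gen j) =
         (\<Prod>v\<leftarrow>vs. \<Sum>j<t. of_int ((M *\<^sub>v v) $ j) * gen j)"
proof -
  have "subst_mat M (\<Prod>v\<leftarrow>vs. lin_form s v) = (\<Prod>v\<leftarrow>vs. lin_form t (M *\<^sub>v v))"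
    using vs(1)
  proof (induction vs)
    case Nil
    show ?case using subst_mat_of_int[of M 1] by simp
  next
    case (Cons v vs)
    thus ?case by (simp add: subst_mat_mult subst_mat_lin[OF M])
  qed
  thus ?thesis using M vs(2) prod_lin_sym_group[of s vs] by (simp add: sym_functor_def lin_form_def)
qed


section \<open>The functor \<open>E\<^sub>d\<close> and its extension\<close>

definition counit_mat :: "int mat" where "counit_mat = 0\<^sub>m 0 1"
definition unit_mat :: "int mat" where "unit_mat = 0\<^sub>m 1 0"
definition diag_mat2 :: "int mat" where "diag_mat2 = mat_of_rows_list 1 [[1], [1]]"
definition fold_mat :: "int mat" where "fold_mat = mat_of_rows_list 2 [[1, 1]]"
definition neg_mat :: "int mat" where "neg_mat = mat_of_rows_list 1 [[-1]]"
definition swap_mat :: "int mat" where "swap_mat = mat_of_rows_list 2 [[0, 1], [1, 0]]"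

definition pad :: "nat \<Rightarrow> int mat \<Rightarrow> nat \<Rightarrow> int mat" where
  "pad n f m = diag_block_mat [1\<^sub>m n, f, 1\<^sub>m m]"

text \<open>\<open>basis_hom n c\<close> is the homomorphism sending \<open>e\<^sub>n\<close> to c and every other basis
  vector to 0.\<close>

definition basis_hom :: "nat \<Rightarrow> ipoly \<Rightarrow> int vec \<Rightarrow> ipoly" where
  "basis_hom n c v = of_int (v $ n) * c"

definition block_map ::
  "nat \<Rightarrow> int mat \<Rightarrow> (int vec \<Rightarrow> ipoly) \<Rightarrow> ipoly \<times> int vec \<Rightarrow> ipoly \<times> int vec" where
  "block_map d M D =
     (\<lambda>(P, v) \<in> carrier (obj (sym_functor d) (dim_col M) \<times>\<times> obj incl_functor (dim_col M)).
        (arr (sym_functor d) M P + D v, arr incl_functor M v))"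

text \<open>Both integer divisions by p below are exact.\<close>

definition is_E_functor :: "nat \<Rightarrow> nat \<Rightarrow> (ipoly \<times> int vec) ab_functor \<Rightarrow> bool" where
  "is_E_functor p l E \<longleftrightarrow> (let d = p ^ l in
     is_ab_functor E \<and>
     (\<forall>s. obj E s = obj (sym_functor d) s \<times>\<times> obj incl_functor s) \<and>
     (\<forall>n m. \<forall>f \<in> {counit_mat, unit_mat, fold_mat, swap_mat}.
        arr E (pad n f m) = block_map d (pad n f m) (\<lambda>v. 0)) \<and>
     (\<forall>n m. arr E (pad n neg_mat m) =
        block_map d (pad n neg_mat m)
          (basis_hom n (of_int ((1 + (-1) ^ d) div int p) * gen n ^ d))) \<and>
     (\<forall>n m. arr E (pad n diag_mat2 m) =
        block_map d (pad n diag_mat2 m)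
          (basis_hom n (\<Sum>k = 1..d - 1. of_nat ((d choose k) div p) *
             gen n ^ k * gen (Suc n) ^ (d - k)))))"

definition E_functor :: "nat \<Rightarrow> nat \<Rightarrow> (ipoly \<times> int vec) ab_functor" where
  "E_functor p l = (THE E. is_E_functor p l E)"

end

theory Submission
  imports Defs "Jordan_Normal_Form.Gauss_Jordan_Elimination"
begin

text \<open>For \<open>v \<in> I(n)\<close> let \<open>\<sigma>(v) = \<Sum>\<^sub>j v\<^sub>j x\<^sub>j\<^sup>d\<close>. Over the rationals, \<open>\<sigma>/p\<close> splits \<open>E\<^sub>d\<close>: the map
  \<open>D(M) = (M \<sigma> - \<sigma> M)/p\<close> is integral, satisfies \<open>D(N M) = N D(M) + D(N) M\<close> and takes the prescribed
  values on the generating morphisms. Twisting \<open>S\<^sup>d \<oplus> I\<close> by \<open>c D\<close> gives an extension for every integer c;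
  those for c and c' are equivalent iff p divides \<open>c - c'\<close>, and Baer sum adds the parameters.
  Every extension E is of this form. For a lift \<open>e \<in> E(1)\<close> of the generator, the difference
  of \<open>\<Delta> e\<close> and the sum of the two coordinate images of e is some \<open>\<delta> \<in> S\<^sup>d(2)\<close>. Since multiplication
  by 2 acts as \<open>2\<^sup>d\<close> on \<open>S\<^sup>d\<close> and as 2 on I, \<open>(2\<^sup>d - 2) \<delta> = a ((x + y)\<^sup>d - x\<^sup>d - y\<^sup>d)\<close> for an integer a. The
  inner binomial coefficients of \<open>d = p\<^sup>l\<close> have greatest common divisor p, so \<open>2\<^sup>d - 2\<close> divides \<open>a p\<close>
  and \<open>\<delta>\<close> is a multiple of \<open>((x + y)\<^sup>d - x\<^sup>d - y\<^sup>d)/p\<close>, which determines the extension.\<close>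

section \<open>Padded generators\<close>

text \<open>Let l(v) be the linear form of v and Q(v) = (l(v)^d - \<sigma>(v))/p. The power l(v)^d
  commutes with matrices but is not additive; \<sigma> is additive but does not commute with
  matrices; both agree modulo p, so Q is integral. Hence D(M) v = Q(M v) - M Q(v), a formula without
  denominators whose cocycle identity telescopes, while Q deviates from additivity only through
  l(v)^d/p. In an arbitrary extension, the images of one lift e of the generator are lifts of all v
  that commute with matrices and may only fail to be additive. Subtracting c Q trades this failure
  for the twist by c D, which is why a single \<delta> in two variables decides everything. The
  number 2 is the smallest positive integer whose actions on \<open>S^d\<close> and I differ.
  Uniqueness of \<open>E_d\<close> is a separate matter: it is prescribed on generating morphisms
  only, so their generation of all matrices has to be proved. Writing a matrix as a projection of
  its graph avoids Euclidean elimination: rows of an identity block are only added to rows below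
  it.\<close>

lemma pad_carrier:
  assumes "f \<in> carrier_mat r c"
  shows "pad n f m \<in> carrier_mat (n + r + m) (n + c + m)"
  using assms by (auto simp: pad_def Let_def)

text \<open>The nested blocks are flattened to one case distinction on the row, from which every row
  and column of a padded generator follows by simplification.\<close>

lemma index_pad:
  assumes "f \<in> carrier_mat r c" "i < n + r + m" "j < n + c + m"
  shows "pad n f m $$ (i, j) =
    (if i < n then (if j = i then 1 else 0)
     else if i < n + r then (if n \<le> j \<and> j < n + c then f $$ (i - n, j - n) else 0)
     else (if n + c \<le> j \<and> j - (n + c) = i - (n + r) then 1 else 0))"
proof -
  have f: "dim_row f = r" "dim_col f = c" using assms(1) by auto
  have d: "diag_block_mat [f, 1\<^sub>m m] = four_block_mat f (0\<^sub>m r m) (0\<^sub>m m c) (1\<^sub>m m)"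
    using f by (intro eq_matI) (auto simp: Let_def)
  have e: "diag_block_mat [f, 1\<^sub>m m] $$ (i, j) =
      (if i < r then if j < c then f $$ (i, j) else 0 else if c \<le> j \<and> j - c = i - r then 1 else 0)"
    if "i < r + m" "j < c + m" for i j
    unfolding d using that f by auto
  have "dim_row (diag_block_mat [f, 1\<^sub>m m]) = r + m" "dim_col (diag_block_mat [f, 1\<^sub>m m]) = c + m"
    unfolding d using f by auto
  hence p: "pad n f m $$ (i, j) = (if i < n then if j < n then 1\<^sub>m n $$ (i, j) else 0\<^sub>m n (c + m) $$ (i, j - n)
      else if j < n then 0\<^sub>m (r + m) n $$ (i - n, j) else diag_block_mat [f, 1\<^sub>m m] $$ (i - n, j - n))"
    unfolding pad_def using assms(2,3)
    by (subst diag_block_mat.simps) (simp add: Let_def del: diag_block_mat.simps)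
  show ?thesis
  proof (cases "n \<le> i \<and> n \<le> j")
    case True
    hence "pad n f m $$ (i, j) = diag_block_mat [f, 1\<^sub>m m] $$ (i - n, j - n)" by (simp add: p)
    also have "\<dots> = (if i - n < r then if j - n < c then f $$ (i - n, j - n) else 0
        else if c \<le> j - n \<and> j - n - c = i - n - r then 1 else 0)"
      using True assms(2,3) by (intro e) auto
    moreover have "i - n < r \<longleftrightarrow> i < n + r" "j - n < c \<longleftrightarrow> j < n + c" "c \<le> j - n \<longleftrightarrow> n + c \<le> j"
      using True by linarith+
    ultimately show ?thesis using True by (simp add: diff_diff_left)
  qed (use assms(2,3) in \<open>auto simp: p\<close>)
qed

lemma generator_carriers:
  "counit_mat \<in> carrier_mat 0 1" "unit_mat \<in> carrier_mat 1 0" "diag_mat2 \<in> carrier_mat 2 1"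
  "fold_mat \<in> carrier_mat 1 2" "neg_mat \<in> carrier_mat 1 1" "swap_mat \<in> carrier_mat 2 2"
  by (auto simp: counit_mat_def unit_mat_def diag_mat2_def fold_mat_def neg_mat_def swap_mat_def
      mat_of_rows_list_def)

lemma generator_index:
  "i < 2 \<Longrightarrow> j < 1 \<Longrightarrow> diag_mat2 $$ (i, j) = 1"
  "i < 1 \<Longrightarrow> j < 2 \<Longrightarrow> fold_mat $$ (i, j) = 1"
  "i < 1 \<Longrightarrow> j < 1 \<Longrightarrow> neg_mat $$ (i, j) = -1"
  "i < 2 \<Longrightarrow> j < 2 \<Longrightarrow> swap_mat $$ (i, j) = (if i = j then 0 else 1)"
  by (auto simp: diag_mat2_def fold_mat_def neg_mat_def swap_mat_def mat_of_rows_list_def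
      less_2_cases_iff)

lemmas pad_generator_carriers = generator_carriers[THEN pad_carrier]
lemmas index_pad_generators = generator_carriers[THEN index_pad]

lemma dim_pad_generators:
  "dim_row (pad n counit_mat m) = n + m" "dim_col (pad n counit_mat m) = Suc (n + m)"
  "dim_row (pad n unit_mat m) = Suc (n + m)" "dim_col (pad n unit_mat m) = n + m"
  "dim_row (pad n diag_mat2 m) = Suc (Suc (n + m))" "dim_col (pad n diag_mat2 m) = Suc (n + m)"
  "dim_row (pad n fold_mat m) = Suc (n + m)" "dim_col (pad n fold_mat m) = Suc (Suc (n + m))"
  "dim_row (pad n neg_mat m) = Suc (n + m)" "dim_col (pad n neg_mat m) = Suc (n + m)"
  "dim_row (pad n swap_mat m) = Suc (Suc (n + m))" "dim_col (pad n swap_mat m) = Suc (Suc (n + m))"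
  using pad_generator_carriers[of n m] by auto

text \<open>Rows serve the generation argument: the rows of a left factor say which rows of the
  right factor are copied, added, negated or dropped.\<close>

lemma row_pad_counit: "i < n + m \<Longrightarrow>
    row (pad n counit_mat m) i = unit_vec (Suc (n + m)) (if i < n then i else Suc i)"
  by (rule eq_vecI; cases i n rule: linorder_cases)
    (auto simp: dim_pad_generators index_pad_generators generator_index)

lemma row_pad_unit: "i < Suc (n + m) \<Longrightarrow> row (pad n unit_mat m) i =
    (if i < n then unit_vec (n + m) i else if i = n then 0\<^sub>v (n + m) else unit_vec (n + m) (i - 1))"
  by (rule eq_vecI; cases i n rule: linorder_cases)
    (auto simp: dim_pad_generators index_pad_generators generator_index)

lemma row_pad_diag: "i < Suc (Suc (n + m)) \<Longrightarrow>
    row (pad n diag_mat2 m) i = unit_vec (Suc (n + m)) (if i \<le> n then i else i - 1)"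
  by (rule eq_vecI; cases i n rule: linorder_cases)
    (auto simp: dim_pad_generators index_pad_generators generator_index)

lemma row_pad_fold: "i < Suc (n + m) \<Longrightarrow> row (pad n fold_mat m) i =
    (if i < n then unit_vec (Suc (Suc (n + m))) i
     else if i = n then unit_vec (Suc (Suc (n + m))) n + unit_vec (Suc (Suc (n + m))) (Suc n)
     else unit_vec (Suc (Suc (n + m))) (Suc i))"
  by (rule eq_vecI; cases i n rule: linorder_cases)
    (auto simp: dim_pad_generators index_pad_generators generator_index)

lemma row_pad_neg: "i < Suc (n + m) \<Longrightarrow> row (pad n neg_mat m) i =
    (if i = n then - unit_vec (Suc (n + m)) n else unit_vec (Suc (n + m)) i)"
  by (rule eq_vecI; cases i n rule: linorder_cases)
    (auto simp: dim_pad_generators index_pad_generators generator_index)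

lemma row_pad_swap: "i < Suc (Suc (n + m)) \<Longrightarrow> row (pad n swap_mat m) i =
    unit_vec (Suc (Suc (n + m))) (if i = n then Suc n else if i = Suc n then n else i)"
  by (rule eq_vecI; cases i n rule: linorder_cases)
    (auto simp: dim_pad_generators index_pad_generators generator_index)

text \<open>Columns, the images of the basis vectors, are what \<open>twist\<close> is computed
  from.\<close>

lemma col_pad_counit: "i < Suc (n + m) \<Longrightarrow> col (pad n counit_mat m) i =
    (if i < n then unit_vec (n + m) i else if i = n then 0\<^sub>v (n + m) else unit_vec (n + m) (i - 1))"
  by (rule eq_vecI; cases i n rule: linorder_cases)
    (auto simp: dim_pad_generators index_pad_generators generator_index)

lemma col_pad_unit: "i < n + m \<Longrightarrow>
    col (pad n unit_mat m) i = unit_vec (Suc (n + m)) (if i < n then i else Suc i)"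
  by (rule eq_vecI; cases i n rule: linorder_cases)
    (auto simp: dim_pad_generators index_pad_generators generator_index)

lemma col_pad_diag: "i < Suc (n + m) \<Longrightarrow> col (pad n diag_mat2 m) i =
    (if i < n then unit_vec (Suc (Suc (n + m))) i
     else if i = n then unit_vec (Suc (Suc (n + m))) n + unit_vec (Suc (Suc (n + m))) (Suc n)
     else unit_vec (Suc (Suc (n + m))) (Suc i))"
  by (rule eq_vecI; cases i n rule: linorder_cases)
    (auto simp: dim_pad_generators index_pad_generators generator_index)

lemma col_pad_fold: "i < Suc (Suc (n + m)) \<Longrightarrow>
    col (pad n fold_mat m) i = unit_vec (Suc (n + m)) (if i \<le> n then i else i - 1)"
  by (rule eq_vecI; cases i n rule: linorder_cases)
    (auto simp: dim_pad_generators index_pad_generators generator_index)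

lemma col_pad_neg: "i < Suc (n + m) \<Longrightarrow> col (pad n neg_mat m) i =
    (if i = n then - unit_vec (Suc (n + m)) n else unit_vec (Suc (n + m)) i)"
  by (rule eq_vecI; cases i n rule: linorder_cases)
    (auto simp: dim_pad_generators index_pad_generators generator_index)

lemma col_pad_swap: "i < Suc (Suc (n + m)) \<Longrightarrow> col (pad n swap_mat m) i =
    unit_vec (Suc (Suc (n + m))) (if i = n then Suc n else if i = Suc n then n else i)"
  by (rule eq_vecI; cases i n rule: linorder_cases)
    (auto simp: dim_pad_generators index_pad_generators generator_index)

section \<open>The generators generate all integer matrices\<close>

definition generators :: "int mat set" where
  "generators = {counit_mat, unit_mat, diag_mat2, fold_mat, neg_mat, swap_mat}"

lemma swaprows_pad_mult:
  assumes "A \<in> carrier_mat (Suc (Suc (n + m))) c"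
  shows "pad n swap_mat m * A = swaprows n (Suc n) A"
  by (rule eq_matI) (use assms in \<open>auto simp: dim_pad_generators row_pad_swap mat_swaprows_def\<close>)

lemma neg_pad_mult:
  assumes "A \<in> carrier_mat (Suc (n + m)) c"
  shows "pad n neg_mat m * A = mat (Suc (n + m)) c (\<lambda>(i, j). if i = n then - A $$ (i, j) else A $$ (i, j))"
  by (rule eq_matI) (use assms in \<open>auto simp: dim_pad_generators row_pad_neg\<close>)

lemma diag_pad_mult:
  assumes "A \<in> carrier_mat (Suc (n + m)) c"
  shows "pad n diag_mat2 m * A =
    mat (Suc (Suc (n + m))) c (\<lambda>(i, j). A $$ (if i \<le> n then i else i - 1, j))"
  by (rule eq_matI) (use assms in \<open>auto simp: dim_pad_generators row_pad_diag\<close>)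

lemma fold_pad_mult:
  assumes "A \<in> carrier_mat (Suc (Suc (n + m))) c"
  shows "pad n fold_mat m * A = mat (Suc (n + m)) c
    (\<lambda>(i, j). if i < n then A $$ (i, j) else if i = n then A $$ (n, j) + A $$ (Suc n, j) else A $$ (Suc i, j))"
  by (rule eq_matI)
     (use assms in \<open>auto simp: dim_pad_generators row_pad_fold add_scalar_prod_distrib[of _ "Suc (Suc (n + m))"]\<close>)

lemma counit_pad_mult:
  assumes "A \<in> carrier_mat (Suc (n + m)) c"
  shows "pad n counit_mat m * A =
    mat (n + m) c (\<lambda>(i, j). A $$ (if i < n then i else Suc i, j))"
  by (rule eq_matI) (use assms in \<open>auto simp: dim_pad_generators row_pad_counit\<close>)

lemma unit_pad_mult:
  assumes "A \<in> carrier_mat (n + m) c"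
  shows "pad n unit_mat m * A = mat (Suc (n + m)) c
    (\<lambda>(i, j). if i < n then A $$ (i, j) else if i = n then 0 else A $$ (i - 1, j))"
  by (rule eq_matI) (use assms in \<open>auto simp: dim_pad_generators row_pad_unit\<close>)

text \<open>Doubling row n puts a copy of it directly above the old row \<open>Suc n\<close>;
  folding these two leaves the original row n intact and adds it to its successor.\<close>

lemma addrow_pad_mult:
  assumes A: "A \<in> carrier_mat (Suc (Suc (n + m))) c"
  shows "pad (Suc n) fold_mat m * (pad n diag_mat2 (Suc m) * A) = addrow 1 (Suc n) n A"
proof -
  have D: "pad n diag_mat2 (Suc m) * A =
      mat (Suc (Suc (Suc n + m))) c (\<lambda>(i, j). A $$ (if i \<le> n then i else i - 1, j))"
    using diag_pad_mult[of A n "Suc m" c] A by simp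
  show ?thesis
    unfolding D by (subst fold_pad_mult[of _ "Suc n" m c], simp, rule eq_matI)
      (use A in \<open>auto simp: mat_addrow_def less_Suc_eq_le\<close>)
qed

text \<open>An induction principle for matrices, to be applied to the equality of two functors on a
  morphism. The condition on dimensions expresses composability, since the matrix product is a total
  function.\<close>

locale row_closed =
  fixes P :: "int mat \<Rightarrow> bool"
  assumes one: "P (1\<^sub>m n)"
    and mult: "P A \<Longrightarrow> f \<in> generators \<Longrightarrow> dim_col (pad n f m) = dim_row A \<Longrightarrow> P (pad n f m * A)"
begin

lemma swaprows: "P A \<Longrightarrow> Suc n < dim_row A \<Longrightarrow> P (swaprows n (Suc n) A)"
  using mult[of A swap_mat n "dim_row A - n - 2"]
  by (subst swaprows_pad_mult[symmetric, of _ n "dim_row A - n - 2" "dim_col A"])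
     (auto simp: generators_def dim_pad_generators)

lemma addrow_one: "P A \<Longrightarrow> Suc n < dim_row A \<Longrightarrow> P (addrow 1 (Suc n) n A)"
  using mult[of A diag_mat2 n "Suc (dim_row A - n - 2)"]
    mult[of "pad n diag_mat2 (Suc (dim_row A - n - 2)) * A" fold_mat "Suc n" "dim_row A - n - 2"]
  by (subst addrow_pad_mult[symmetric, of _ n "dim_row A - n - 2" "dim_col A"])
     (auto simp: generators_def dim_pad_generators)

lemma negrow:
  "P A \<Longrightarrow> n < dim_row A \<Longrightarrow>
    P (mat (dim_row A) (dim_col A) (\<lambda>(i, j). if i = n then - A $$ (i, j) else A $$ (i, j)))"
  using mult[of A neg_mat n "dim_row A - n - 1"] neg_pad_mult[of A n "dim_row A - n - 1" "dim_col A"]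
  by (auto simp: generators_def dim_pad_generators)

text \<open>Negating row n before and after the addition reverses the sign with which it enters row
  \<open>Suc n\<close> and restores row n itself.\<close>

lemma addrow_minus_one: "P A \<Longrightarrow> Suc n < dim_row A \<Longrightarrow> P (addrow (-1) (Suc n) n A)"
proof -
  let ?N = "\<lambda>A. mat (dim_row A) (dim_col A) (\<lambda>(i, j). if i = n then - A $$ (i, j) else A $$ (i, j) :: int)"
  assume A: "P A" "Suc n < dim_row A"
  have "P (?N (addrow 1 (Suc n) n (?N A)))"
    using A by (intro negrow addrow_one) auto
  also have "?N (addrow 1 (Suc n) n (?N A)) = addrow (-1) (Suc n) n A"
    by (rule eq_matI) (use A in \<open>auto simp: mat_addrow_def\<close>)
  finally show ?thesis .
qed

lemma addrow_adjacent:
  assumes "P A" "Suc n < dim_row A"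
  shows "P (addrow a (Suc n) n A)"
proof (induction a rule: int_induct[where k = 0])
  case base
  have "addrow 0 (Suc n) n A = A" by (rule eq_matI) (auto simp: mat_addrow_def)
  thus ?case using assms by simp
next
  case (step1 a)
  have "addrow (a + 1) (Suc n) n A = addrow 1 (Suc n) n (addrow a (Suc n) n A)"
    by (rule eq_matI) (use assms in \<open>auto simp: mat_addrow_def algebra_simps\<close>)
  thus ?case using addrow_one[OF step1(2)] assms by simp
next
  case (step2 a)
  have "addrow (a - 1) (Suc n) n A = addrow (-1) (Suc n) n (addrow a (Suc n) n A)"
    by (rule eq_matI) (use assms in \<open>auto simp: mat_addrow_def algebra_simps\<close>)
  thus ?case using addrow_minus_one[OF step2(2)] assms by simp
qed

text \<open>Conjugation by the swap of the target row with the row below it increases the distance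
  by one. The form l + Suc k keeps the target strictly below the source.\<close>

lemma addrow:
  assumes "P A" "l + Suc k < dim_row A"
  shows "P (addrow a (l + Suc k) l A)"
  using assms
proof (induction k arbitrary: A)
  case 0
  thus ?case using addrow_adjacent by simp
next
  case (Suc k)
  let ?s = "swaprows (l + Suc k) (Suc (l + Suc k))"
  have "P (?s (addrow a (l + Suc k) l (?s A)))"
    using Suc.prems by (intro swaprows Suc.IH) auto
  also have "?s (addrow a (l + Suc k) l (?s A)) = addrow a (l + Suc (Suc k)) l A"
    by (rule eq_matI) (use Suc.prems in \<open>auto simp: mat_addrow_def mat_swaprows_def\<close>)
  finally show ?case .
qed

lemma append_zero_rows: "P (mat (s + t) s (\<lambda>(i, j). if i = j then 1 else 0))"
proof (induction t)
  case 0
  show ?case using one[of s] by (simp add: one_mat_def)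
next
  case (Suc t)
  have "P (pad (s + t) unit_mat 0 * mat (s + t) s (\<lambda>(i, j). if i = j then 1 else 0))"
    using Suc by (intro mult) (auto simp: generators_def dim_pad_generators)
  also have "pad (s + t) unit_mat 0 * mat (s + t) s (\<lambda>(i, j). if i = j then 1 else 0) = mat (s + Suc t) s (\<lambda>(i, j). if i = j then 1 else 0)"
    by (subst unit_pad_mult[of _ "s + t" 0 s], simp, rule eq_matI) auto
  finally show ?case .
qed

text \<open>The identity stacked on M is the graph of M. Its lower block is filled one nonzero entry
  at a time: a multiple of row j of the untouched identity block, added to row s + i, changes only
  the entry (i, j) of M.\<close>

lemma graph_mat:
  assumes "M \<in> carrier_mat t s"
  shows "P (mat (s + t) s (\<lambda>(i, j). if i < s then if i = j then 1 else 0 else M $$ (i - s, j)))"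
  using assms
proof (induction "card {x \<in> {..<t} \<times> {..<s}. M $$ x \<noteq> 0}" arbitrary: M)
  case 0
  hence "M $$ (i, j) = 0" if "i < t" "j < s" for i j using that by (auto simp: card_eq_0_iff)
  hence "mat (s + t) s (\<lambda>(i, j). if i < s then if i = j then 1 else 0 else M $$ (i - s, j))
    = mat (s + t) s (\<lambda>(i, j). if i = j then 1 else 0)" by (intro eq_matI) auto
  thus ?case using append_zero_rows by simp
next
  case (Suc k)
  have "{x \<in> {..<t} \<times> {..<s}. M $$ x \<noteq> 0} \<noteq> {}" using Suc.hyps(2) by (metis card.empty nat.distinct(1))
  then obtain i j where ij: "i < t" "j < s" "M $$ (i, j) \<noteq> 0" by auto
  define M' where "M' = mat t s (\<lambda>x. if x = (i, j) then 0 else M $$ x)"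
  have "{x \<in> {..<t} \<times> {..<s}. M' $$ x \<noteq> 0} = {x \<in> {..<t} \<times> {..<s}. M $$ x \<noteq> 0} - {(i, j)}"
    by (auto simp: M'_def split: if_splits)
  hence "k = card {x \<in> {..<t} \<times> {..<s}. M' $$ x \<noteq> 0}"
    using Suc.hyps(2) ij by (simp add: card_Diff_singleton)
  hence "P (mat (s + t) s (\<lambda>(i, j). if i < s then if i = j then 1 else 0 else M' $$ (i - s, j)))"
    (is "P ?L") using Suc.hyps(1) by (simp add: M'_def)
  \<comment> \<open>The target is row s + i in the shape that \<open>addrow\<close> expects; the
    truncated subtraction is exact because j < s.\<close>
  hence "P (addrow (M $$ (i, j)) (j + Suc (s + i - j - 1)) j ?L)"
    using ij by (intro addrow) auto
  also have "j + Suc (s + i - j - 1) = s + i" using ij by simp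
  also have "addrow (M $$ (i, j)) (s + i) j ?L =
      mat (s + t) s (\<lambda>(i, j). if i < s then if i = j then 1 else 0 else M $$ (i - s, j))"
    by (rule eq_matI) (use ij in \<open>auto simp: mat_addrow_def M'_def\<close>)
  finally show ?case .
qed

lemma drop_first_rows: "P A \<Longrightarrow> k \<le> dim_row A \<Longrightarrow> P (mat (dim_row A - k) (dim_col A) (\<lambda>(i, j). A $$ (i + k, j)))"
proof (induction k)
  case 0
  have "mat (dim_row A) (dim_col A) (\<lambda>(i, j). A $$ (i, j)) = A" by (rule eq_matI) auto
  thus ?case using 0 by simp
next
  case (Suc k)
  let ?B = "mat (dim_row A - k) (dim_col A) (\<lambda>(i, j). A $$ (i + k, j))"
  have "P (pad 0 counit_mat (dim_row A - k - 1) * ?B)"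
    using Suc by (intro mult) (auto simp: generators_def dim_pad_generators)
  also have "pad 0 counit_mat (dim_row A - k - 1) * ?B =
      mat (dim_row A - Suc k) (dim_col A) (\<lambda>(i, j). A $$ (i + Suc k, j))"
  proof -
    have "?B \<in> carrier_mat (Suc (0 + (dim_row A - k - 1))) (dim_col A)" using Suc.prems by auto
    from counit_pad_mult[OF this] Suc.prems show ?thesis by (intro eq_matI) auto
  qed
  finally show ?case .
qed

text \<open>A morphism is its graph followed by the projection that forgets the first
  \<open>dim_col M\<close> coordinates.\<close>

lemma all: "P M"
proof -
  have "P (mat (dim_col M + dim_row M) (dim_col M)
    (\<lambda>(i, j). if i < dim_col M then if i = j then 1 else 0 else M $$ (i - dim_col M, j)))" (is "P ?A")
    by (rule graph_mat) auto
  hence "P (mat (dim_row ?A - dim_col M) (dim_col ?A) (\<lambda>(i, j). ?A $$ (i + dim_col M, j)))"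
    by (rule drop_first_rows) simp
  also have "mat (dim_row ?A - dim_col M) (dim_col ?A) (\<lambda>(i, j). ?A $$ (i + dim_col M, j)) = M"
    by (rule eq_matI) auto
  finally show ?thesis .
qed

end

section \<open>The crossed homomorphism and its arithmetic\<close>

lemma prime_power_dvd_choose:
  fixes p :: nat
  assumes "prime p" "0 < k" "k < p ^ l"
  shows "p dvd (p ^ l choose k)"
proof (rule ccontr)
  assume "\<not> p dvd (p ^ l choose k)"
  hence "coprime (p ^ l) (p ^ l choose k)"
    using assms(1) by (simp add: prime_imp_coprime)
  \<comment> \<open>Absorption: a binomial coefficient prime to p would force all of p^l to divide
    k.\<close>
  moreover have "k * (p ^ l choose k) = p ^ l * ((p ^ l - 1) choose (k - 1))"
    using assms(2) binomial_absorption[of "k - 1" "p ^ l"] by simp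
  hence "p ^ l dvd k * (p ^ l choose k)" by simp
  ultimately have "p ^ l dvd k" by (simp add: coprime_dvd_mult_left_iff)
  thus False using assms(2,3) by (simp add: nat_dvd_not_less)
qed

text \<open>Neighbours in row p^l - 1 of Pascal's triangle add up to an inner entry of row p^l,
  which p divides. So indivisibility passes from each entry to the next, starting at 1.\<close>

lemma not_dvd_choose_prime_power_minus_one:
  fixes p :: nat
  assumes "prime p" "j < p ^ l"
  shows "\<not> p dvd ((p ^ l - 1) choose j)"
  using assms(2)
proof (induction j)
  case 0
  show ?case using assms(1) by (simp add: prime_nat_iff)
next
  case (Suc j)
  have "p dvd (p ^ l choose Suc j)" using assms(1) Suc.prems by (intro prime_power_dvd_choose) auto
  moreover have "(p ^ l choose Suc j) = ((p ^ l - 1) choose j) + ((p ^ l - 1) choose Suc j)"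
    using Suc.prems prime_gt_0_nat[OF assms(1)] by (subst Suc_pred'[of "p ^ l"]) (auto simp del: Suc_pred)
  ultimately show ?case using Suc.IH Suc.prems by (metis Suc_lessD dvd_add_left_iff)
qed

text \<open>By absorption the coefficient at p^(l - 1) is p times an entry of row p^l - 1, and that
  entry is prime to p. Thus the coefficients at 1 and p^(l - 1) alone already have greatest common
  divisor p.\<close>

lemma gcd_choose_prime_power:
  fixes p :: nat
  assumes "prime p" "l \<ge> 1"
  shows "gcd (p ^ l) (p ^ l choose p ^ (l - 1)) = p"
proof -
  let ?u = "(p ^ l - 1) choose (p ^ (l - 1) - 1)"
  have pos: "0 < p ^ (l - 1)" using assms(1) by (simp add: prime_gt_0_nat)
  have pl: "p ^ l = p * p ^ (l - 1)" using assms(2) by (simp add: power_eq_if)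
  have "p ^ (l - 1) * (p ^ l choose p ^ (l - 1)) = p ^ l * ?u"
    using pos binomial_absorption[of "p ^ (l - 1) - 1" "p ^ l"] by simp
  hence "p ^ (l - 1) * (p ^ l choose p ^ (l - 1)) = p ^ (l - 1) * (p * ?u)"
    unfolding pl by (simp only: mult.assoc mult.left_commute)
  hence c: "(p ^ l choose p ^ (l - 1)) = p * ?u"
    using pos by (metis mult_left_cancel neq0_conv)
  have "p ^ (l - 1) \<le> p ^ l" using assms(1) by (intro power_increasing) (auto simp: prime_ge_Suc_0_nat)
  hence "p ^ (l - 1) - 1 < p ^ l" using pos by linarith
  hence "\<not> p dvd ?u"
    using assms(1) not_dvd_choose_prime_power_minus_one by blast
  hence "coprime (p ^ (l - 1)) ?u" using assms(1) by (simp add: prime_imp_coprime)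
  hence "gcd (p * p ^ (l - 1)) (p * ?u) = p" by (simp add: gcd_mult_left)
  thus ?thesis using c pl by metis
qed

lemma binomial_inner:
  fixes a b :: "'a :: comm_ring_1"
  assumes "d \<ge> 1"
  shows "(a + b) ^ d - a ^ d - b ^ d = (\<Sum>k = 1..d - 1. of_nat (d choose k) * a ^ k * b ^ (d - k))"
proof -
  have "{..d} = insert 0 (insert d {1..d - 1})" using assms by auto
  thus ?thesis using assms by (simp add: binomial_ring)
qed

lemma freshman_dvd:
  fixes a b :: "'a :: comm_ring_1" and p :: nat
  assumes "prime p"
  shows "of_nat p dvd (a + b) ^ (p ^ l) - a ^ (p ^ l) - b ^ (p ^ l)"
proof -
  have "of_nat p dvd (of_nat (p ^ l choose k) :: 'a)" if "k \<in> {1..p ^ l - 1}" for k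
  proof -
    have "p dvd (p ^ l choose k)" using that by (intro prime_power_dvd_choose[OF assms]) auto
    thus ?thesis by (auto elim!: dvdE)
  qed
  hence "of_nat p dvd (\<Sum>k = 1..p ^ l - 1. of_nat (p ^ l choose k) * a ^ k * b ^ (p ^ l - k))"
    by (intro dvd_sum dvd_mult2) auto
  thus ?thesis using assms by (subst binomial_inner) (auto simp: prime_gt_0_nat Suc_le_eq)
qed

lemma freshman_sum_dvd:
  fixes f :: "'b \<Rightarrow> 'a :: comm_ring_1" and p :: nat
  assumes "prime p" "finite A"
  shows "of_nat p dvd (\<Sum>i\<in>A. f i) ^ (p ^ l) - (\<Sum>i\<in>A. f i ^ (p ^ l))"
  using assms(2)
proof (induction A)
  case empty
  show ?case using assms(1) by (simp add: prime_gt_0_nat zero_power)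
next
  case (insert x A)
  have "(\<Sum>i\<in>insert x A. f i) ^ (p ^ l) - (\<Sum>i\<in>insert x A. f i ^ (p ^ l)) =
      ((f x + sum f A) ^ (p ^ l) - f x ^ (p ^ l) - sum f A ^ (p ^ l)) + (sum f A ^ (p ^ l) - (\<Sum>i\<in>A. f i ^ (p ^ l)))"
    using insert.hyps by simp
  thus ?case using insert.IH freshman_dvd[OF assms(1), of "f x" "sum f A" l] by (metis dvd_add)
qed

text \<open>To be additive, \<sigma> carries v_j to the first power, whereas the d-th power of v_j
  x_j produces v_j^d; this congruence bridges the two.\<close>

lemma prime_power_fermat_dvd:
  fixes p :: nat and z :: int
  assumes "prime p"
  shows "int p dvd z ^ (p ^ l) - z"
proof (induction z rule: int_induct[where k = 0])
  case base
  show ?case using assms by (simp add: prime_gt_0_nat zero_power)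
next
  case (step1 z)
  have "(z + 1) ^ (p ^ l) - (z + 1) = ((z + 1) ^ (p ^ l) - z ^ (p ^ l) - 1 ^ (p ^ l)) + (z ^ (p ^ l) - z)" by simp
  thus ?case using freshman_dvd[OF assms, of z 1 l] step1 by (metis dvd_add of_nat_id)
next
  case (step2 z)
  have "(z - 1) ^ (p ^ l) - (z - 1) = (z ^ (p ^ l) - z) - ((z - 1 + 1) ^ (p ^ l) - (z - 1) ^ (p ^ l) - 1 ^ (p ^ l))" by simp
  thus ?case using freshman_dvd[OF assms, of "z - 1" 1 l] step2 by (metis dvd_diff of_nat_id)
qed

section \<open>Homogeneous polynomials and substitution of linear forms\<close>

lemma of_int_mult_ipoly: "of_int z * (P :: ipoly) = frag_cmul z P"
proof -
  have "of_int z * P = Poly_Mapping.single 0 z * P" by (metis id_apply of_int_eq_id single_of_int)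
  also have "\<dots> = Poly_Mapping.map ((*) z) P" by (rule mult_map_scale_conv_mult[symmetric])
  also have "\<dots> = frag_cmul z P"
    by (rule poly_mapping_eqI) (simp add: map.rep_eq when_def)
  finally show ?thesis .
qed

lemma carrier_sym_group: "P \<in> carrier (sym_group d n) \<longleftrightarrow> Poly_Mapping.keys P \<subseteq> sym_exps d n"
  by (simp add: sym_group_eq)

lemma mult_sym_group [simp]: "x \<otimes>\<^bsub>sym_group d n\<^esub> y = x + y"
  and one_sym_group [simp]: "\<one>\<^bsub>sym_group d n\<^esub> = 0"
  by (simp_all add: sym_group_def)

lemma comm_group_sym_group: "comm_group (sym_group d n)"
  by (simp add: sym_group_eq abelian_free_Abelian_group)

lemma sym_group_zero: "0 \<in> carrier (sym_group d n)"
  by (simp add: carrier_sym_group)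

lemma sym_group_add:
  "P \<in> carrier (sym_group d n) \<Longrightarrow> Q \<in> carrier (sym_group d n) \<Longrightarrow> P + Q \<in> carrier (sym_group d n)"
  using keys_add[of P Q] by (auto simp: carrier_sym_group)

lemma sym_group_diff:
  "P \<in> carrier (sym_group d n) \<Longrightarrow> Q \<in> carrier (sym_group d n) \<Longrightarrow> P - Q \<in> carrier (sym_group d n)"
  using keys_diff[of P Q] by (auto simp: carrier_sym_group)

lemma sym_group_uminus: "P \<in> carrier (sym_group d n) \<Longrightarrow> - P \<in> carrier (sym_group d n)"
  using sym_group_diff[OF sym_group_zero, of P d n] by simp

lemma sym_group_of_int_mult: "P \<in> carrier (sym_group d n) \<Longrightarrow> of_int z * P \<in> carrier (sym_group d n)"
  using keys_cmul[of z P] by (auto simp: carrier_sym_group of_int_mult_ipoly)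

text \<open>A nonzero integer factor does not change the support. This places exact quotients by p
  in the symmetric power.\<close>

lemma sym_group_of_int_multD:
  assumes "of_int z * P \<in> carrier (sym_group d n)" "z \<noteq> 0"
  shows "P \<in> carrier (sym_group d n)"
  using assms by (auto simp: carrier_sym_group of_int_mult_ipoly in_keys_iff subset_iff)

lemma sym_group_power:
  assumes "P \<in> carrier (sym_group c n)"
  shows "P ^ k \<in> carrier (sym_group (k * c) n)"
proof (induction k)
  case 0
  show ?case using of_int_sym_group[of 1 n] by simp
next
  case (Suc k)
  show ?case using sym_group_mult[OF assms Suc] by simp
qed

lemma subst_mat_power: "subst_mat M (P ^ k) = subst_mat M P ^ k"
  using subst_mat_of_int[of M 1] by (induction k) (auto simp: subst_mat_mult)

lemma subst_mat_gen_col: "j < dim_col M \<Longrightarrow> subst_mat M (gen j) = lin_form (dim_row M) (col M j)"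
  by (simp add: subst_mat_gen lin_form_def)

lemma frag_of_gens: "frag_of m = (\<Prod>i\<leftarrow>index_list m. gen i)"
  by (simp only: prod_gen index_list)

lemma subst_mat_prod_list: "subst_mat M (prod_list Ps) = prod_list (map (subst_mat M) Ps)"
  using subst_mat_of_int[of M 1] by (induction Ps) (auto simp: subst_mat_mult)

text \<open>Monomials are products of variables, so compatibility with differences and products
  reduces everything to the variables. Functoriality follows without expanding powers of linear
  forms.\<close>

lemma subst_mat_eqI:
  assumes "P \<in> carrier (sym_group d n)"
    and add: "\<And>P Q. f (P - Q) = f P - (f Q :: ipoly)"
    and prod: "\<And>Ps. f (prod_list Ps) = prod_list (map f Ps)"
    and gen: "\<And>i. i < n \<Longrightarrow> f (gen i) = subst_mat M (gen i)"
  shows "f P = subst_mat M P"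
proof -
  have "Poly_Mapping.keys P \<subseteq> sym_exps d n" using assms(1) by (simp add: carrier_sym_group)
  thus ?thesis
  proof (induction P rule: frag_induction)
    case zero
    show ?case using add[of 0 0] by (simp add: subst_mat_0)
  next
    case (one m)
    have "set (index_list m) \<subseteq> {..<n}" using index_list_in[OF one] by simp
    hence "map f (map gen (index_list m)) = map (subst_mat M) (map gen (index_list m))"
      using gen by auto
    thus ?case by (simp only: frag_of_gens prod subst_mat_prod_list)
  qed (simp add: add subst_mat_diff)
qed

lemma subst_mat_times:
  assumes "M \<in> carrier_mat s r" "N \<in> carrier_mat t s" "P \<in> carrier (sym_group d r)"
  shows "subst_mat (N * M) P = subst_mat N (subst_mat M P)"
proof (rule subst_mat_eqI[OF assms(3), where f = "\<lambda>P. subst_mat N (subst_mat M P)", symmetric])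
  fix i assume i: "i < r"
  have "col (N * M) i = N *\<^sub>v col M i" using assms i by (intro eq_vecI) auto
  thus "subst_mat N (subst_mat M (gen i)) = subst_mat (N * M) (gen i)"
    using i assms by (simp add: subst_mat_gen_col subst_mat_lin[of N t s])
qed (auto simp: subst_mat_diff subst_mat_prod_list comp_def)

lemma subst_mat_one:
  assumes "P \<in> carrier (sym_group d n)"
  shows "subst_mat (1\<^sub>m n) P = P"
  by (rule subst_mat_eqI[OF assms, where f = "\<lambda>P. P", symmetric]) (auto simp: subst_mat_gen_col lin_unit)

lemma subst_mat_carrier:
  assumes M: "M \<in> carrier_mat t s" and P: "P \<in> carrier (sym_group d s)"
  shows "subst_mat M P \<in> carrier (sym_group d t)"
proof -
  have "Poly_Mapping.keys P \<subseteq> sym_exps d s" using P by (simp add: carrier_sym_group)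
  thus ?thesis
  proof (induction P rule: frag_induction)
    case zero
    show ?case by (simp add: subst_mat_0 sym_group_zero)
  next
    case (one m)
    note il = index_list_in[OF one]
    have "map (subst_mat M) (map gen (index_list m)) = map (lin_form t) (map (col M) (index_list m))"
      using il M by (auto simp: subst_mat_gen_col)
    hence "subst_mat M (frag_of m) = prod_list (map (lin_form t) (map (col M) (index_list m)))"
      by (simp only: frag_of_gens subst_mat_prod_list)
    thus ?case using prod_lin_sym_group[of t "map (col M) (index_list m)"] il by (simp only: length_map)
  qed (simp add: subst_mat_diff sym_group_diff)
qed

section \<open>The additive power sum and the twist derived from it\<close>

lemma lin_form_add:
  "u \<in> carrier_vec n \<Longrightarrow> v \<in> carrier_vec n \<Longrightarrow> lin_form n (u + v) = lin_form n u + lin_form n v"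
  by (simp add: lin_form_def sum.distrib[symmetric] algebra_simps)

text \<open>This is \<sigma> in degree d.\<close>

definition diag_pow :: "nat \<Rightarrow> nat \<Rightarrow> int vec \<Rightarrow> ipoly" where
  "diag_pow d n v = (\<Sum>j<n. of_int (v $ j) * gen j ^ d)"

lemma diag_pow_add:
  "u \<in> carrier_vec n \<Longrightarrow> v \<in> carrier_vec n \<Longrightarrow> diag_pow d n (u + v) = diag_pow d n u + diag_pow d n v"
  by (simp add: diag_pow_def sum.distrib[symmetric] algebra_simps)

lemma diag_pow_carrier: "diag_pow d n v \<in> carrier (sym_group d n)"
  unfolding diag_pow_def
  by (intro sym_group_sum sym_group_of_int_mult) (use sym_group_power[OF gen_sym_group] in auto)

lemma diag_pow_unit: "i < n \<Longrightarrow> diag_pow d n (unit_vec n i) = gen i ^ d"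
proof -
  assume i: "i < n"
  have "diag_pow d n (unit_vec n i) = (\<Sum>j<n. if j = i then gen j ^ d else 0)"
    unfolding diag_pow_def by (rule sum.cong) (auto simp: i)
  thus ?thesis using i by simp
qed

lemma diag_pow_mult_vec:
  assumes "M \<in> carrier_mat t s" "v \<in> carrier_vec s"
  shows "diag_pow d t (M *\<^sub>v v) = (\<Sum>j<s. of_int (v $ j) * diag_pow d t (col M j))"
proof -
  have "diag_pow d t (M *\<^sub>v v) = (\<Sum>i<t. \<Sum>j<s. of_int (v $ j) * (of_int (M $$ (i, j)) * gen i ^ d))"
    unfolding diag_pow_def
    by (rule sum.cong) (use assms in \<open>auto simp: scalar_prod_def sum_distrib_left sum_distrib_right atLeast0LessThan mult_ac\<close>)
  also have "\<dots> = (\<Sum>j<s. \<Sum>i<t. of_int (v $ j) * (of_int (M $$ (i, j)) * gen i ^ d))" by (rule sum.swap)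
  also have "\<dots> = (\<Sum>j<s. of_int (v $ j) * diag_pow d t (col M j))"
    using assms by (simp add: diag_pow_def sum_distrib_left)
  finally show ?thesis .
qed

lemma subst_mat_diag_pow:
  assumes "M \<in> carrier_mat t s"
  shows "subst_mat M (diag_pow d s v) = (\<Sum>j<s. of_int (v $ j) * lin_form t (col M j) ^ d)"
  using assms
  by (simp add: diag_pow_def subst_mat_sum subst_mat_mult subst_mat_of_int subst_mat_power subst_mat_gen_col)

text \<open>The exact quotient by p; it exists since raising to the power \<open>d = p\<^sup>l\<close> is additive modulo p.\<close>

definition frob_quot :: "nat \<Rightarrow> nat \<Rightarrow> nat \<Rightarrow> int vec \<Rightarrow> ipoly" where
  "frob_quot p d n v = (THE W. of_int (int p) * W = lin_form n v ^ d - diag_pow d n v)"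

text \<open>This is D, written columnwise so that integrality and additivity in v are visible: at a
  basis vector, M \<sigma> - \<sigma> M is the d-th power of the linear form of a column minus
  \<sigma> of that column.\<close>

definition twist :: "nat \<Rightarrow> nat \<Rightarrow> int mat \<Rightarrow> int vec \<Rightarrow> ipoly" where
  "twist p d M v = (\<Sum>j<dim_col M. of_int (v $ j) * frob_quot p d (dim_row M) (col M j))"

text \<open>The groups do not depend on c. The value c = 1 gives the functor \<open>E_d\<close>, c =
  0 the direct sum.\<close>

definition twisted_functor :: "nat \<Rightarrow> nat \<Rightarrow> int \<Rightarrow> (ipoly \<times> int vec) ab_functor" where
  "twisted_functor p d c =
     \<lparr>obj = (\<lambda>s. obj (sym_functor d) s \<times>\<times> obj incl_functor s),
      arr = (\<lambda>M. block_map d M (\<lambda>v. of_int c * twist p d M v))\<rparr>"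

locale prime_power =
  fixes p l d :: nat
  assumes p: "prime p" and l: "l \<ge> 1" and d: "d = p ^ l"
begin

lemma p_pos: "p > 0" and d_pos: "d > 0" and d_gt_1: "d > 1"
proof -
  show "p > 0" "d > 0" using p d by (auto simp: prime_gt_0_nat)
  show "d > 1" using prime_gt_1_nat[OF p] l d by (auto intro!: one_less_power simp del: One_nat_def)
qed

lemma p_cancel: "of_int (int p) * P = of_int (int p) * (Q :: ipoly) \<longleftrightarrow> P = Q"
  using p_pos by simp

text \<open>The sum of all (v_j x_j)^d is inserted in between: raising to the power d is additive
  modulo p, and Fermat's congruence replaces each v_j^d by v_j. Cancellation of p gives the
  uniqueness that the description operator demands.\<close>

lemma frob_quot: "of_int (int p) * frob_quot p d n v = lin_form n v ^ d - diag_pow d n v"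
proof -
  have "of_nat p dvd (\<Sum>j<n. (of_int (v $ j) * gen j) ^ d) - diag_pow d n v"
  proof -
    have "of_nat p dvd (of_int (v $ j) * gen j) ^ d - of_int (v $ j) * gen j ^ d" for j
    proof -
      have "of_int (int p) dvd (of_int ((v $ j) ^ d - v $ j) :: ipoly)"
        using prime_power_fermat_dvd[OF p, of "v $ j" l]
        by (metis d dvd_def of_int_mult)
      hence "of_int (int p) dvd of_int ((v $ j) ^ d - v $ j) * gen j ^ d" by (rule dvd_mult2)
      thus ?thesis by (simp add: power_mult_distrib algebra_simps)
    qed
    thus ?thesis by (auto simp: diag_pow_def sum_subtractf[symmetric] intro!: dvd_sum)
  qed
  moreover have "of_nat p dvd lin_form n v ^ d - (\<Sum>j<n. (of_int (v $ j) * gen j) ^ d)"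
    using freshman_sum_dvd[OF p, of "{..<n}" "\<lambda>j. of_int (v $ j) * gen j" l]
    by (simp add: lin_form_def d)
  ultimately have "of_nat p dvd lin_form n v ^ d - diag_pow d n v"
    by (metis (no_types, lifting) dvd_add diff_add_cancel add_diff_eq)
  then obtain W where W: "of_int (int p) * W = lin_form n v ^ d - diag_pow d n v"
    by (metis dvd_def of_int_of_nat_eq)
  show ?thesis unfolding frob_quot_def
    by (rule theI[of _ W], rule W, metis W p_cancel)
qed

lemma frob_quot_eqI: "of_int (int p) * W = lin_form n v ^ d - diag_pow d n v \<Longrightarrow> frob_quot p d n v = W"
  using frob_quot p_cancel by metis

lemma frob_quot_carrier: "frob_quot p d n v \<in> carrier (sym_group d n)"
proof -
  have "of_int (int p) * frob_quot p d n v \<in> carrier (sym_group d n)"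
    unfolding frob_quot using sym_group_power[OF lin_sym_group] diag_pow_carrier by (auto intro!: sym_group_diff)
  thus ?thesis by (rule sym_group_of_int_multD) (use p_pos in auto)
qed

lemma frob_quot_unit: "i < n \<Longrightarrow> frob_quot p d n (unit_vec n i) = 0"
  by (rule frob_quot_eqI) (simp add: lin_unit diag_pow_unit)

lemma frob_quot_zero: "frob_quot p d n (0\<^sub>v n) = 0"
  using d_pos by (intro frob_quot_eqI) (simp add: lin_form_def diag_pow_def)

lemma twist_carrier: "M \<in> carrier_mat t s \<Longrightarrow> twist p d M v \<in> carrier (sym_group d t)"
  unfolding twist_def by (intro sym_group_sum sym_group_of_int_mult) (auto intro: frob_quot_carrier)

text \<open>So p times the twist is the coboundary of an integral additive map, which is why c will
  matter only modulo p.\<close>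

lemma p_twist:
  assumes "M \<in> carrier_mat t s" "v \<in> carrier_vec s"
  shows "of_int (int p) * twist p d M v = subst_mat M (diag_pow d s v) - diag_pow d t (M *\<^sub>v v)"
proof -
  have "of_int (int p) * twist p d M v = (\<Sum>j<s. of_int (v $ j) * (of_int (int p) * frob_quot p d t (col M j)))"
    using assms(1) by (simp add: twist_def sum_distrib_left mult_ac)
  also have "\<dots> = subst_mat M (diag_pow d s v) - diag_pow d t (M *\<^sub>v v)"
    unfolding frob_quot subst_mat_diag_pow[OF assms(1)] diag_pow_mult_vec[OF assms]
    by (simp add: sum_subtractf right_diff_distrib)
  finally show ?thesis .
qed

text \<open>The d-th power of a linear form commutes with substitution and drops out, leaving the
  coboundary of \<open>frob_quot\<close>.\<close>

lemma twist_frob_quot: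
  assumes "M \<in> carrier_mat t s" "v \<in> carrier_vec s"
  shows "twist p d M v = frob_quot p d t (M *\<^sub>v v) - subst_mat M (frob_quot p d s v)"
proof -
  have "of_int (int p) * subst_mat M (frob_quot p d s v) = subst_mat M (of_int (int p) * frob_quot p d s v)"
    by (simp only: subst_mat_mult subst_mat_of_int)
  also have "\<dots> = lin_form t (M *\<^sub>v v) ^ d - subst_mat M (diag_pow d s v)"
    by (simp only: frob_quot subst_mat_diff subst_mat_power subst_mat_lin[OF assms])
  finally have "of_int (int p) * twist p d M v =
      of_int (int p) * (frob_quot p d t (M *\<^sub>v v) - subst_mat M (frob_quot p d s v))"
    unfolding right_diff_distrib frob_quot p_twist[OF assms] by simp
  thus ?thesis by (simp only: p_cancel)
qed

text \<open>Telescoping: applying N to \<open>frob_quot\<close> of M v gives a term that occurs in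
  both summands with opposite signs.\<close>

lemma twist_times:
  assumes "M \<in> carrier_mat s r" "N \<in> carrier_mat t s" "v \<in> carrier_vec r"
  shows "twist p d (N * M) v = subst_mat N (twist p d M v) + twist p d N (M *\<^sub>v v)"
proof -
  have NM: "N * M \<in> carrier_mat t r" and Mv: "M *\<^sub>v v \<in> carrier_vec s" using assms by auto
  have "subst_mat (N * M) (frob_quot p d r v) = subst_mat N (subst_mat M (frob_quot p d r v))"
    by (rule subst_mat_times[OF assms(1,2) frob_quot_carrier])
  thus ?thesis using assms(1,2,3)
    by (simp add: twist_frob_quot[OF NM assms(3)] twist_frob_quot[OF assms(1,3)]
        twist_frob_quot[OF assms(2) Mv] subst_mat_diff)
qed

lemma twist_add:
  assumes "M \<in> carrier_mat t s" "u \<in> carrier_vec s" "v \<in> carrier_vec s"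
  shows "twist p d M (u + v) = twist p d M u + twist p d M v"
  using assms by (simp add: twist_def sum.distrib[symmetric] algebra_simps)

lemma twist_one: "v \<in> carrier_vec n \<Longrightarrow> twist p d (1\<^sub>m n) v = 0"
  by (simp add: twist_def frob_quot_unit)

end

section \<open>The twisted functors\<close>

lemma functor_comm_group: "is_ab_functor F \<Longrightarrow> comm_group (obj F n)"
  by (simp add: is_ab_functor_def)

lemma functor_hom: "is_ab_functor F \<Longrightarrow> M \<in> carrier_mat t s \<Longrightarrow> arr F M \<in> hom (obj F s) (obj F t)"
  by (simp add: is_ab_functor_def)

lemma functor_closed:
  "is_ab_functor F \<Longrightarrow> M \<in> carrier_mat t s \<Longrightarrow> x \<in> carrier (obj F s) \<Longrightarrow> arr F M x \<in> carrier (obj F t)"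
  using functor_hom[of F M t s] by (auto simp: hom_def)

lemma functor_extensional:
  "is_ab_functor F \<Longrightarrow> M \<in> carrier_mat t s \<Longrightarrow> arr F M \<in> extensional (carrier (obj F s))"
  by (auto simp: is_ab_functor_def)

lemma functor_one: "is_ab_functor F \<Longrightarrow> x \<in> carrier (obj F n) \<Longrightarrow> arr F (1\<^sub>m n) x = x"
  by (simp add: is_ab_functor_def)

lemma functor_times:
  assumes "is_ab_functor F" "M \<in> carrier_mat s r" "N \<in> carrier_mat t s" "x \<in> carrier (obj F r)"
  shows "arr F (N * M) x = arr F N (arr F M x)"
  using assms unfolding is_ab_functor_def by blast

lemma incl_functor_simps [simp]:
  "carrier (obj incl_functor n) = carrier_vec n"
  "x \<otimes>\<^bsub>obj incl_functor n\<^esub> y = x + y"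
  "\<one>\<^bsub>obj incl_functor n\<^esub> = 0\<^sub>v n"
  by (simp_all add: incl_functor_def)

lemma arr_incl_functor [simp]:
  "M \<in> carrier_mat t s \<Longrightarrow> v \<in> carrier_vec s \<Longrightarrow> arr incl_functor M v = M *\<^sub>v v"
  by (auto simp: incl_functor_def)

lemma obj_sym_functor [simp]: "obj (sym_functor d) = sym_group d"
  by (simp add: sym_functor_def)

lemma arr_sym_functor [simp]:
  "M \<in> carrier_mat t s \<Longrightarrow> P \<in> carrier (sym_group d s) \<Longrightarrow> arr (sym_functor d) M P = subst_mat M P"
  by (auto simp: sym_functor_def)

lemma comm_group_incl_functor: "comm_group (obj incl_functor n)"
proof (rule comm_groupI)
  fix x assume "x \<in> carrier (obj incl_functor n)"
  thus "\<exists>y\<in>carrier (obj incl_functor n). y \<otimes>\<^bsub>obj incl_functor n\<^esub> x = \<one>\<^bsub>obj incl_functor n\<^esub>"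
    by (intro bexI[of _ "- x"]) auto
qed (auto simp: assoc_add_vec[of _ n] comm_add_vec[of _ n])

lemma block_map_apply:
  assumes "M \<in> carrier_mat t s" "P \<in> carrier (sym_group d s)" "v \<in> carrier_vec s"
  shows "block_map d M D (P, v) = (subst_mat M P + D v, M *\<^sub>v v)"
  using assms by (auto simp: block_map_def)

lemma block_map_cong:
  assumes "\<And>v. v \<in> carrier_vec (dim_col M) \<Longrightarrow> D v = D' v"
  shows "block_map d M D = block_map d M D'"
  unfolding block_map_def by (rule restrict_ext) (use assms in auto)

lemma twisted_functor_simps [simp]:
  "obj (twisted_functor p d c) s = sym_group d s \<times>\<times> obj incl_functor s"
  by (simp add: twisted_functor_def)

lemma arr_twisted_functor [simp]:
  assumes "M \<in> carrier_mat t s" "P \<in> carrier (sym_group d s)" "v \<in> carrier_vec s"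
  shows "arr (twisted_functor p d c) M (P, v) = (subst_mat M P + of_int c * twist p d M v, M *\<^sub>v v)"
  using assms by (simp add: twisted_functor_def block_map_apply)

lemma direct_sum_eq_twisted_functor: "direct_sum (sym_functor d) incl_functor = twisted_functor p d 0"
  by (simp add: direct_sum_def twisted_functor_def block_map_def fun_eq_iff)

context prime_power
begin

lemma twisted_functor_functor: "is_ab_functor (twisted_functor p d c)"
  unfolding is_ab_functor_def
proof (intro conjI allI ballI)
  let ?F = "twisted_functor p d c"
  show "comm_group (obj ?F n)" for n
  proof -
    interpret S: comm_group "sym_group d n" by (rule comm_group_sym_group)
    interpret I: comm_group "obj incl_functor n" by (rule comm_group_incl_functor)
    have "group (sym_group d n \<times>\<times> obj incl_functor n)"
      by (intro DirProd_group S.is_group I.is_group)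
    thus ?thesis
      by (simp, intro group.group_comm_groupI) (auto simp: add.commute comm_add_vec[of _ n])
  qed
  show "arr ?F M \<in> hom (obj ?F s) (obj ?F t) \<inter> extensional (carrier (obj ?F s))"
    if M: "M \<in> carrier_mat t s" for M s t
  proof
    show "arr ?F M \<in> hom (obj ?F s) (obj ?F t)"
    proof (rule homI)
      fix x assume "x \<in> carrier (obj ?F s)"
      thus "arr ?F M x \<in> carrier (obj ?F t)"
        using M by (auto intro!: sym_group_add subst_mat_carrier sym_group_of_int_mult twist_carrier)
    next
      fix x y assume "x \<in> carrier (obj ?F s)" "y \<in> carrier (obj ?F s)"
      thus "arr ?F M (x \<otimes>\<^bsub>obj ?F s\<^esub> y) = arr ?F M x \<otimes>\<^bsub>obj ?F t\<^esub> arr ?F M y"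
        using M by (auto simp: sym_group_add subst_mat_add twist_add mult_add_distrib_mat_vec algebra_simps)
    qed
    show "arr ?F M \<in> extensional (carrier (obj ?F s))"
      using M by (auto simp: twisted_functor_def block_map_def)
  qed
  show "arr ?F (1\<^sub>m n) x = x" if "x \<in> carrier (obj ?F n)" for n x
    using that by (auto simp: subst_mat_one twist_one arr_twisted_functor[of _ n n])
  show "arr ?F (N * M) x = arr ?F N (arr ?F M x)"
    if "M \<in> carrier_mat s r" "N \<in> carrier_mat t s" "x \<in> carrier (obj ?F r)" for M N x r s t
  proof -
    note x0 = that(3)
    obtain P v where x: "x = (P, v)" and P: "P \<in> carrier (sym_group d r)" and v: "v \<in> carrier_vec r"
      using x0 by auto
    have NM: "N * M \<in> carrier_mat t r" using that by auto
    have c: "subst_mat M P + of_int c * twist p d M v \<in> carrier (sym_group d s)"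
      using that P by (intro sym_group_add subst_mat_carrier sym_group_of_int_mult twist_carrier)
    show ?thesis
      using that v unfolding x arr_twisted_functor[OF NM P v] arr_twisted_functor[OF that(1) P v]
      by (subst arr_twisted_functor[OF that(2) c])
         (auto simp: subst_mat_times[OF that(1,2) P] twist_times[OF that(1,2) v] subst_mat_add
           subst_mat_mult subst_mat_of_int distrib_left)
  qed
qed

lemma twisted_functor_extension:
  "is_extension incl_functor (sym_functor d) (sum_ext incl_functor (twisted_functor p d c))"
  unfolding is_extension_def
proof (intro conjI allI)
  let ?F = "twisted_functor p d c" and ?X = "sum_ext incl_functor (twisted_functor p d c)"
  show "is_ab_functor (middle ?X)" by (simp add: sum_ext_def twisted_functor_functor)
  show "nat_trans (sym_functor d) (middle ?X) (inc ?X)"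
  proof -
    have "twist p d M (0\<^sub>v s) = 0" if "M \<in> carrier_mat t s" for M t s
      using that by (simp add: twist_def)
    thus ?thesis
      by (auto simp: nat_trans_def sum_ext_def hom_def arr_twisted_functor arr_sym_functor[of _ _ _ _ d])
  qed
  show "nat_trans (middle ?X) incl_functor (prj ?X)"
    by (auto simp: nat_trans_def sum_ext_def hom_def arr_twisted_functor)
  fix n
  show "inc ?X n \<in> mon (obj (sym_functor d) n) (obj (middle ?X) n)"
    by (auto simp: sum_ext_def mon_def hom_def inj_on_def)
  show "prj ?X n \<in> epi (obj (middle ?X) n) (obj incl_functor n)"
    using sym_group_zero[of d n] by (force simp: sum_ext_def epi_def hom_def)
  show "inc ?X n ` carrier (obj (sym_functor d) n) = kernel (obj (middle ?X) n) (obj incl_functor n) (prj ?X n)"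
    by (auto simp: sum_ext_def kernel_def)
qed

section \<open>Values of the twist on the generating morphisms\<close>

lemma twist_eq_0:
  assumes "\<And>j. j < dim_col M \<Longrightarrow> (\<exists>i < dim_row M. col M j = unit_vec (dim_row M) i) \<or> col M j = 0\<^sub>v (dim_row M)"
  shows "twist p d M v = 0"
  unfolding twist_def
proof (intro sum.neutral ballI)
  fix j assume "j \<in> {..<dim_col M}"
  with assms[of j] show "of_int (v $ j) * frob_quot p d (dim_row M) (col M j) = 0"
    by (auto simp: frob_quot_unit frob_quot_zero)
qed

lemma twist_single:
  assumes "n < dim_col M" "\<And>j. j < dim_col M \<Longrightarrow> j \<noteq> n \<Longrightarrow> \<exists>i < dim_row M. col M j = unit_vec (dim_row M) i"
  shows "twist p d M v = of_int (v $ n) * frob_quot p d (dim_row M) (col M n)"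
proof -
  have "(\<Sum>j<dim_col M. of_int (v $ j) * frob_quot p d (dim_row M) (col M j)) =
      (\<Sum>j\<in>{n}. of_int (v $ j) * frob_quot p d (dim_row M) (col M j))"
  proof (rule sum.mono_neutral_right)
    show "\<forall>j\<in>{..<dim_col M} - {n}. of_int (v $ j) * frob_quot p d (dim_row M) (col M j) = 0"
    proof
      fix j assume "j \<in> {..<dim_col M} - {n}"
      then obtain i where "i < dim_row M" "col M j = unit_vec (dim_row M) i" using assms(2) by auto
      thus "of_int (v $ j) * frob_quot p d (dim_row M) (col M j) = 0" by (simp add: frob_quot_unit)
    qed
  qed (use assms(1) in auto)
  thus ?thesis by (simp add: twist_def)
qed

lemma lin_form_uminus: "v \<in> carrier_vec n \<Longrightarrow> lin_form n (- v) = - lin_form n v"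
  by (simp add: lin_form_def sum_negf)

lemma diag_pow_uminus: "v \<in> carrier_vec n \<Longrightarrow> diag_pow d n (- v) = - diag_pow d n v"
  by (simp add: diag_pow_def sum_negf)

lemma frob_quot_uminus_unit:
  assumes "i < n"
  shows "frob_quot p d n (- unit_vec n i) = of_int ((1 + (-1) ^ d) div int p) * gen i ^ d"
proof (rule frob_quot_eqI)
  \<comment> \<open>Fermat's congruence at -1 makes the prescribed coefficient integral.\<close>
  have "int p dvd 1 + (-1) ^ d"
    using prime_power_fermat_dvd[OF p, of "-1" l] by (simp add: d add.commute)
  hence "of_int (int p) * of_int ((1 + (-1) ^ d) div int p) = (of_int (1 + (-1) ^ d) :: ipoly)"
    by (metis dvd_mult_div_cancel of_int_mult)
  hence "of_int (int p) * (of_int ((1 + (-1) ^ d) div int p) * gen i ^ d) = (1 + (-1) ^ d) * gen i ^ d"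
    by (simp only: mult.assoc[symmetric]) simp
  also have "\<dots> = lin_form n (- unit_vec n i) ^ d - diag_pow d n (- unit_vec n i)"
    using assms by (simp add: lin_form_uminus diag_pow_uminus lin_unit diag_pow_unit power_minus[of "gen i"] algebra_simps)
  finally show "of_int (int p) * (of_int ((1 + (-1) ^ d) div int p) * gen i ^ d) =
    lin_form n (- unit_vec n i) ^ d - diag_pow d n (- unit_vec n i)" .
qed

text \<open>\<sigma> is additive, so only the d-th power contributes to the defect.\<close>

lemma frob_quot_add:
  assumes "u \<in> carrier_vec n" "v \<in> carrier_vec n"
  shows "of_int (int p) * (frob_quot p d n (u + v) - frob_quot p d n u - frob_quot p d n v) =
    (lin_form n u + lin_form n v) ^ d - lin_form n u ^ d - lin_form n v ^ d"
  unfolding right_diff_distrib frob_quot using assms by (simp add: lin_form_add diag_pow_add)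

lemma frob_quot_unit_add_unit:
  assumes "i < n" "j < n"
  shows "frob_quot p d n (unit_vec n i + unit_vec n j) =
    (\<Sum>k = 1..d - 1. of_nat ((d choose k) div p) * gen i ^ k * gen j ^ (d - k))"
proof -
  have "of_int (int p) * frob_quot p d n (unit_vec n i + unit_vec n j) =
      (gen i + gen j) ^ d - gen i ^ d - gen j ^ d"
    using frob_quot_add[of "unit_vec n i" n "unit_vec n j"] assms by (simp add: lin_unit frob_quot_unit)
  also have "\<dots> = (\<Sum>k = 1..d - 1. of_nat (d choose k) * gen i ^ k * gen j ^ (d - k))"
    using d_pos by (intro binomial_inner) simp
  also have "\<dots> = of_int (int p) * (\<Sum>k = 1..d - 1. of_nat ((d choose k) div p) * gen i ^ k * gen j ^ (d - k))"
    unfolding sum_distrib_left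
  proof (rule sum.cong)
    fix k assume "k \<in> {1..d - 1}"
    hence "p dvd (d choose k)" unfolding d by (intro prime_power_dvd_choose[OF p]) auto
    hence "(of_nat (d choose k) :: ipoly) = of_int (int p) * of_nat ((d choose k) div p)"
      by (metis dvd_mult_div_cancel of_int_of_nat_eq of_nat_mult)
    thus "of_nat (d choose k) * gen i ^ k * gen j ^ (d - k) =
      of_int (int p) * (of_nat ((d choose k) div p) * gen i ^ k * gen j ^ (d - k))" by (simp add: mult.assoc)
  qed simp
  finally show ?thesis by (simp only: p_cancel)
qed

text \<open>The columns of padded counit, unit, fold and swap are basis vectors or 0, where
  \<open>frob_quot\<close> vanishes. Padded negation and diagonal have one exceptional column each,
  -e_n and e_n + e_(n+1), and these account for the prescribed values.\<close>

lemma twisted_functor_is_E_functor: "is_E_functor p l (twisted_functor p d 1)"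
proof -
  have "twist p d (pad n f m) v = 0" if "f \<in> {counit_mat, unit_mat, fold_mat, swap_mat}" for n m f v
    by (rule twist_eq_0)
       (use that in \<open>auto simp: dim_pad_generators col_pad_counit col_pad_unit col_pad_fold col_pad_swap\<close>)
  moreover have "twist p d (pad n neg_mat m) v = basis_hom n (of_int ((1 + (-1) ^ d) div int p) * gen n ^ d) v" for n m v
    by (subst twist_single[of n])
       (auto simp: dim_pad_generators col_pad_neg frob_quot_uminus_unit basis_hom_def)
  moreover have "twist p d (pad n diag_mat2 m) v =
      basis_hom n (\<Sum>k = 1..d - 1. of_nat ((d choose k) div p) * gen n ^ k * gen (Suc n) ^ (d - k)) v" for n m v
    by (subst twist_single[of n])
       (auto simp: dim_pad_generators col_pad_diag frob_quot_unit_add_unit basis_hom_def)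
  ultimately show ?thesis
    unfolding is_E_functor_def Let_def d[symmetric]
    by (intro conjI ballI allI twisted_functor_functor)
       (auto simp: twisted_functor_def simp del: twisted_functor_simps intro!: block_map_cong)
qed

text \<open>Functoriality spreads agreement from the padded generators to all matrices. Arrows are
  \<open>undefined\<close> off their domains, so agreement on carriers is equality of functions and
  finally of records.\<close>

lemma is_E_functor_unique:
  assumes E: "is_E_functor p l E" and E': "is_E_functor p l E'"
  shows "E = E'"
proof -
  have o: "obj E s = sym_group d s \<times>\<times> obj incl_functor s" "obj E' s = sym_group d s \<times>\<times> obj incl_functor s" for s
    using E E' by (auto simp: is_E_functor_def Let_def d)
  hence oE: "obj E' s = obj E s" for s by simp
  have F: "is_ab_functor E" "is_ab_functor E'" using E E' by (auto simp: is_E_functor_def Let_def)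
  have ext: "arr E M \<in> extensional (carrier (obj E (dim_col M)))"
    "arr E' M \<in> extensional (carrier (obj E (dim_col M)))" for M
    using functor_extensional[OF F(1), of M "dim_row M" "dim_col M"] functor_extensional[OF F(2), of M "dim_row M" "dim_col M"]
    by (auto simp: oE)
  have gens: "arr E (pad n f m) = arr E' (pad n f m)" if "f \<in> generators" for n f m
    using that E E' by (auto simp: is_E_functor_def Let_def generators_def)
  interpret row_closed "\<lambda>M. arr E M = arr E' M"
  proof
    show "arr E (1\<^sub>m n) = arr E' (1\<^sub>m n)" for n
      by (rule extensionalityI[OF ext(1) ext(2)])
         (use functor_one[OF F(1)] functor_one[OF F(2)] in \<open>auto simp: oE\<close>)
    fix A f n m
    assume IH: "arr E A = arr E' A" and f: "f \<in> generators" and dim: "dim_col (pad n f m) = dim_row A"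
    let ?G = "pad n f m"
    have G: "?G \<in> carrier_mat (dim_row ?G) (dim_row A)" using dim by auto
    show "arr E (?G * A) = arr E' (?G * A)"
    proof (rule extensionalityI[OF ext(1) ext(2)])
      fix x assume "x \<in> carrier (obj E (dim_col (?G * A)))"
      hence x: "x \<in> carrier (obj E (dim_col A))" by simp
      have "arr E (?G * A) x = arr E ?G (arr E A x)"
        by (rule functor_times[OF F(1) carrier_matI[OF refl refl] G x])
      also have "\<dots> = arr E' ?G (arr E' A x)" by (simp add: IH gens[OF f])
      also have "\<dots> = arr E' (?G * A) x"
        using functor_times[OF F(2) carrier_matI[OF refl refl] G, of x] x by (simp add: oE)
      finally show "arr E (?G * A) x = arr E' (?G * A) x" .
    qed
  qed
  have "arr E = arr E'" using all by auto
  moreover have "obj E = obj E'" using oE by auto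
  ultimately show ?thesis by (cases E, cases E') auto
qed

lemma E_functor_eq: "E_functor p l = twisted_functor p d 1"
  unfolding E_functor_def
  by (rule the_equality) (auto intro: twisted_functor_is_E_functor is_E_functor_unique)

end

section \<open>Lifting the generator of \<open>I(1)\<close>\<close>

context prime_power
begin

section \<open>The additivity defect in two variables\<close>

abbreviation "cross_quot \<equiv> frob_quot p d 2 (unit_vec 2 0 + unit_vec 2 1)"

lemma p_cross_quot: "of_int (int p) * cross_quot = (gen 0 + gen 1) ^ d - gen 0 ^ d - gen 1 ^ d"
  using frob_quot_add[of "unit_vec 2 0" 2 "unit_vec 2 1"]
  by (simp add: lin_unit frob_quot_unit)

lemma gen_power: "gen i ^ k = frag_of (Poly_Mapping.single i k)"
  by (induction k) (auto simp: gen_def mult_single single_add[symmetric])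

text \<open>The exponent of the first variable separates the terms of the binomial expansion, so
  each coefficient can be read off.\<close>

lemma lookup_p_cross_quot:
  assumes "k \<in> {1..d - 1}"
  shows "Poly_Mapping.lookup (of_int (int p) * cross_quot)
      (Poly_Mapping.single 0 k + Poly_Mapping.single 1 (d - k)) = int (d choose k)"
proof -
  let ?m = "\<lambda>k. Poly_Mapping.single (0::nat) k + Poly_Mapping.single 1 (d - k)"
  have inj: "?m i = ?m k \<longleftrightarrow> i = k" for i
  proof
    assume "?m i = ?m k"
    hence "Poly_Mapping.lookup (?m i) 0 = Poly_Mapping.lookup (?m k) 0" by simp
    thus "i = k" by (simp add: lookup_add lookup_single)
  qed simp
  have "of_int (int p) * cross_quot = (\<Sum>i = 1..d - 1. of_nat (d choose i) * gen 0 ^ i * gen 1 ^ (d - i))"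
    unfolding p_cross_quot using d_pos by (intro binomial_inner) simp
  also have "\<dots> = (\<Sum>i = 1..d - 1. frag_cmul (int (d choose i)) (frag_of (?m i)))"
  proof (rule sum.cong)
    fix i
    have "of_nat (d choose i) * gen 0 ^ i * gen 1 ^ (d - i) = of_int (int (d choose i)) * frag_of (?m i)"
      by (simp add: gen_power mult_single mult.assoc)
    thus "of_nat (d choose i) * gen 0 ^ i * gen 1 ^ (d - i) = frag_cmul (int (d choose i)) (frag_of (?m i))"
      by (simp only: of_int_mult_ipoly)
  qed simp
  also have "Poly_Mapping.lookup \<dots> (?m k) = (\<Sum>i = 1..d - 1. if i = k then int (d choose i) else 0)"
    unfolding lookup_sum
    by (rule sum.cong) (auto simp: lookup_single when_def inj inj[THEN trans[OF eq_commute]] simp del: One_nat_def)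
  also have "\<dots> = int (d choose k)" using assms by simp
  finally show ?thesis .
qed

lemma cross_quot_nonzero: "cross_quot \<noteq> 0"
proof
  have one_in: "1 \<in> {1..d - 1}" using d_gt_1 by auto
  assume "cross_quot = 0"
  hence "int (d choose 1) = 0" using lookup_p_cross_quot[of 1] one_in by simp
  thus False using d_pos by simp
qed

lemma multiple_of_cross_quot:
  assumes eq: "of_int N * \<delta> = of_int a * (of_int (int p) * cross_quot)" and N: "N \<noteq> 0"
  shows "\<exists>c. \<delta> = of_int c * cross_quot"
proof -
  have dv: "N dvd a * int (d choose k)" if "k \<in> {1..d - 1}" for k
  proof -
    let ?m = "Poly_Mapping.single 0 k + Poly_Mapping.single 1 (d - k)"
    have "Poly_Mapping.lookup (of_int N * \<delta>) ?m = Poly_Mapping.lookup (of_int a * (of_int (int p) * cross_quot)) ?m"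
      by (simp only: eq)
    hence "N * Poly_Mapping.lookup \<delta> ?m = a * int (d choose k)"
      using lookup_p_cross_quot[OF that] by (simp add: of_int_mult_ipoly)
    thus ?thesis by (metis dvd_triv_left)
  qed
  \<comment> \<open>Both k = 1 and k = p^(l - 1) are inner positions, and comparing coefficients at
    these two is enough.\<close>
  have "p ^ (l - 1) < d" unfolding d using p l by (intro power_strict_increasing) (auto simp: prime_gt_Suc_0_nat)
  moreover have "0 < p ^ (l - 1)" using p_pos by simp
  ultimately have "N dvd a * int (d choose 1)" "N dvd a * int (d choose p ^ (l - 1))"
    using d_gt_1 by (intro dv; auto)+
  hence "N dvd gcd (a * int d) (a * int (d choose p ^ (l - 1)))" by simp
  also have "gcd (a * int d) (a * int (d choose p ^ (l - 1))) = normalize (a * gcd (int d) (int (d choose p ^ (l - 1))))"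
    by (simp add: gcd_mult_left normalize_mult)
  also have "gcd (int d) (int (d choose p ^ (l - 1))) = int p"
    unfolding d using gcd_choose_prime_power[OF p l] by (metis gcd_int_int_eq)
  finally have "N dvd a * int p" by simp
  then obtain c where c: "a * int p = N * c" by (rule dvdE)
  have "of_int N * \<delta> = of_int (a * int p) * cross_quot" by (simp add: eq mult.assoc)
  also have "\<dots> = of_int N * (of_int c * cross_quot)" by (simp only: c of_int_mult mult.assoc)
  finally show ?thesis using N by auto
qed

text \<open>In one variable the exponent is forced to be d. Two lifts of the generator of I(1)
  therefore differ by a single integer a.\<close>

lemma sym_group_rank_one:
  assumes "P \<in> carrier (sym_group d 1)"
  obtains a where "P = of_int a * gen 0 ^ d"
proof -
  have "m = Poly_Mapping.single 0 d" if "m \<in> sym_exps d 1" for m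
  proof (rule poly_mapping_eqI)
    fix i show "Poly_Mapping.lookup m i = Poly_Mapping.lookup (Poly_Mapping.single 0 d) i"
      using that by (cases "i = 0") (auto simp: sym_exps_iff lookup_single when_def in_keys_iff)
  qed
  hence "Poly_Mapping.keys P \<subseteq> {Poly_Mapping.single 0 d}" using assms by (auto simp: carrier_sym_group)
  hence "P = frag_cmul (Poly_Mapping.lookup P (Poly_Mapping.single 0 d)) (frag_of (Poly_Mapping.single 0 d))"
    by (intro poly_mapping_eqI) (auto simp: lookup_single when_def in_keys_iff subset_iff)
  thus ?thesis using that by (simp only: of_int_mult_ipoly gen_power)
qed

end

lemma mat_mult_unit_vec:
  assumes "M \<in> carrier_mat t s" "i < s"
  shows "M *\<^sub>v unit_vec s i = (col M i :: int vec)"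
  using assms by (intro eq_vecI) auto

lemma mult_mat_of_cols_single:
  assumes "M \<in> carrier_mat t s" "v \<in> carrier_vec s"
  shows "M * mat_of_cols s [v] = mat_of_cols t [M *\<^sub>v v]"
  using assms by (intro eq_matI) (auto simp: mat_of_cols_def intro!: arg_cong2[of _ _ _ _ scalar_prod] eq_vecI)

lemma mat_of_cols_single_mult_vec:
  assumes "v \<in> carrier_vec t"
  shows "mat_of_cols t [v] *\<^sub>v unit_vec 1 0 = (v :: int vec)"
  using mat_mult_unit_vec[OF mat_of_cols_carrier(1)[of t "[v]"], of 0] assms by simp

section \<open>Calculus in an arbitrary extension\<close>

locale sym_extension = prime_power +
  fixes X :: "(ipoly, 'b, int vec) fun_ext"
  assumes X: "is_extension incl_functor (sym_functor d) X"
begin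

abbreviation "E \<equiv> middle X"

lemma middle_functor: "is_ab_functor E"
  using X by (simp add: is_extension_def)

sublocale E: comm_group "obj E n" for n
  by (rule functor_comm_group[OF middle_functor])

lemma inc_hom: "inc X n \<in> hom (sym_group d n) (obj E n)"
  and prj_hom: "prj X n \<in> hom (obj E n) (obj incl_functor n)"
  and inc_inj_on: "inj_on (inc X n) (carrier (sym_group d n))"
  and prj_surj: "prj X n ` carrier (obj E n) = carrier_vec n"
  and exact: "inc X n ` carrier (sym_group d n) = kernel (obj E n) (obj incl_functor n) (prj X n)"
  using X by (auto simp: is_extension_def mon_def epi_def)

lemma inc_closed [simp]: "P \<in> carrier (sym_group d n) \<Longrightarrow> inc X n P \<in> carrier (obj E n)"
  using inc_hom by (auto simp: hom_def)

lemma inc_add: "P \<in> carrier (sym_group d n) \<Longrightarrow> Q \<in> carrier (sym_group d n) \<Longrightarrow>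
    inc X n (P + Q) = inc X n P \<otimes>\<^bsub>obj E n\<^esub> inc X n Q"
  using inc_hom[of n] by (auto simp: hom_def)

lemma inc_zero: "inc X n 0 = \<one>\<^bsub>obj E n\<^esub>"
  using inc_add[of 0 n 0] inc_closed[of 0 n] by (metis E.r_cancel_one' add_0 sym_group_zero)

lemma prj_closed [simp]: "x \<in> carrier (obj E n) \<Longrightarrow> prj X n x \<in> carrier_vec n"
  using prj_hom[of n] by (auto simp: hom_def)

lemma prj_mult: "x \<in> carrier (obj E n) \<Longrightarrow> y \<in> carrier (obj E n) \<Longrightarrow>
    prj X n (x \<otimes>\<^bsub>obj E n\<^esub> y) = prj X n x + prj X n y"
  using prj_hom[of n] by (auto simp: hom_def)

lemma prj_inc: "P \<in> carrier (sym_group d n) \<Longrightarrow> prj X n (inc X n P) = 0\<^sub>v n"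
  using exact[of n] by (auto simp: kernel_def)

lemma inc_natural:
  "M \<in> carrier_mat t s \<Longrightarrow> P \<in> carrier (sym_group d s) \<Longrightarrow> arr E M (inc X s P) = inc X t (subst_mat M P)"
  using X unfolding is_extension_def nat_trans_def by (metis arr_sym_functor obj_sym_functor)

lemma prj_natural:
  "M \<in> carrier_mat t s \<Longrightarrow> x \<in> carrier (obj E s) \<Longrightarrow> prj X t (arr E M x) = M *\<^sub>v prj X s x"
  using X unfolding is_extension_def nat_trans_def by (metis arr_incl_functor prj_closed)

lemma arr_closed [simp]: "M \<in> carrier_mat t s \<Longrightarrow> x \<in> carrier (obj E s) \<Longrightarrow> arr E M x \<in> carrier (obj E t)"
  by (rule functor_closed[OF middle_functor])

lemma arr_mult:
  "M \<in> carrier_mat t s \<Longrightarrow> x \<in> carrier (obj E s) \<Longrightarrow> y \<in> carrier (obj E s) \<Longrightarrow>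
    arr E M (x \<otimes>\<^bsub>obj E s\<^esub> y) = arr E M x \<otimes>\<^bsub>obj E t\<^esub> arr E M y"
  using functor_hom[OF middle_functor, of M t s] by (auto simp: hom_def)

lemma prj_eqE:
  assumes "x \<in> carrier (obj E n)" "y \<in> carrier (obj E n)" "prj X n x = prj X n y"
  obtains P where "P \<in> carrier (sym_group d n)" "x = y \<otimes>\<^bsub>obj E n\<^esub> inc X n P"
proof -
  let ?z = "inv\<^bsub>obj E n\<^esub> y \<otimes>\<^bsub>obj E n\<^esub> x"
  have z: "?z \<in> carrier (obj E n)" using assms by simp
  have x: "x = y \<otimes>\<^bsub>obj E n\<^esub> ?z" using assms E.inv_solve_left by (metis E.inv_closed z)
  have "prj X n y = prj X n y + prj X n ?z" using prj_mult[OF assms(2) z] x assms(3) by simp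
  hence "prj X n y $ i = prj X n y $ i + prj X n ?z $ i" if "i < n" for i
    using prj_closed[OF z] that by (metis carrier_vecD index_add_vec(1))
  hence "prj X n ?z = 0\<^sub>v n" using prj_closed[OF z] by (intro eq_vecI) auto
  hence "?z \<in> inc X n ` carrier (sym_group d n)" using z exact[of n] by (simp add: kernel_def)
  thus ?thesis using that x by auto
qed

end

section \<open>The natural family of lifts and its additivity defect\<close>

context sym_extension
begin

text \<open>Yoneda: the one-column matrix v is the morphism 1 -> t that sends the generator to v, so
  e in E(1) yields a family natural in t. If e lifts the generator, this family lifts every v, but
  nothing forces it to be additive in v.\<close>

definition push :: "'b \<Rightarrow> nat \<Rightarrow> int vec \<Rightarrow> 'b" where
  "push e t v = arr E (mat_of_cols t [v]) e"

lemma mat_of_cols_single_carrier: "mat_of_cols t [v] \<in> carrier_mat t 1"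
  by (simp add: mat_of_cols_def)

context
  fixes e
  assumes e: "e \<in> carrier (obj E 1)"
begin

lemma push_closed [simp]: "push e t v \<in> carrier (obj E t)"
  unfolding push_def by (rule arr_closed[OF mat_of_cols_single_carrier e])

lemma arr_push:
  assumes "M \<in> carrier_mat t s" "v \<in> carrier_vec s"
  shows "arr E M (push e s v) = push e t (M *\<^sub>v v)"
  unfolding push_def
  by (subst functor_times[OF middle_functor mat_of_cols_single_carrier assms(1) e, symmetric])
     (simp add: mult_mat_of_cols_single[OF assms])

lemma prj_push:
  assumes "prj X 1 e = unit_vec 1 0" "v \<in> carrier_vec t"
  shows "prj X t (push e t v) = v"
  unfolding push_def
  using prj_natural[OF mat_of_cols_single_carrier e, of t v] mat_of_cols_single_mult_vec assms by simp

end

text \<open>\<open>cross_lift c e\<close>: the lift \<open>e\<close> of the generator of \<open>I(1)\<close> deviates from additivity by c times the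
  deviation in \<open>E\<^sub>d\<close>; this c classifies the extension.\<close>

definition cross_lift :: "int \<Rightarrow> 'b \<Rightarrow> bool" where
  "cross_lift c e \<longleftrightarrow> e \<in> carrier (obj E 1) \<and> prj X 1 e = unit_vec 1 0 \<and>
     push e 2 (unit_vec 2 0 + unit_vec 2 1) =
       push e 2 (unit_vec 2 0) \<otimes>\<^bsub>obj E 2\<^esub> push e 2 (unit_vec 2 1) \<otimes>\<^bsub>obj E 2\<^esub> inc X 2 (of_int c * cross_quot)"

lemma scalar_mat_mult_vec: "v \<in> carrier_vec n \<Longrightarrow> (2 \<cdot>\<^sub>m 1\<^sub>m n) *\<^sub>v v = 2 \<cdot>\<^sub>v (v :: int vec)"
  by (intro eq_vecI) (auto simp: row_smult)

lemma subst_double: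
  assumes "P \<in> carrier (sym_group d n)"
  shows "subst_mat (2 \<cdot>\<^sub>m 1\<^sub>m n) P = 2 ^ d * P"
proof -
  let ?T = "2 \<cdot>\<^sub>m 1\<^sub>m n :: int mat"
  have g: "subst_mat ?T (gen i) = 2 * gen i" if "i < n" for i
  proof -
    have "col ?T i = unit_vec n i + unit_vec n i" using that by (intro eq_vecI) auto
    thus ?thesis using that by (simp add: subst_mat_gen_col lin_form_add lin_unit)
  qed
  have "Poly_Mapping.keys P \<subseteq> sym_exps d n" using assms by (simp add: carrier_sym_group)
  thus ?thesis
  proof (induction P rule: frag_induction)
    case zero
    show ?case by (simp add: subst_mat_0)
  next
    case (one m)
    have "(\<Prod>i\<leftarrow>js. subst_mat ?T (gen i)) = 2 ^ length js * (\<Prod>i\<leftarrow>js. gen i)" if "set js \<subseteq> {..<n}" for js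
      using that by (induction js) (auto simp: g mult_ac)
    from this[of "index_list m"] index_list_in[OF one] show ?case
      by (simp add: frag_of_gens subst_mat_prod_list comp_def)
  qed (simp add: subst_mat_diff right_diff_distrib)
qed

text \<open>Multiplication by 2 acts on \<open>S\<^sup>d\<close> as \<open>2\<^sup>d\<close> but on I as 2. Comparing both actions on a lift bounds
  the deviation from additivity up to the factor \<open>2\<^sup>d - 2\<close>.\<close>

lemma ex_cross_lift: "\<exists>c e. cross_lift c e"
proof -
  let ?u = "unit_vec 2 0 :: int vec" and ?v = "unit_vec 2 1 :: int vec"
  let ?T = "\<lambda>n. 2 \<cdot>\<^sub>m 1\<^sub>m n :: int mat"
  have T: "?T n \<in> carrier_mat n n" for n by simp
  obtain e where e: "e \<in> carrier (obj E 1)" and pe: "prj X 1 e = unit_vec 1 0"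
    using prj_surj[of 1] by (metis imageE unit_vec_carrier)
  note [simp] = push_closed[OF e]
  have "prj X 1 (arr E (?T 1) e) = prj X 1 (e \<otimes>\<^bsub>obj E 1\<^esub> e)"
    using e pe T[of 1] by (simp add: prj_natural[OF T] prj_mult scalar_mat_mult_vec del: One_nat_def)
       (intro eq_vecI; simp)
  \<comment> \<open>\<alpha> measures how far multiplication by 2 on e is from e + e; being
    homogeneous in one variable, it supplies the integer a.\<close>
  then obtain \<alpha> where \<alpha>: "\<alpha> \<in> carrier (sym_group d 1)"
    and Te: "arr E (?T 1) e = e \<otimes>\<^bsub>obj E 1\<^esub> e \<otimes>\<^bsub>obj E 1\<^esub> inc X 1 \<alpha>"
    using prj_eqE[of "arr E (?T 1) e" 1 "e \<otimes>\<^bsub>obj E 1\<^esub> e"] e arr_closed[OF T] by auto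
  obtain a where a: "\<alpha> = of_int a * gen 0 ^ d" using sym_group_rank_one[OF \<alpha>] .
  have S: "subst_mat (mat_of_cols t [v]) \<alpha> = of_int a * lin_form t v ^ d" if "v \<in> carrier_vec t" for t v
    using that by (simp add: a subst_mat_mult subst_mat_of_int subst_mat_power subst_mat_gen_col)
  have Sc: "of_int a * lin_form t v ^ d \<in> carrier (sym_group d t)" for t v
    using sym_group_power[OF lin_sym_group, of t v d] by (intro sym_group_of_int_mult) simp
  have Tp: "arr E (?T t) (push e t v) =
      push e t v \<otimes>\<^bsub>obj E t\<^esub> push e t v \<otimes>\<^bsub>obj E t\<^esub> inc X t (of_int a * lin_form t v ^ d)"
    if v: "v \<in> carrier_vec t" for t v
  proof -
    note M = mat_of_cols_single_carrier[of t v]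
    \<comment> \<open>Scalars commute with every matrix, so the error at e is transported to all
      lifts: at v it is a times the d-th power of the linear form of v.\<close>
    have "?T t * mat_of_cols t [v] = mat_of_cols t [v] * ?T 1"
      using M by (simp add: mult_smult_assoc_mat[OF one_carrier_mat M] mult_smult_distrib[OF M one_carrier_mat] del: One_nat_def)
    hence "arr E (?T t) (push e t v) = arr E (mat_of_cols t [v]) (arr E (?T 1) e)"
      unfolding push_def
      by (simp only: functor_times[OF middle_functor M T e, symmetric] functor_times[OF middle_functor T M e, symmetric])
    also have "\<dots> = push e t v \<otimes>\<^bsub>obj E t\<^esub> push e t v \<otimes>\<^bsub>obj E t\<^esub> inc X t (subst_mat (mat_of_cols t [v]) \<alpha>)"
      unfolding Te using e \<alpha> by (simp add: arr_mult[OF M] inc_natural[OF M] push_def del: One_nat_def)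
    finally show ?thesis by (simp only: S[OF v])
  qed
  let ?x = "push e 2 (?u + ?v)" and ?y = "push e 2 ?u \<otimes>\<^bsub>obj E 2\<^esub> push e 2 ?v"
  have "prj X 2 ?x = prj X 2 ?y"
    by (simp add: prj_mult prj_push[OF e pe])
  then obtain \<delta> where \<delta>: "\<delta> \<in> carrier (sym_group d 2)" and x: "?x = ?y \<otimes>\<^bsub>obj E 2\<^esub> inc X 2 \<delta>"
    using prj_eqE[of ?x 2 ?y] by auto
  let ?A = "of_int a * (gen 0 + gen 1) ^ d" and ?B = "of_int a * gen 0 ^ d" and ?C = "of_int a * gen 1 ^ d"
  have A: "?A \<in> carrier (sym_group d 2)" "?B \<in> carrier (sym_group d 2)" "?C \<in> carrier (sym_group d 2)"
    using Sc[of 2 "?u + ?v"] Sc[of 2 ?u] Sc[of 2 ?v] by (simp_all add: lin_form_add lin_unit)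
  have D: "2 ^ d * \<delta> \<in> carrier (sym_group d 2)" using subst_mat_carrier[OF T \<delta>] by (simp add: subst_double[OF \<delta>])
  have "2 * \<delta> \<in> carrier (sym_group d 2)" "inc X 2 (2 * \<delta>) = inc X 2 \<delta> \<otimes>\<^bsub>obj E 2\<^esub> inc X 2 \<delta>"
    using \<delta> by (simp_all only: mult_2 inc_add sym_group_add)
  note D2 = this
  \<comment> \<open>Multiplication by 2 is evaluated twice on the lift of e_0 + e_1: on the lift as
    a whole, with error a (x_0 + x_1)^d, and termwise on the two basis lifts and \<delta>, with
    errors a x_0^d and a x_1^d and \<delta> scaled by 2^d.\<close>
  have "?y \<otimes>\<^bsub>obj E 2\<^esub> ?y \<otimes>\<^bsub>obj E 2\<^esub> inc X 2 (2 * \<delta> + ?A) = ?x \<otimes>\<^bsub>obj E 2\<^esub> ?x \<otimes>\<^bsub>obj E 2\<^esub> inc X 2 ?A"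
    unfolding x using A \<delta> D2 by (simp add: inc_add E.m_ac)
  also have "\<dots> = arr E (?T 2) ?x"
    by (subst Tp) (simp_all add: lin_form_add lin_unit)
  also have "\<dots> = arr E (?T 2) (push e 2 ?u) \<otimes>\<^bsub>obj E 2\<^esub> arr E (?T 2) (push e 2 ?v) \<otimes>\<^bsub>obj E 2\<^esub> inc X 2 (2 ^ d * \<delta>)"
    unfolding x using \<delta> by (simp add: arr_mult[OF T] inc_natural[OF T] subst_double)
  also have "\<dots> = ?y \<otimes>\<^bsub>obj E 2\<^esub> ?y \<otimes>\<^bsub>obj E 2\<^esub> inc X 2 (?B + ?C + 2 ^ d * \<delta>)"
    using A D by (simp add: Tp lin_unit inc_add sym_group_add E.m_ac)
  finally have "inc X 2 (2 * \<delta> + ?A) = inc X 2 (?B + ?C + 2 ^ d * \<delta>)"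
    using A D D2 by (simp add: sym_group_add)
  hence "2 * \<delta> + ?A = ?B + ?C + 2 ^ d * \<delta>"
    using inc_inj_on[of 2] A D D2 by (simp add: inj_on_def sym_group_add)
  hence "of_int (2 ^ d - 2) * \<delta> = of_int a * (of_int (int p) * cross_quot)"
    unfolding p_cross_quot by (simp add: algebra_simps)
  \<comment> \<open>This needs d > 1; for d = 1 the two actions of 2 coincide.\<close>
  moreover have "(2::int) ^ d - 2 \<noteq> 0"
    using power_strict_increasing[OF d_gt_1, of "2::int"] by simp
  ultimately obtain c where "\<delta> = of_int c * cross_quot" using multiple_of_cross_quot by blast
  thus ?thesis using e pe x by (auto simp: cross_lift_def)
qed

text \<open>The matrix with columns u and v carries the basis of rank 2 to u and v, so naturality
  transports the one relation defining \<open>cross_lift\<close> to all pairs of vectors.\<close>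

lemma push_add:
  assumes e: "cross_lift c e" and u: "u \<in> carrier_vec t" and v: "v \<in> carrier_vec t"
  shows "push e t (u + v) = push e t u \<otimes>\<^bsub>obj E t\<^esub> push e t v \<otimes>\<^bsub>obj E t\<^esub>
    inc X t (of_int c * (frob_quot p d t (u + v) - frob_quot p d t u - frob_quot p d t v))"
proof -
  let ?W = "mat_of_cols t [u, v]"
  have W: "?W \<in> carrier_mat t 2" using mat_of_cols_carrier(1)[of t "[u, v]"] by (simp add: numeral_2_eq_2)
  have e1: "e \<in> carrier (obj E 1)" using e by (simp add: cross_lift_def)
  have W0: "?W *\<^sub>v unit_vec 2 0 = u" and W1: "?W *\<^sub>v unit_vec 2 1 = v"
    using mat_mult_unit_vec[OF W, of 0] mat_mult_unit_vec[OF W, of 1] u v by simp_all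
  have W01: "?W *\<^sub>v (unit_vec 2 0 + unit_vec 2 1) = u + v"
    using W W0 W1 by (simp add: mult_add_distrib_mat_vec[of _ t 2])
  \<comment> \<open>Substituting the linear forms of u and v into the cross term gives the defect of
    \<open>frob_quot\<close> at u and v; both sides are compared after multiplication by p.\<close>
  have B: "subst_mat ?W cross_quot = frob_quot p d t (u + v) - frob_quot p d t u - frob_quot p d t v"
  proof -
    have "of_int (int p) * subst_mat ?W cross_quot = subst_mat ?W (of_int (int p) * cross_quot)"
      by (simp only: subst_mat_mult subst_mat_of_int)
    also have "\<dots> = (lin_form t u + lin_form t v) ^ d - lin_form t u ^ d - lin_form t v ^ d"
      unfolding p_cross_quot using W u v
      by (simp add: subst_mat_diff subst_mat_power subst_mat_add subst_mat_gen_col)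
    finally have "of_int (int p) * subst_mat ?W cross_quot =
      of_int (int p) * (frob_quot p d t (u + v) - frob_quot p d t u - frob_quot p d t v)"
      by (simp only: frob_quot_add[OF u v])
    thus ?thesis by (simp only: p_cancel)
  qed
  have "push e t (u + v) = arr E ?W (push e 2 (unit_vec 2 0 + unit_vec 2 1))"
    by (simp add: arr_push[OF e1 W] W01[simplified])
  also have "\<dots> = arr E ?W (push e 2 (unit_vec 2 0)) \<otimes>\<^bsub>obj E t\<^esub> arr E ?W (push e 2 (unit_vec 2 1)) \<otimes>\<^bsub>obj E t\<^esub>
      inc X t (subst_mat ?W (of_int c * cross_quot))"
    using e W sym_group_of_int_mult[OF frob_quot_carrier[of 2 "unit_vec 2 0 + unit_vec 2 1"], of c]
    by (simp add: cross_lift_def arr_mult[OF W] inc_natural[OF W] push_closed[OF e1])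
  also have "\<dots> = push e t u \<otimes>\<^bsub>obj E t\<^esub> push e t v \<otimes>\<^bsub>obj E t\<^esub>
    inc X t (of_int c * (frob_quot p d t (u + v) - frob_quot p d t u - frob_quot p d t v))"
    using arr_push[OF e1 W, of "unit_vec 2 0"] arr_push[OF e1 W, of "unit_vec 2 1"] W0 W1
    by (simp only: subst_mat_mult subst_mat_of_int B unit_vec_carrier)
  finally show ?thesis .
qed

abbreviation "qc c n v \<equiv> of_int c * frob_quot p d n v"

lemma qc_closed: "P \<in> carrier (sym_group d n) \<Longrightarrow> P - qc c n v \<in> carrier (sym_group d n)"
  by (intro sym_group_diff sym_group_of_int_mult frob_quot_carrier)

lemma cross_lift_ext_equiv:
  assumes e: "cross_lift c e"
  shows "ext_equiv incl_functor (sym_functor d) (sum_ext incl_functor (twisted_functor p d c)) X"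
proof -
  let ?F = "twisted_functor p d c"
  have e1: "e \<in> carrier (obj E 1)" and pe: "prj X 1 e = unit_vec 1 0" using e by (auto simp: cross_lift_def)
  note [simp] = push_closed[OF e1] qc_closed
  \<comment> \<open>\<open>push e\<close> has c times the defect of \<open>frob_quot\<close>, so
    subtracting c times \<open>frob_quot\<close> along the inclusion restores additivity.\<close>
  define \<theta> where "\<theta> n = (\<lambda>(P, v). push e n v \<otimes>\<^bsub>obj E n\<^esub> inc X n (P - qc c n v))" for n
  have \<theta>_prj: "prj X n (\<theta> n (P, v)) = v" if "P \<in> carrier (sym_group d n)" "v \<in> carrier_vec n" for n P v
    using that by (simp add: \<theta>_def prj_mult prj_inc prj_push[OF e1 pe])
  have \<theta>_hom: "\<theta> n \<in> hom (obj ?F n) (obj E n)" for n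
  proof (rule homI)
    show "\<theta> n x \<in> carrier (obj E n)" if "x \<in> carrier (obj ?F n)" for x
      using that by (auto simp: \<theta>_def)
    fix x y assume "x \<in> carrier (obj ?F n)" "y \<in> carrier (obj ?F n)"
    then obtain P u Q v where xy: "x = (P, u)" "y = (Q, v)" and c: "P \<in> carrier (sym_group d n)"
      "Q \<in> carrier (sym_group d n)" "u \<in> carrier_vec n" "v \<in> carrier_vec n" by auto
    let ?R = "of_int c * (frob_quot p d n (u + v) - frob_quot p d n u - frob_quot p d n v)"
    have R: "?R \<in> carrier (sym_group d n)"
      by (intro sym_group_of_int_mult sym_group_diff frob_quot_carrier)
    have PQ: "P + Q \<in> carrier (sym_group d n)" using c by (intro sym_group_add)
    have "\<theta> n (x \<otimes>\<^bsub>obj ?F n\<^esub> y) = push e n u \<otimes>\<^bsub>obj E n\<^esub> push e n v \<otimes>\<^bsub>obj E n\<^esub>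
        (inc X n ?R \<otimes>\<^bsub>obj E n\<^esub> inc X n (P + Q - qc c n (u + v)))"
      using c R PQ by (simp add: xy \<theta>_def push_add[OF e] E.m_assoc)
    also have "inc X n ?R \<otimes>\<^bsub>obj E n\<^esub> inc X n (P + Q - qc c n (u + v)) = inc X n ((P - qc c n u) + (Q - qc c n v))"
      using R PQ by (simp add: inc_add[symmetric] algebra_simps)
    also have "\<dots> = inc X n (P - qc c n u) \<otimes>\<^bsub>obj E n\<^esub> inc X n (Q - qc c n v)"
      using c by (simp add: inc_add)
    finally show "\<theta> n (x \<otimes>\<^bsub>obj ?F n\<^esub> y) = \<theta> n x \<otimes>\<^bsub>obj E n\<^esub> \<theta> n y"
      using c by (simp add: xy \<theta>_def E.m_ac)
  qed
  have push0: "push e n (0\<^sub>v n) = \<one>\<^bsub>obj E n\<^esub>" for n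
    using push_add[OF e, of "0\<^sub>v n" n "0\<^sub>v n"] by (simp add: frob_quot_zero inc_zero)
  show ?thesis
    unfolding ext_equiv_def
  proof (intro exI[of _ \<theta>] conjI allI ballI)
    show "nat_trans (middle (sum_ext incl_functor ?F)) E \<theta>"
      unfolding nat_trans_def sum_ext_def fun_ext.simps
    proof (intro conjI allI ballI)
      show "\<theta> n \<in> hom (obj ?F n) (obj E n)" for n by (rule \<theta>_hom)
      fix s t x and M :: "int mat" assume M: "M \<in> carrier_mat t s" and "x \<in> carrier (obj ?F s)"
      then obtain P v where x: "x = (P, v)" and P: "P \<in> carrier (sym_group d s)" and v: "v \<in> carrier_vec s" by auto
      \<comment> \<open>The price is naturality: \<open>frob_quot\<close> does not commute with M,
        and the error is exactly the twist.\<close>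
      have "subst_mat M P + of_int c * twist p d M v - qc c t (M *\<^sub>v v) = subst_mat M (P - qc c s v)"
        by (simp add: twist_frob_quot[OF M v] subst_mat_diff subst_mat_mult subst_mat_of_int algebra_simps)
      thus "\<theta> t (arr ?F M x) = arr E M (\<theta> s x)"
        using P by (simp add: x arr_twisted_functor[OF M P v] \<theta>_def arr_mult[OF M] arr_push[OF e1 M v] inc_natural[OF M])
    qed
    fix n
    show "\<theta> n \<in> iso (obj (middle (sum_ext incl_functor ?F)) n) (obj E n)"
      unfolding iso_def sum_ext_def fun_ext.simps
    proof (intro CollectI conjI \<theta>_hom bij_betw_imageI)
      show "inj_on (\<theta> n) (carrier (obj ?F n))"
      proof (rule inj_onI)
        fix x y assume "x \<in> carrier (obj ?F n)" "y \<in> carrier (obj ?F n)" and eq: "\<theta> n x = \<theta> n y"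
        then obtain P u Q v where xy: "x = (P, u)" "y = (Q, v)" and c: "P \<in> carrier (sym_group d n)"
          "Q \<in> carrier (sym_group d n)" "u \<in> carrier_vec n" "v \<in> carrier_vec n" by auto
        have "u = v" using \<theta>_prj[of P n u] \<theta>_prj[of Q n v] c eq xy by simp
        moreover from this have "inc X n (P - qc c n v) = inc X n (Q - qc c n v)"
          using eq c by (simp add: xy \<theta>_def)
        hence "P - qc c n v = Q - qc c n v" using inc_inj_on[of n] c by (simp add: inj_on_def)
        ultimately show "x = y" by (simp add: xy)
      qed
      show "\<theta> n ` carrier (obj ?F n) = carrier (obj E n)"
      proof
        show "\<theta> n ` carrier (obj ?F n) \<subseteq> carrier (obj E n)" using \<theta>_hom[of n] by (auto simp: hom_def)
        show "carrier (obj E n) \<subseteq> \<theta> n ` carrier (obj ?F n)"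
        proof
          fix x assume x: "x \<in> carrier (obj E n)"
          let ?v = "prj X n x"
          have "prj X n x = prj X n (push e n ?v)" using x by (simp add: prj_push[OF e1 pe])
          then obtain P where P: "P \<in> carrier (sym_group d n)" "x = push e n ?v \<otimes>\<^bsub>obj E n\<^esub> inc X n P"
            using prj_eqE[OF x push_closed[OF e1]] by metis
          have "P + qc c n ?v \<in> carrier (sym_group d n)"
            using P by (intro sym_group_add sym_group_of_int_mult frob_quot_carrier)
          moreover have "x = \<theta> n (P + qc c n ?v, ?v)" using P by (simp add: \<theta>_def)
          ultimately show "x \<in> \<theta> n ` carrier (obj ?F n)" using x by (intro image_eqI) auto
        qed
      qed
    qed
    show "\<theta> n (inc (sum_ext incl_functor ?F) n a) = inc X n a" if "a \<in> carrier (obj (sym_functor d) n)" for a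
      using that by (simp add: sum_ext_def \<theta>_def frob_quot_zero push0)
    show "prj X n (\<theta> n x) = prj (sum_ext incl_functor ?F) n x"
      if "x \<in> carrier (obj (middle (sum_ext incl_functor ?F)) n)" for x
      using that \<theta>_prj by (auto simp: sum_ext_def)
  qed
qed

lemma ex_ext_equiv_twisted:
  "\<exists>c. ext_equiv incl_functor (sym_functor d) (sum_ext incl_functor (twisted_functor p d c)) X"
  using ex_cross_lift cross_lift_ext_equiv by blast

end

section \<open>Equivalence of extensions\<close>

lemma ext_equiv_trans:
  assumes "ext_equiv C A X Y" "ext_equiv C A Y Z"
  shows "ext_equiv C A X Z"
proof -
  from assms(1) obtain \<theta> where t: "nat_trans (middle X) (middle Y) \<theta>"
    and it: "\<And>n. \<theta> n \<in> iso (obj (middle X) n) (obj (middle Y) n)"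
    and at: "\<And>n a. a \<in> carrier (obj A n) \<Longrightarrow> \<theta> n (inc X n a) = inc Y n a"
    and pt: "\<And>n e. e \<in> carrier (obj (middle X) n) \<Longrightarrow> prj Y n (\<theta> n e) = prj X n e"
    by (auto simp: ext_equiv_def)
  from assms(2) obtain \<psi> where s: "nat_trans (middle Y) (middle Z) \<psi>"
    and iso2: "\<And>n. \<psi> n \<in> iso (obj (middle Y) n) (obj (middle Z) n)"
    and at2: "\<And>n a. a \<in> carrier (obj A n) \<Longrightarrow> \<psi> n (inc Y n a) = inc Z n a"
    and ps: "\<And>n e. e \<in> carrier (obj (middle Y) n) \<Longrightarrow> prj Z n (\<psi> n e) = prj Y n e"
    by (auto simp: ext_equiv_def)
  have cl: "\<theta> n x \<in> carrier (obj (middle Y) n)" if "x \<in> carrier (obj (middle X) n)" for n x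
    using it[of n] that by (auto simp: iso_def hom_def)
  have hom: "\<psi> n \<circ> \<theta> n \<in> hom (obj (middle X) n) (obj (middle Z) n)" for n
    using it[of n] iso2[of n] by (intro hom_compose) (auto simp: iso_def)
  show ?thesis
    unfolding ext_equiv_def
  proof (intro exI[of _ "\<lambda>n. \<psi> n \<circ> \<theta> n"] conjI allI ballI)
    show "nat_trans (middle X) (middle Z) (\<lambda>n. \<psi> n \<circ> \<theta> n)"
      using t s hom cl by (auto simp: nat_trans_def)
    show "\<psi> n \<circ> \<theta> n \<in> iso (obj (middle X) n) (obj (middle Z) n)" for n
      using hom it[of n] iso2[of n] by (auto simp: iso_def intro: bij_betw_trans)
  qed (simp_all add: at at2 pt ps cl)
qed

text \<open>Only the closure properties of X are needed, so that this applies to a Baer sum without knowing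
  that it is an extension.\<close>

lemma ext_equiv_sym:
  assumes eq: "ext_equiv C A X Y"
    and grp: "\<And>n. group (obj (middle X) n)"
    and arr: "\<And>M s t x. M \<in> carrier_mat t s \<Longrightarrow> x \<in> carrier (obj (middle X) s) \<Longrightarrow>
        arr (middle X) M x \<in> carrier (obj (middle X) t)"
    and inc: "\<And>n a. a \<in> carrier (obj A n) \<Longrightarrow> inc X n a \<in> carrier (obj (middle X) n)"
  shows "ext_equiv C A Y X"
proof -
  from eq obtain \<theta> where t: "nat_trans (middle X) (middle Y) \<theta>"
    and it: "\<And>n. \<theta> n \<in> iso (obj (middle X) n) (obj (middle Y) n)"
    and at: "\<And>n a. a \<in> carrier (obj A n) \<Longrightarrow> \<theta> n (inc X n a) = inc Y n a"
    and pt: "\<And>n e. e \<in> carrier (obj (middle X) n) \<Longrightarrow> prj Y n (\<theta> n e) = prj X n e"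
    by (auto simp: ext_equiv_def)
  define \<psi> where "\<psi> n = inv_into (carrier (obj (middle X) n)) (\<theta> n)" for n
  have inj: "inj_on (\<theta> n) (carrier (obj (middle X) n))"
    and im: "\<theta> n ` carrier (obj (middle X) n) = carrier (obj (middle Y) n)" for n
    using it[of n] by (auto simp: iso_def bij_betw_def)
  have \<psi>\<theta>: "\<psi> n (\<theta> n x) = x" if "x \<in> carrier (obj (middle X) n)" for n x
    using inj that by (simp add: \<psi>_def)
  have iso: "\<psi> n \<in> iso (obj (middle Y) n) (obj (middle X) n)" for n
    unfolding \<psi>_def by (rule group.iso_set_sym[OF grp it])
  have ex: "\<exists>x \<in> carrier (obj (middle X) n). y = \<theta> n x" if "y \<in> carrier (obj (middle Y) n)" for n y
    using im[of n] that by auto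
  show ?thesis
    unfolding ext_equiv_def
  proof (intro exI[of _ \<psi>] conjI allI ballI iso)
    show "nat_trans (middle Y) (middle X) \<psi>"
      unfolding nat_trans_def
    proof (intro conjI allI ballI)
      show "\<psi> n \<in> hom (obj (middle Y) n) (obj (middle X) n)" for n
        using iso by (simp add: iso_def)
      fix s t y and M :: "int mat" assume M: "M \<in> carrier_mat t s" and "y \<in> carrier (obj (middle Y) s)"
      then obtain x where x: "x \<in> carrier (obj (middle X) s)" and y: "y = \<theta> s x" using ex by blast
      have "\<theta> t (arr (middle X) M x) = arr (middle Y) M y"
        using t M x y unfolding nat_trans_def by blast
      thus "\<psi> t (arr (middle Y) M y) = arr (middle X) M (\<psi> s y)"
        using \<psi>\<theta>[OF x] \<psi>\<theta>[OF arr[OF M x]] y by simp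
    qed
    show "\<psi> n (inc Y n a) = inc X n a" if "a \<in> carrier (obj A n)" for n a
      using at[OF that] \<psi>\<theta>[OF inc[OF that]] by simp
    show "prj X n (\<psi> n y) = prj Y n y" if "y \<in> carrier (obj (middle Y) n)" for n y
      using ex[OF that] \<psi>\<theta> pt by auto
  qed
qed

lemma extension_ext_equiv_sym:
  assumes "is_extension C A X" "ext_equiv C A X Y"
  shows "ext_equiv C A Y X"
  using assms(2)
proof (rule ext_equiv_sym)
  have F: "is_ab_functor (middle X)" using assms(1) by (simp add: is_extension_def)
  show "group (obj (middle X) n)" for n using functor_comm_group[OF F] by (simp add: comm_group_def)
  show "arr (middle X) M x \<in> carrier (obj (middle X) t)"
    if "M \<in> carrier_mat t s" "x \<in> carrier (obj (middle X) s)" for M s t x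
    using functor_closed[OF F that] .
  show "inc X n a \<in> carrier (obj (middle X) n)" if "a \<in> carrier (obj A n)" for n a
    using assms(1) that unfolding is_extension_def mon_def hom_def by blast
qed

context prime_power
begin

abbreviation twisted_ext :: "int \<Rightarrow> (ipoly, ipoly \<times> int vec, int vec) fun_ext" where
  "twisted_ext c \<equiv> sum_ext incl_functor (twisted_functor p d c)"

abbreviation ext_eq (infix "\<sim>\<^sub>e" 50) where
  "X \<sim>\<^sub>e Y \<equiv> ext_equiv incl_functor (sym_functor d) X Y"

text \<open>Shearing by a \<sigma> changes the arrows by the coboundary of a \<sigma>, which is a p
  times the twist.\<close>

lemma twisted_ext_equivI:
  assumes "c - c' = int p * a"
  shows "twisted_ext c \<sim>\<^sub>e twisted_ext c'"
proof -
  let ?F = "twisted_functor p d c" and ?G = "twisted_functor p d c'"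
  define \<theta> where "\<theta> n = (\<lambda>(P :: ipoly, v :: int vec). (P + of_int a * diag_pow d n v, v))" for n
  have s: "of_int a * diag_pow d n v \<in> carrier (sym_group d n)" for n v
    by (intro sym_group_of_int_mult diag_pow_carrier)
  have hom: "\<theta> n \<in> hom (obj ?F n) (obj ?G n)" for n
    by (rule homI) (auto simp: \<theta>_def diag_pow_add sym_group_add s algebra_simps)
  have bij: "bij_betw (\<theta> n) (carrier (obj ?F n)) (carrier (obj ?G n))" for n
    by (rule bij_betwI[where g = "\<lambda>(P, v). (P - of_int a * diag_pow d n v, v)"])
       (auto simp: \<theta>_def sym_group_add sym_group_diff s)
  show ?thesis
    unfolding ext_equiv_def
  proof (intro exI[of _ \<theta>] conjI allI ballI)
    show "nat_trans (middle (twisted_ext c)) (middle (twisted_ext c')) \<theta>"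
      unfolding nat_trans_def sum_ext_def fun_ext.simps
    proof (intro conjI allI ballI)
      show "\<theta> n \<in> hom (obj ?F n) (obj ?G n)" for n by (rule hom)
      fix t k x and M :: "int mat" assume M: "M \<in> carrier_mat t k" and "x \<in> carrier (obj ?F k)"
      then obtain P v where x: "x = (P, v)" and P: "P \<in> carrier (sym_group d k)" and v: "v \<in> carrier_vec k" by auto
      have "of_int c * twist p d M v = of_int c' * twist p d M v + of_int a * (of_int (int p) * twist p d M v)"
      proof -
        have "c = c' + a * int p" using assms by (simp add: algebra_simps)
        hence "(of_int c :: ipoly) = of_int c' + of_int a * of_int (int p)" by (metis of_int_add of_int_mult)
        thus ?thesis by (simp only: distrib_right mult.assoc)
      qed
      thus "\<theta> t (arr ?F M x) = arr ?G M (\<theta> k x)"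
        unfolding x \<theta>_def p_twist[OF M v] using P s[of k v]
        by (simp add: arr_twisted_functor[OF M P v] arr_twisted_functor[OF M _ v] sym_group_add subst_mat_add
            subst_mat_mult subst_mat_of_int algebra_simps)
    qed
    fix n
    show "\<theta> n \<in> iso (obj (middle (twisted_ext c)) n) (obj (middle (twisted_ext c')) n)"
      using hom bij by (simp add: iso_def sum_ext_def)
    show "\<theta> n (inc (twisted_ext c) n b) = inc (twisted_ext c') n b" if "b \<in> carrier (obj (sym_functor d) n)" for b
      by (simp add: \<theta>_def sum_ext_def diag_pow_def)
    show "prj (twisted_ext c') n (\<theta> n x) = prj (twisted_ext c) n x" if "x \<in> carrier (obj (middle (twisted_ext c)) n)" for x
      by (simp add: \<theta>_def sum_ext_def split: prod.split)
  qed
qed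

text \<open>An equivalence sends (0, e) to (a x_0^d, e) for some integer a. Additivity at e_0 + e_1
  makes c - c' and a p the same multiple of the cross term, a nonzero polynomial.\<close>

lemma twisted_ext_equivD:
  assumes "twisted_ext c \<sim>\<^sub>e twisted_ext c'"
  shows "int p dvd c - c'"
proof -
  let ?F = "twisted_functor p d c" and ?G = "twisted_functor p d c'"
  let ?u = "unit_vec 2 0 :: int vec" and ?v = "unit_vec 2 1 :: int vec" and ?e = "unit_vec 1 0 :: int vec"
  from assms obtain \<theta> where t: "nat_trans ?F ?G \<theta>"
    and i: "\<forall>n. \<forall>P\<in>carrier (sym_group d n). \<theta> n (P, 0\<^sub>v n) = (P, 0\<^sub>v n)"
    and pr: "\<forall>n. \<forall>x\<in>carrier (obj ?F n). snd (\<theta> n x) = snd x"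
    by (auto simp: ext_equiv_def sum_ext_def simp del: twisted_functor_simps)
  have hom: "\<theta> n \<in> hom (obj ?F n) (obj ?G n)" for n using t by (simp only: nat_trans_def)
  have nat: "\<theta> t (arr ?F M x) = arr ?G M (\<theta> s x)" if "M \<in> carrier_mat t s" "x \<in> carrier (obj ?F s)" for s t M x
    using t that unfolding nat_trans_def by blast
  have inc: "\<theta> n (P, 0\<^sub>v n) = (P, 0\<^sub>v n)" if "P \<in> carrier (sym_group d n)" for n P using i that by blast
  have prj: "snd (\<theta> n x) = snd x" if "x \<in> carrier (obj ?F n)" for n x using pr that by blast
  define \<alpha> where "\<alpha> = fst (\<theta> 1 (0, ?e))"
  have e: "(0, ?e) \<in> carrier (obj ?F 1)" by (simp add: sym_group_zero)
  have \<theta>e: "\<theta> 1 (0, ?e) = (\<alpha>, ?e)" using prj[OF e] by (simp add: \<alpha>_def prod_eq_iff)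
  have "\<theta> 1 (0, ?e) \<in> carrier (obj ?G 1)" using hom[of 1] e unfolding hom_def by blast
  hence \<alpha>: "\<alpha> \<in> carrier (sym_group d 1)" using \<theta>e by simp
  then obtain a where a: "\<alpha> = of_int a * gen 0 ^ d" by (rule sym_group_rank_one)
  \<comment> \<open>The argument of \<theta> is the image of (0, e) under the one-column matrix w,
    so naturality determines its value.\<close>
  have lift: "\<theta> 2 (of_int c * frob_quot p d 2 w, w) = (of_int a * lin_form 2 w ^ d + of_int c' * frob_quot p d 2 w, w)"
    if w: "w \<in> carrier_vec 2" for w
  proof -
    let ?M = "mat_of_cols 2 [w]"
    have M: "?M \<in> carrier_mat 2 1" by (simp add: mat_of_cols_def)
    note Me = mat_of_cols_single_mult_vec[OF w]
    have tw: "twist p d ?M ?e = frob_quot p d 2 w"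
      using twist_frob_quot[OF M, of ?e] Me by (simp add: frob_quot_unit subst_mat_0)
    have "subst_mat ?M \<alpha> = of_int a * lin_form 2 w ^ d"
      using w by (simp add: a subst_mat_mult subst_mat_of_int subst_mat_power subst_mat_gen_col)
    thus ?thesis
      using nat[OF M e] unfolding \<theta>e
      by (simp add: arr_twisted_functor[OF M sym_group_zero] arr_twisted_functor[OF M \<alpha>] tw Me subst_mat_0
          del: One_nat_def)
  qed
  have B: "of_int c * cross_quot \<in> carrier (sym_group d 2)"
    by (intro sym_group_of_int_mult frob_quot_carrier)
  have add: "\<theta> 2 (P + Q, x + y) = \<theta> 2 (P, x) \<otimes>\<^bsub>obj ?G 2\<^esub> \<theta> 2 (Q, y)"
    if "P \<in> carrier (sym_group d 2)" "Q \<in> carrier (sym_group d 2)" "x \<in> carrier_vec 2" "y \<in> carrier_vec 2" for P Q x y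
    using hom_mult[OF hom, of "(P, x)" 2 "(Q, y)"] that by simp
  \<comment> \<open>The same element is split into a part from the inclusion and the two basis
    lifts, at which \<open>frob_quot\<close> vanishes.\<close>
  have "\<theta> 2 (of_int c * cross_quot, ?u + ?v) = (of_int c * cross_quot, 0\<^sub>v 2) \<otimes>\<^bsub>obj ?G 2\<^esub>
      ((of_int a * gen 0 ^ d, ?u) \<otimes>\<^bsub>obj ?G 2\<^esub> (of_int a * gen 1 ^ d, ?v))"
    using add[OF B sym_group_zero, of "0\<^sub>v 2" "?u + ?v"] add[of 0 0 ?u ?v] inc[OF B] lift[of ?u] lift[of ?v]
    by (simp add: sym_group_zero frob_quot_unit lin_unit)
  hence "of_int c * cross_quot + (of_int a * gen 0 ^ d + of_int a * gen 1 ^ d) =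
      of_int a * (gen 0 + gen 1) ^ d + of_int c' * cross_quot"
    using lift[of "?u + ?v"] by (simp add: lin_form_add lin_unit)
  hence "of_int c * cross_quot - of_int c' * cross_quot = of_int a * (of_int (int p) * cross_quot)"
    unfolding p_cross_quot by (simp add: algebra_simps)
  hence "of_int (c - c' - a * int p) * cross_quot = 0" by (simp add: algebra_simps)
  hence "c - c' - a * int p = 0"
    using cross_quot_nonzero by (simp only: mult_eq_0_iff of_int_eq_0_iff simp_thms)
  hence "c - c' = a * int p" by simp
  thus ?thesis by simp
qed

lemma twisted_ext_equiv_iff: "twisted_ext c \<sim>\<^sub>e twisted_ext c' \<longleftrightarrow> int p dvd c - c'"
  using twisted_ext_equivI twisted_ext_equivD by (auto elim!: dvdE)

end

section \<open>Baer sums of twisted extensions\<close>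

context group_hom
begin

text \<open>Homomorphisms are constant on cosets of their kernel; this evaluates the occurrences of
  \<open>the_elem\<close> for maps out of a Baer sum.\<close>

lemma image_kernel_coset:
  assumes "x \<in> carrier G"
  shows "h ` (kernel G H h #> x) = {h x}"
proof -
  have "h ` (kernel G H h #> x) = (\<Union>k\<in>kernel G H h. {h (k \<otimes> x)})" by (auto simp: r_coset_def)
  also have "\<dots> = (\<Union>k\<in>kernel G H h. {h x})" by (rule SUP_cong) (use assms in \<open>auto simp: kernel_def\<close>)
  also have "\<dots> = {h x}" using G.one_closed hom_one by (auto simp: kernel_def)
  finally show ?thesis .
qed

lemma kernel_coset_eqI:
  assumes "x \<in> carrier G" "y \<in> carrier G" "h x = h y"
  shows "kernel G H h #> x = kernel G H h #> y"
proof (rule G.repr_independence)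
  have "y = (y \<otimes> inv x) \<otimes> x" using assms by (simp add: G.m_assoc)
  moreover have "y \<otimes> inv x \<in> kernel G H h" using assms by (simp add: kernel_def)
  ultimately show "y \<in> kernel G H h #> x" unfolding r_coset_def by blast
qed (use assms subgroup_kernel in auto)

end

context sym_extension
begin

lemma prj_inv:
  assumes "x \<in> carrier (obj E n)"
  shows "prj X n (inv\<^bsub>obj E n\<^esub> x) = - prj X n x"
proof -
  interpret I: comm_group "obj incl_functor n" by (rule comm_group_incl_functor)
  interpret h: group_hom "obj E n" "obj incl_functor n" "prj X n"
    by unfold_locales (rule prj_hom)
  have "- prj X n x = inv\<^bsub>obj incl_functor n\<^esub> (prj X n x)"
    using prj_closed[OF assms] by (intro I.inv_equality[symmetric]) auto
  thus ?thesis using h.hom_inv[OF assms] by simp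
qed

text \<open>The \<open>S^d\<close> component of the equivalence: an additive retraction of the
  inclusion, natural only up to c times the twist. In this form two equivalences can be
  added.\<close>

lemma twisted_splitting:
  assumes "X \<sim>\<^sub>e twisted_ext c"
  obtains \<phi> where
    "\<And>n x. x \<in> carrier (obj E n) \<Longrightarrow> \<phi> n x \<in> carrier (sym_group d n)"
    "\<And>n x y. x \<in> carrier (obj E n) \<Longrightarrow> y \<in> carrier (obj E n) \<Longrightarrow>
      \<phi> n (x \<otimes>\<^bsub>obj E n\<^esub> y) = \<phi> n x + \<phi> n y"
    "\<And>s t M x. M \<in> carrier_mat t s \<Longrightarrow> x \<in> carrier (obj E s) \<Longrightarrow>
      \<phi> t (arr E M x) = subst_mat M (\<phi> s x) + of_int c * twist p d M (prj X s x)"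
    "\<And>n P. P \<in> carrier (sym_group d n) \<Longrightarrow> \<phi> n (inc X n P) = P"
    "\<And>n P v. P \<in> carrier (sym_group d n) \<Longrightarrow> v \<in> carrier_vec n \<Longrightarrow>
      \<exists>x\<in>carrier (obj E n). \<phi> n x = P \<and> prj X n x = v"
proof -
  let ?T = "twisted_functor p d c"
  from assms obtain \<theta> where t: "nat_trans E ?T \<theta>"
    and iso: "\<forall>n. \<theta> n \<in> iso (obj E n) (obj ?T n)"
    and i: "\<forall>n. \<forall>P\<in>carrier (sym_group d n). \<theta> n (inc X n P) = (P, 0\<^sub>v n)"
    and pr: "\<forall>n. \<forall>x\<in>carrier (obj E n). snd (\<theta> n x) = prj X n x"
    by (auto simp: ext_equiv_def sum_ext_def simp del: twisted_functor_simps)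
  have bij: "bij_betw (\<theta> n) (carrier (obj E n)) (carrier (sym_group d n) \<times> carrier_vec n)" for n
    using iso by (simp add: iso_def)
  have pair: "\<theta> n x = (fst (\<theta> n x), prj X n x)" if "x \<in> carrier (obj E n)" for n x
    using pr that by (metis prod.collapse)
  have cl: "fst (\<theta> n x) \<in> carrier (sym_group d n)" if "x \<in> carrier (obj E n)" for n x
    using bij_betwE[OF bij] that by (metis mem_Times_iff)
  show ?thesis
  proof (rule that[of "\<lambda>n x. fst (\<theta> n x)"])
    show "fst (\<theta> n x) \<in> carrier (sym_group d n)" if "x \<in> carrier (obj E n)" for n x
      using cl that .
    show "fst (\<theta> n (x \<otimes>\<^bsub>obj E n\<^esub> y)) = fst (\<theta> n x) + fst (\<theta> n y)"
      if xy: "x \<in> carrier (obj E n)" "y \<in> carrier (obj E n)" for n x y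
    proof -
      have "\<theta> n (x \<otimes>\<^bsub>obj E n\<^esub> y) = \<theta> n x \<otimes>\<^bsub>obj ?T n\<^esub> \<theta> n y"
        using t xy unfolding nat_trans_def hom_def by blast
      also have "\<dots> = (fst (\<theta> n x) + fst (\<theta> n y), prj X n x + prj X n y)"
        by (subst pair[OF xy(1)], subst pair[OF xy(2)]) simp
      finally show ?thesis by simp
    qed
    show "fst (\<theta> t (arr E M x)) = subst_mat M (fst (\<theta> s x)) + of_int c * twist p d M (prj X s x)"
      if M: "M \<in> carrier_mat t s" and x: "x \<in> carrier (obj E s)" for s t x and M :: "int mat"
    proof -
      have "\<theta> t (arr E M x) = arr ?T M (\<theta> s x)"
        using \<open>nat_trans E ?T \<theta>\<close> M x unfolding nat_trans_def by blast
      also have "\<theta> s x = (fst (\<theta> s x), prj X s x)" by (rule pair[OF x])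
      also have "arr ?T M \<dots> = (subst_mat M (fst (\<theta> s x)) + of_int c * twist p d M (prj X s x), M *\<^sub>v prj X s x)"
        by (rule arr_twisted_functor[OF M cl[OF x] prj_closed[OF x]])
      finally show ?thesis by simp
    qed
    show "fst (\<theta> n (inc X n P)) = P" if "P \<in> carrier (sym_group d n)" for n P using i that by simp
    show "\<exists>x\<in>carrier (obj E n). fst (\<theta> n x) = P \<and> prj X n x = v"
      if Pv: "P \<in> carrier (sym_group d n)" "v \<in> carrier_vec n" for n P and v :: "int vec"
    proof -
      have "(P, v) \<in> \<theta> n ` carrier (obj E n)" using bij[of n] Pv by (simp add: bij_betw_def)
      then obtain x where "x \<in> carrier (obj E n)" "\<theta> n x = (P, v)" by force
      thus ?thesis using pr by force
    qed
  qed
qed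

end

context prime_power
begin

text \<open>First isomorphism theorem for the sum of the two retractions on the pullback. Both
  naturality errors are taken at the same vector, so they add up to c + c' times the twist, and the
  kernel is the skew diagonal.\<close>

lemma baer_sum_twisted:
  fixes X :: "(ipoly, 'b, int vec) fun_ext" and Y :: "(ipoly, 'c, int vec) fun_ext"
  assumes X: "is_extension incl_functor (sym_functor d) X" and Y: "is_extension incl_functor (sym_functor d) Y"
    and Xc: "X \<sim>\<^sub>e twisted_ext c" and Yc: "Y \<sim>\<^sub>e twisted_ext c'"
  shows "baer_sum (sym_functor d) X Y \<sim>\<^sub>e twisted_ext (c + c')"
    and "twisted_ext (c + c') \<sim>\<^sub>e baer_sum (sym_functor d) X Y"
proof -
  interpret X: sym_extension p l d X by unfold_locales (rule X)
  interpret Y: sym_extension p l d Y by unfold_locales (rule Y)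
  let ?T = "\<lambda>c. twisted_functor p d c" and ?B = "baer_sum (sym_functor d) X Y"
  let ?P = "pullback_fun X Y" and ?K = "skew_diagonal (sym_functor d) X Y"
  obtain \<phi> where
    p1: "\<And>n x. x \<in> carrier (obj (middle X) n) \<Longrightarrow> \<phi> n x \<in> carrier (sym_group d n)" and
    p2: "\<And>n x y. x \<in> carrier (obj (middle X) n) \<Longrightarrow> y \<in> carrier (obj (middle X) n) \<Longrightarrow>
      \<phi> n (x \<otimes>\<^bsub>obj (middle X) n\<^esub> y) = \<phi> n x + \<phi> n y" and
    p3: "\<And>s t M x. M \<in> carrier_mat t s \<Longrightarrow> x \<in> carrier (obj (middle X) s) \<Longrightarrow>
      \<phi> t (arr (middle X) M x) = subst_mat M (\<phi> s x) + of_int c * twist p d M (prj X s x)" and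
    p4: "\<And>n P. P \<in> carrier (sym_group d n) \<Longrightarrow> \<phi> n (inc X n P) = P" and
    p5: "\<And>n P v. P \<in> carrier (sym_group d n) \<Longrightarrow> v \<in> carrier_vec n \<Longrightarrow>
      \<exists>x\<in>carrier (obj (middle X) n). \<phi> n x = P \<and> prj X n x = v"
    by (rule X.twisted_splitting[OF Xc], rule that)
  obtain \<psi> where
    q1: "\<And>n x. x \<in> carrier (obj (middle Y) n) \<Longrightarrow> \<psi> n x \<in> carrier (sym_group d n)" and
    q2: "\<And>n x y. x \<in> carrier (obj (middle Y) n) \<Longrightarrow> y \<in> carrier (obj (middle Y) n) \<Longrightarrow>
      \<psi> n (x \<otimes>\<^bsub>obj (middle Y) n\<^esub> y) = \<psi> n x + \<psi> n y" and
    q3: "\<And>s t M x. M \<in> carrier_mat t s \<Longrightarrow> x \<in> carrier (obj (middle Y) s) \<Longrightarrow>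
      \<psi> t (arr (middle Y) M x) = subst_mat M (\<psi> s x) + of_int c' * twist p d M (prj Y s x)" and
    q4: "\<And>n P. P \<in> carrier (sym_group d n) \<Longrightarrow> \<psi> n (inc Y n P) = P" and
    q5: "\<And>n P v. P \<in> carrier (sym_group d n) \<Longrightarrow> v \<in> carrier_vec n \<Longrightarrow>
      \<exists>x\<in>carrier (obj (middle Y) n). \<psi> n x = P \<and> prj Y n x = v"
    by (rule Y.twisted_splitting[OF Yc], rule that)
  define \<chi> where "\<chi> n = (\<lambda>(x, y). (\<phi> n x + \<psi> n y, prj X n x))" for n
  have Pcar: "(x, y) \<in> carrier (?P n) \<longleftrightarrow>
      x \<in> carrier (obj (middle X) n) \<and> y \<in> carrier (obj (middle Y) n) \<and> prj X n x = prj Y n y" for n x y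
    by (simp add: pullback_fun_def)
  have Pmult: "(x, y) \<otimes>\<^bsub>?P n\<^esub> (x', y') = (x \<otimes>\<^bsub>obj (middle X) n\<^esub> x', y \<otimes>\<^bsub>obj (middle Y) n\<^esub> y')" for n x y x' y'
    by (simp add: pullback_fun_def)
  have Pgrp: "group (?P n)" for n
  proof -
    have "subgroup (carrier (?P n)) (obj (middle X) n \<times>\<times> obj (middle Y) n)"
    proof (rule group.subgroupI)
      show G: "group (obj (middle X) n \<times>\<times> obj (middle Y) n)"
        by (intro DirProd_group X.E.is_group Y.E.is_group)
      show "carrier (?P n) \<subseteq> carrier (obj (middle X) n \<times>\<times> obj (middle Y) n)" using Pcar by auto
      have "(inc X n 0, inc Y n 0) \<in> carrier (?P n)"
        by (simp add: Pcar sym_group_zero X.prj_inc Y.prj_inc)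
      thus "carrier (?P n) \<noteq> {}" by blast
      fix a assume a: "a \<in> carrier (?P n)"
      thus "inv\<^bsub>obj (middle X) n \<times>\<times> obj (middle Y) n\<^esub> a \<in> carrier (?P n)"
        by (cases a) (simp add: Pcar inv_DirProd[OF X.E.is_group Y.E.is_group] X.prj_inv Y.prj_inv)
      fix b assume "b \<in> carrier (?P n)"
      thus "a \<otimes>\<^bsub>obj (middle X) n \<times>\<times> obj (middle Y) n\<^esub> b \<in> carrier (?P n)"
        using a by (cases a, cases b) (simp add: Pcar X.prj_mult Y.prj_mult)
    qed
    thus ?thesis using DirProd_group[OF X.E.is_group Y.E.is_group]
      by (auto simp: pullback_fun_def dest: subgroup.subgroup_is_group)
  qed
  have Tgrp: "group (obj (?T (c + c')) n)" for n
    using functor_comm_group[OF twisted_functor_functor, of "c + c'" n] by (simp only: comm_group_def)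
  have \<chi>hom: "\<chi> n \<in> hom (?P n) (obj (?T (c + c')) n)" for n
    by (rule homI)
       (auto simp: \<chi>_def Pcar Pmult p1 q1 p2 q2 X.prj_mult sym_group_add algebra_simps)
  have H: "group_hom (?P n) (obj (?T (c + c')) n) (\<chi> n)" for n
    using Pgrp Tgrp \<chi>hom by (simp add: group_hom_def group_hom_axioms_def)
  have surj: "\<chi> n ` carrier (?P n) = carrier (obj (?T (c + c')) n)" for n
  proof
    show "\<chi> n ` carrier (?P n) \<subseteq> carrier (obj (?T (c + c')) n)" using \<chi>hom[of n] unfolding hom_def by blast
    show "carrier (obj (?T (c + c')) n) \<subseteq> \<chi> n ` carrier (?P n)"
    proof
      fix z assume "z \<in> carrier (obj (?T (c + c')) n)"
      then obtain Q v where z: "z = (Q, v)" "Q \<in> carrier (sym_group d n)" "v \<in> carrier_vec n" by auto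
      obtain x where x: "x \<in> carrier (obj (middle X) n)" "\<phi> n x = Q" "prj X n x = v" using p5[OF z(2,3)] by blast
      \<comment> \<open>The component Q is already reached through x, so y only has to lie over v
        with component 0.\<close>
      obtain y where y: "y \<in> carrier (obj (middle Y) n)" "\<psi> n y = 0" "prj Y n y = v"
        using q5[OF sym_group_zero z(3)] by blast
      show "z \<in> \<chi> n ` carrier (?P n)"
        using x y z by (intro image_eqI[of _ _ "(x, y)"]) (auto simp: \<chi>_def Pcar)
    qed
  qed
  have inc_inv: "inv\<^bsub>obj (middle Y) n\<^esub> (inc Y n P) = inc Y n (- P)" if "P \<in> carrier (sym_group d n)" for n P
    using Y.inc_add[of "- P" n P] that
    by (intro Y.E.inv_equality) (simp_all add: sym_group_uminus Y.inc_zero)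
  have ker: "kernel (?P n) (obj (?T (c + c')) n) (\<chi> n) = ?K n" for n
  proof
    show "?K n \<subseteq> kernel (?P n) (obj (?T (c + c')) n) (\<chi> n)"
      by (auto simp: skew_diagonal_def kernel_def inc_inv Pcar \<chi>_def X.prj_inc Y.prj_inc p4 q4 sym_group_uminus)
    show "kernel (?P n) (obj (?T (c + c')) n) (\<chi> n) \<subseteq> ?K n"
    proof
      fix z assume "z \<in> kernel (?P n) (obj (?T (c + c')) n) (\<chi> n)"
      then obtain x y where z: "z = (x, y)" and c: "x \<in> carrier (obj (middle X) n)" "y \<in> carrier (obj (middle Y) n)"
        and x0: "prj X n x = 0\<^sub>v n" and y0: "prj Y n y = 0\<^sub>v n" and sum: "\<phi> n x + \<psi> n y = 0"
        by (cases z) (auto simp: kernel_def \<chi>_def Pcar)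
      from c x0 have "x \<in> inc X n ` carrier (sym_group d n)" by (simp add: X.exact kernel_def)
      then obtain P where P: "P \<in> carrier (sym_group d n)" "x = inc X n P" by blast
      from c y0 have "y \<in> inc Y n ` carrier (sym_group d n)" by (simp add: Y.exact kernel_def)
      then obtain Q where Q: "Q \<in> carrier (sym_group d n)" "y = inc Y n Q" by blast
      have "Q = - P" using sum P Q by (simp add: p4 q4 eq_neg_iff_add_eq_0 add.commute)
      thus "z \<in> ?K n" using P Q by (auto simp: z skew_diagonal_def inc_inv)
    qed
  qed
  note coset_image = group_hom.image_kernel_coset[OF H, unfolded ker]
  note coset_eqI = group_hom.kernel_coset_eqI[OF H, unfolded ker]
  have normal: "?K n \<lhd> ?P n" for n using group_hom.normal_kernel[OF H, of n] by (simp only: ker)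
  have Bcar: "K \<in> carrier (obj (middle ?B) n) \<longleftrightarrow> (\<exists>z\<in>carrier (?P n). K = ?K n #>\<^bsub>?P n\<^esub> z)" for K n
    by (auto simp: baer_sum_def FactGroup_def RCOSETS_def)
  define push where "push M = (\<lambda>(x, y). (arr (middle X) M x, arr (middle Y) M y))" for M
  have pushP: "push M z \<in> carrier (?P t)" if "M \<in> carrier_mat t s" "z \<in> carrier (?P s)" for M s t z
    using that by (cases z) (auto simp: push_def Pcar X.prj_natural Y.prj_natural)
  have \<chi>push: "\<chi> t (push M z) = arr (?T (c + c')) M (\<chi> s z)" if M: "M \<in> carrier_mat t s" and z: "z \<in> carrier (?P s)" for M s t z
  proof (cases z)
    case (Pair x y)
    hence xy: "x \<in> carrier (obj (middle X) s)" "y \<in> carrier (obj (middle Y) s)" "prj Y s y = prj X s x"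
      using z by (auto simp: Pcar)
    have s: "\<phi> s x + \<psi> s y \<in> carrier (sym_group d s)" using xy by (intro sym_group_add p1 q1)
    show ?thesis
      using xy arr_twisted_functor[OF M s X.prj_closed[OF xy(1)], of p "c + c'"]
      by (simp add: Pair push_def \<chi>_def p3[OF M] q3[OF M] X.prj_natural[OF M] subst_mat_add algebra_simps)
  qed
  have arrB: "arr (middle ?B) M (?K s #>\<^bsub>?P s\<^esub> z) = ?K t #>\<^bsub>?P t\<^esub> push M z"
    if M: "M \<in> carrier_mat t s" and z: "z \<in> carrier (?P s)" for M s t z
  proof -
    have K: "?K s #>\<^bsub>?P s\<^esub> z \<subseteq> carrier (?P s)"
      using normal[of s] z Pgrp by (intro monoid.r_coset_subset_G group.is_monoid) (auto simp: normal_def subgroup.subset)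
    \<comment> \<open>\<chi> takes one value on a coset and distinguishes cosets, so all
      representatives are pushed into the same coset and \<open>the_elem\<close> is
      meaningful.\<close>
    have "?K t #>\<^bsub>?P t\<^esub> push M w = ?K t #>\<^bsub>?P t\<^esub> push M z" if w: "w \<in> ?K s #>\<^bsub>?P s\<^esub> z" for w
    proof (rule coset_eqI[OF pushP[OF M] pushP[OF M z]])
      show wP: "w \<in> carrier (?P s)" using K w by blast
      have "\<chi> s w = \<chi> s z" using coset_image[OF z] w by blast
      thus "\<chi> t (push M w) = \<chi> t (push M z)" using \<chi>push[OF M wP] \<chi>push[OF M z] by simp
    qed
    moreover have "z \<in> ?K s #>\<^bsub>?P s\<^esub> z"
      using normal[of s] z Pgrp by (intro group.rcos_self) (auto simp: normal_def)
    ultimately have "(\<lambda>w. ?K t #>\<^bsub>?P t\<^esub> push M w) ` (?K s #>\<^bsub>?P s\<^esub> z) = {?K t #>\<^bsub>?P t\<^esub> push M z}"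
      by blast
    moreover have "?K s #>\<^bsub>?P s\<^esub> z \<in> carrier (?P s Mod ?K s)"
      using z Bcar[of "?K s #>\<^bsub>?P s\<^esub> z" s] by (auto simp: baer_sum_def)
    ultimately show ?thesis using M by (simp add: baer_sum_def push_def case_prod_beta')
  qed
  have incP: "(inc X n P, \<one>\<^bsub>obj (middle Y) n\<^esub>) \<in> carrier (?P n)" if "P \<in> carrier (sym_group d n)" for n P
    using that Y.prj_inc[OF sym_group_zero, of n] by (simp add: Pcar X.prj_inc Y.inc_zero)
  show *: "?B \<sim>\<^sub>e twisted_ext (c + c')"
    unfolding ext_equiv_def
  proof (intro exI[of _ "\<lambda>n K. the_elem (\<chi> n ` K)"] conjI allI ballI)
    show iso: "(\<lambda>K. the_elem (\<chi> n ` K)) \<in> iso (obj (middle ?B) n) (obj (middle (twisted_ext (c + c'))) n)" for n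
      using group_hom.FactGroup_iso_set[OF H surj, of n, unfolded ker] by (simp add: baer_sum_def sum_ext_def)
    show "nat_trans (middle ?B) (middle (twisted_ext (c + c'))) (\<lambda>n K. the_elem (\<chi> n ` K))"
      unfolding nat_trans_def
    proof (intro conjI allI ballI)
      show "(\<lambda>K. the_elem (\<chi> n ` K)) \<in> hom (obj (middle ?B) n) (obj (middle (twisted_ext (c + c'))) n)" for n
        using iso[of n] by (simp add: iso_def)
      fix s t K and M :: "int mat" assume M: "M \<in> carrier_mat t s" and "K \<in> carrier (obj (middle ?B) s)"
      then obtain z where z: "z \<in> carrier (?P s)" "K = ?K s #>\<^bsub>?P s\<^esub> z" using Bcar by blast
      show "the_elem (\<chi> t ` arr (middle ?B) M K) = arr (middle (twisted_ext (c + c'))) M (the_elem (\<chi> s ` K))"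
        using z by (simp add: arrB[OF M] coset_image pushP[OF M] \<chi>push[OF M] sum_ext_def)
    qed
    fix n
    show "the_elem (\<chi> n ` inc ?B n P) = inc (twisted_ext (c + c')) n P"
      if "P \<in> carrier (obj (sym_functor d) n)" for P
    proof -
      have P: "P \<in> carrier (sym_group d n)" using that by simp
      have "\<psi> n \<one>\<^bsub>obj (middle Y) n\<^esub> = 0" using q4[OF sym_group_zero, of n] by (simp add: Y.inc_zero)
      thus ?thesis using coset_image[OF incP[OF P]] P
        by (simp add: baer_sum_def sum_ext_def \<chi>_def p4 X.prj_inc)
    qed
    show "prj (twisted_ext (c + c')) n (the_elem (\<chi> n ` K)) = prj ?B n K"
      if K: "K \<in> carrier (obj (middle ?B) n)" for K
    proof -
      obtain z where z: "z \<in> carrier (?P n)" "K = ?K n #>\<^bsub>?P n\<^esub> z" using K unfolding Bcar by blast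
      have "(\<lambda>(x, y). prj X n x) ` K = snd ` \<chi> n ` K" by (auto simp: \<chi>_def image_image case_prod_beta')
      thus ?thesis using coset_image[OF z(1)] z(2) by (simp add: baer_sum_def sum_ext_def)
    qed
  qed
  show "twisted_ext (c + c') \<sim>\<^sub>e ?B"
  proof (rule ext_equiv_sym[OF *])
    show "group (obj (middle ?B) n)" for n
      using normal.factorgroup_is_group[OF normal, of n] by (simp add: baer_sum_def)
    show "arr (middle ?B) M K \<in> carrier (obj (middle ?B) t)"
      if M: "M \<in> carrier_mat t s" and K: "K \<in> carrier (obj (middle ?B) s)" for M s t K
      using K pushP[OF M] unfolding Bcar by (auto simp: arrB[OF M])
    show "inc ?B n P \<in> carrier (obj (middle ?B) n)" if "P \<in> carrier (obj (sym_functor d) n)" for n P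
      unfolding Bcar using that incP[of P n] by (auto simp: baer_sum_def)
  qed
qed

section \<open>The group of extensions is cyclic of order p\<close>

abbreviation "Ext \<equiv> Ext1 incl_functor (sym_functor d)"
abbreviation "cls c \<equiv> ext_class incl_functor (sym_functor d) (twisted_ext c)"

lemma cls_eq_iff: "cls c = cls c' \<longleftrightarrow> int p dvd c - c'"
proof
  assume eq: "cls c = cls c'"
  have "twisted_ext c' \<in> cls c'"
    using twisted_functor_extension twisted_ext_equiv_iff by (simp add: ext_class_def)
  hence "twisted_ext c' \<in> cls c" by (simp only: eq)
  thus "int p dvd c - c'" by (simp add: ext_class_def twisted_ext_equiv_iff)
next
  assume "int p dvd c - c'"
  hence "twisted_ext c \<sim>\<^sub>e twisted_ext c'" "twisted_ext c' \<sim>\<^sub>e twisted_ext c"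
    by (simp_all add: twisted_ext_equiv_iff dvd_diff_commute)
  thus "cls c = cls c'" unfolding ext_class_def by (auto intro: ext_equiv_trans)
qed

lemma ext_class_eq_cls:
  assumes "X \<sim>\<^sub>e twisted_ext c" "twisted_ext c \<sim>\<^sub>e X"
  shows "ext_class incl_functor (sym_functor d) X = cls c"
  using assms unfolding ext_class_def by (auto intro: ext_equiv_trans)

lemma carrier_Ext: "carrier Ext = range cls"
proof
  show "range cls \<subseteq> carrier Ext" using twisted_functor_extension by (auto simp: Ext1_def)
  show "carrier Ext \<subseteq> range cls"
  proof
    fix U assume "U \<in> carrier Ext"
    then obtain X :: "(ipoly, ipoly \<times> int vec, int vec) fun_ext"
      where X: "is_extension incl_functor (sym_functor d) X" and U: "U = ext_class incl_functor (sym_functor d) X"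
      by (auto simp: Ext1_def)
    interpret X: sym_extension p l d X by unfold_locales (rule X)
    obtain c where "twisted_ext c \<sim>\<^sub>e X" using X.ex_ext_equiv_twisted by blast
    thus "U \<in> range cls"
      using ext_class_eq_cls[of X c] extension_ext_equiv_sym[OF twisted_functor_extension] U by auto
  qed
qed

text \<open>The product is a union over all pairs of representatives. Every pair contributes the
  same class, and classes are nonempty, so the union is that class.\<close>

lemma mult_Ext: "cls c \<otimes>\<^bsub>Ext\<^esub> cls c' = cls (c + c')"
proof -
  have eq: "ext_class incl_functor (sym_functor d) (baer_sum (sym_functor d) X Y) = cls (c + c')"
    if "X \<in> cls c" "Y \<in> cls c'" for X Y
    using that
    by (intro ext_class_eq_cls baer_sum_twisted)
       (auto simp: ext_class_def intro: extension_ext_equiv_sym[OF twisted_functor_extension])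
  have "twisted_ext b \<in> cls b" for b
    using twisted_functor_extension twisted_ext_equiv_iff by (simp add: ext_class_def)
  hence ne: "cls b \<noteq> {}" for b by blast
  have "cls c \<otimes>\<^bsub>Ext\<^esub> cls c' =
      (\<Union>X\<in>cls c. \<Union>Y\<in>cls c'. ext_class incl_functor (sym_functor d) (baer_sum (sym_functor d) X Y))"
    by (simp add: Ext1_def)
  also have "\<dots> = (\<Union>X\<in>cls c. \<Union>Y\<in>cls c'. cls (c + c'))"
    by (intro SUP_cong refl eq)
  also have "\<dots> = cls (c + c')" using ne by simp
  finally show ?thesis .
qed

lemma one_Ext: "\<one>\<^bsub>Ext\<^esub> = cls 0"
  by (simp add: Ext1_def direct_sum_eq_twisted_functor[of d p])

text \<open>All axioms are inherited from addition of the integer parameters, so no associativity of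
  Baer sums has to be checked on representatives.\<close>

lemma comm_group_Ext: "comm_group Ext"
proof (rule comm_groupI)
  fix x assume "x \<in> carrier Ext"
  then obtain c where "x = cls c" by (auto simp: carrier_Ext)
  hence "cls (- c) \<otimes>\<^bsub>Ext\<^esub> x = \<one>\<^bsub>Ext\<^esub>" by (simp add: mult_Ext one_Ext)
  thus "\<exists>y\<in>carrier Ext. y \<otimes>\<^bsub>Ext\<^esub> x = \<one>\<^bsub>Ext\<^esub>" by (auto simp: carrier_Ext)
qed (auto simp: carrier_Ext mult_Ext one_Ext ac_simps)

lemma cls_mod: "cls (c mod int p) = cls c"
  by (simp add: cls_eq_iff mod_eq_dvd_iff[symmetric])

lemma iso_Ext: "cls \<in> iso (integer_mod_group p) Ext"
proof -
  have car: "carrier (integer_mod_group p) = {0..<int p}"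
    using p_pos by (simp add: carrier_integer_mod_group)
  have "inj_on cls {0..<int p}"
    by (rule inj_onI) (auto simp: cls_eq_iff mod_eq_dvd_iff[symmetric])
  moreover have "cls ` {0..<int p} = carrier Ext"
  proof -
    have "cls c \<in> cls ` {0..<int p}" for c
      using p_pos by (intro image_eqI[of _ _ "c mod int p"]) (simp_all add: cls_mod)
    thus ?thesis by (auto simp: carrier_Ext)
  qed
  moreover have "cls \<in> hom (integer_mod_group p) Ext"
    by (rule homI) (auto simp: carrier_Ext mult_Ext cls_mod)
  ultimately show ?thesis by (simp add: iso_def bij_betw_def car)
qed

lemma generate_Ext: "generate Ext {cls 1} = carrier Ext"
proof
  interpret comm_group Ext by (rule comm_group_Ext)
  show "generate Ext {cls 1} \<subseteq> carrier Ext"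
    by (rule generate_incl) (auto simp: carrier_Ext)
  have gen: "cls (int k) \<in> generate Ext {cls 1}" for k
  proof (induction k)
    case 0
    show ?case using generate.one[of Ext] by (simp add: one_Ext)
  next
    case (Suc k)
    have "cls 1 \<otimes>\<^bsub>Ext\<^esub> cls (int k) \<in> generate Ext {cls 1}"
      by (rule generate.eng[OF generate.incl Suc]) simp
    thus ?case by (simp add: mult_Ext)
  qed
  \<comment> \<open>Nonnegative multiples suffice, since c may be replaced by its residue modulo
    p.\<close>
  have "cls c \<in> generate Ext {cls 1}" for c
    using gen[of "nat (c mod int p)"] p_pos by (simp add: cls_mod)
  thus "carrier Ext \<subseteq> generate Ext {cls 1}" by (auto simp: carrier_Ext)
qed

end

theorem propositionB11:
  fixes p l d :: nat
  assumes "prime p" and "l \<ge> 1" and "d = p ^ l"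
  shows "(\<exists>!E. is_E_functor p l E) \<and>
    is_extension incl_functor (sym_functor d) (sum_ext incl_functor (E_functor p l)) \<and>
    comm_group (Ext1 incl_functor (sym_functor d)) \<and>
    Ext1 incl_functor (sym_functor d) \<cong> integer_mod_group p \<and>
    generate (Ext1 incl_functor (sym_functor d))
        {ext_class incl_functor (sym_functor d) (sum_ext incl_functor (E_functor p l))}
      = carrier (Ext1 incl_functor (sym_functor d))"
proof -
  interpret prime_power p l d using assms by unfold_locales
  have "integer_mod_group p \<cong> Ext" using iso_Ext by (auto simp: is_iso_def)
  hence "Ext \<cong> integer_mod_group p" by (rule group.iso_sym[OF group_integer_mod_group])
  moreover have "\<exists>!E. is_E_functor p l E"
    using twisted_functor_is_E_functor is_E_functor_unique by (intro ex_ex1I) auto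
  \<comment> \<open>\<open>E_functor p l\<close> is the twist with parameter 1, so its class is
    \<open>cls 1\<close>.\<close>
  ultimately show ?thesis
    using twisted_functor_extension comm_group_Ext generate_Ext by (simp add: E_functor_eq)
qed

end
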